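(* Let $\mathcal{R}_{a,b,c}$ be the lattice of congruent triangles with sides $a,b,c$ and opposite angles $\alpha,\beta,\gamma$ (as defined in the context), where the triangles are obtuse or right with $\pi/2\le\alpha<\pi$. Let $\mathcal{C}$ be a rectangle with side lengths $g$ and $h$, with support function $s$, satisfying $\max_{0\le\phi<2\pi}c^*(\phi)\le c$, where $$c^*(\phi)=s(\phi)\csc\alpha+s(\phi+\alpha+\beta)\csc\beta+s(\phi+\alpha+\pi)(\cot\alpha+\cot\beta).$$ Put $u=2(g+h)$, $F=gh$, $Q=ab\sin\gamma$. Then the probabilities $p(i)$ that the randomly thrown rectangle $\mathcal{C}$ hits exactly $i$ triangles of $\mathcal{R}_{a,b,c}$ are $$p(1)=1-\frac{(a+b+c)u}{\pi Q}+\frac{(\alpha a^2+\beta b^2+\gamma c^2)(g^2+h^2)}{2\pi Q^2}+\frac{3(g^2+h^2)}{2\pi Q}+\frac{2a^2F}{\pi Q^2}+\frac{2F}{Q}-\frac{2\alpha F}{\pi Q},$$ $$p(2)=\frac{(a+b+c)u}{\pi Q}-\frac{(a^2+b^2+c^2)(g^2+h^2)}{4Q^2}-\frac{(\alpha a^2+\beta b^2+\gamma c^2)(g^2+h^2)}{2\pi Q^2}-\frac{3(g^2+h^2)}{2\pi Q}-\frac{(3a^2+b^2+c^2)F}{\pi Q^2}-\frac{2F}{Q}+\frac{2\alpha F}{\pi Q},$$ $$p(3)=\frac{(a^2+b^2+c^2)(g^2+h^2)}{2Q^2}-\frac{(\alpha a^2+\beta b^2+\gamma c^2)(g^2+h^2)}{2\pi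 Q^2}-\frac{3(g^2+h^2)}{2\pi Q}+\frac{2(b^2+c^2)F}{\pi Q^2}-\frac{2F}{Q}+\frac{2\alpha F}{\pi Q},$$ $$p(4)=\frac{3(g^2+h^2)}{2\pi Q}-\frac{(a^2+b^2+c^2)(g^2+h^2)}{4Q^2}+\frac{(\alpha a^2+\beta b^2+\gamma c^2)(g^2+h^2)}{2\pi Q^2}-\frac{(b^2+c^2-a^2)F}{\pi Q^2}+\frac{F}{Q}-\frac{2\alpha F}{\pi Q},$$ $$p(5)=0,\qquad p(6)=\frac{F}{Q}.$$
   Context: Lattice. Fix a triangle with sides $a,b,c$ and opposite angles $\alpha,\beta,\gamma$, and altitudes $h_a=b\sin\gamma=c\sin\beta$, $h_b=a\sin\gamma=c\sin\alpha$, $h_c=a\sin\beta=b\sin\alpha$. The lattice $\mathcal{R}_{a,b,c}$ is the union of the three families of parallel lines $\{x\sin\beta+y\cos\beta=kh_a\}$, $\{x\sin\alpha-y\cos\alpha=kh_b\}$, $\{y=kh_c\}$, $k\in\mathbb{Z}$, in $\mathbb{R}^2$. These lines cut the plane into triangles ("the triangles of $\mathcal{R}_{a,b,c}$"), all congruent to $\mathcal{T}=\{(x,y): 0\le y\le h_c,\ y\cot\alpha\le x\le c-y\cot\beta\}$. Two triangles form a parallelogram congruent to $\mathcal{Q}=\{(x,y): 0\le y\le h_c,\ y\cot\alpha\le x\le c+y\cot\alpha\}$, whose area is $Q=ab\sin\gamma=ac\sin\beta=bc\sin\alpha$. Body. The planar convex body $\mathcal{C}$ is provided with a fixed reference point $O$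 in $\mathcal{C}$ and a fixed oriented line segment $\sigma$ starting in $O$, both moving rigidly with $\mathcal{C}$. Support function $s:\mathbb{R}\to\mathbb{R}$: place $\mathcal{C}$ with $O$ at the origin of a Cartesian coordinate system and rotated so that the (counterclockwise) angle from the positive $x$-axis to $\sigma$ is $\phi$; then $s(\phi)$ is the distance from the origin to the support line of $\mathcal{C}$ perpendicular to the $x$-axis on the side of the positive $x$-axis, i.e. $s(\phi)$ is the maximal $x$-coordinate of the points of $\mathcal{C}$ in this position. Random throw of $\mathcal{C}$ onto $\mathcal{R}_{a,b,c}$: only rotations and translations of $\mathcal{C}$ are used; the position $(x,y)$ of $O$ is uniformly distributed in $\mathcal{Q}$ (so $y$ is uniform in $[0,h_c]$ and, given $y$, $x$ is uniform in $[y\cot\alpha,\,h_b\csc\alpha+y\cot\alpha]$, where $h_b\csc\alpha=c$), and the angle $\phi$ from a fixed direction perpendicular to the sides $b$ to the segment $\sigma$ is uniformly distributed in $[0,2\pi]$ and independent of $(x,y)$. The body hits a triangle if it has nonempty intersection with it; $p(i)$ is the probability that exactly $i$ triangles of $\mathcal{R}_{a,b,c}$ are hit. The quantity $c^*(\phi)$ is the length of the side corresponding to $c$ of the triangle similar to $\mathcal{T}$ (with parallel sides) all of whose sides touch $\mathcal{C}$ in direction $\phi$; the condition $\max c^*\le c$ expresses that in every direction $\mathcal{C}$ fits into a single triangle of the lattice. *)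

theory Defs
  imports "HOL-Probability.Probability"
begin

type_synonym point = "real \<times> real"

definition angle_at :: "point \<Rightarrow> point \<Rightarrow> point \<Rightarrow> real" where
  "angle_at A B C = arccos (((B - A) \<bullet> (C - A)) / (norm (B - A) * norm (C - A)))"

definition triangle_sides_angles ::
  "real \<Rightarrow> real \<Rightarrow> real \<Rightarrow> real \<Rightarrow> real \<Rightarrow> real \<Rightarrow> bool" where
  "triangle_sides_angles a b c \<alpha> \<beta> \<gamma> \<longleftrightarrow>
     (\<exists>A B C :: point. \<not> collinear {A, B, C} \<and>
        a = dist B C \<and> b = dist C A \<and> c = dist A B \<and>
        \<alpha> = angle_at A B C \<and> \<beta> = angle_at B C A \<and> \<gamma> = angle_at C A B)"

(* The three families of parallel lines; c sin \<beta>, c sin \<alpha>, b sin \<alpha> are the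
   altitudes onto the sides a, b, c. The triangle with vertices (0, 0), (c, 0) and
   (b cos \<alpha>, b sin \<alpha>) is one of those cut out. *)
definition tri_lattice :: "real \<Rightarrow> real \<Rightarrow> real \<Rightarrow> real \<Rightarrow> point set" where
  "tri_lattice b c \<alpha> \<beta> =
     (\<Union>k::int. {(x, y). x * sin \<beta> + y * cos \<beta> = of_int k * (c * sin \<beta>)}) \<union>
     (\<Union>k::int. {(x, y). x * sin \<alpha> - y * cos \<alpha> = of_int k * (c * sin \<alpha>)}) \<union>
     (\<Union>k::int. {(x, y). y = of_int k * (b * sin \<alpha>)})"

definition lattice_triangles :: "real \<Rightarrow> real \<Rightarrow> real \<Rightarrow> real \<Rightarrow> point set set" where
  "lattice_triangles b c \<alpha> \<beta> = closure ` components (- tri_lattice b c \<alpha> \<beta>)"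

definition lattice_parallelogram :: "real \<Rightarrow> real \<Rightarrow> real \<Rightarrow> point set" where
  "lattice_parallelogram b c \<alpha> =
     {(x, y). 0 \<le> y \<and> y \<le> b * sin \<alpha> \<and> y * cot \<alpha> \<le> x \<and> x \<le> c + y * cot \<alpha>}"

definition rot :: "real \<Rightarrow> point \<Rightarrow> point" where
  "rot \<theta> p = (fst p * cos \<theta> - snd p * sin \<theta>, fst p * sin \<theta> + snd p * cos \<theta>)"

(* A body is given in its own coordinate frame: its reference point O is the origin
   and the oriented segment \<sigma> points along the positive x-axis. *)

definition is_rectangle :: "real \<Rightarrow> real \<Rightarrow> point set \<Rightarrow> bool" where
  "is_rectangle g h C \<longleftrightarrow> (\<exists>v \<theta>. C = (\<lambda>p. v + rot \<theta> p) ` ({0..g} \<times> {0..h}))"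

definition support_fun :: "point set \<Rightarrow> real \<Rightarrow> real" where
  "support_fun C \<phi> = (SUP p\<in>C. fst (rot \<phi> p))"

definition c_star :: "point set \<Rightarrow> real \<Rightarrow> real \<Rightarrow> real \<Rightarrow> real" where
  "c_star C \<alpha> \<beta> \<phi> =
     support_fun C \<phi> * (1 / sin \<alpha>) + support_fun C (\<phi> + \<alpha> + \<beta>) * (1 / sin \<beta>) +
     support_fun C (\<phi> + \<alpha> + pi) * (cot \<alpha> + cot \<beta>)"

(* The angle \<phi> is counted from (- sin \<alpha>, cos \<alpha>), i.e. the direction \<alpha> + pi / 2. It is the
   normal of the sides b that points out of the triangle with vertices (0, 0), (c, 0) and
   (b cos \<alpha>, b sin \<alpha>), and so the one for which c_star has its geometric meaning. *)
definition placed :: "real \<Rightarrow> point set \<Rightarrow> point \<Rightarrow> real \<Rightarrow> point set" where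
  "placed \<alpha> C P \<phi> = (\<lambda>p. P + rot (\<phi> + \<alpha> + pi / 2) p) ` C"

definition hit_count ::
  "real \<Rightarrow> real \<Rightarrow> real \<Rightarrow> real \<Rightarrow> point set \<Rightarrow> point \<Rightarrow> real \<Rightarrow> nat" where
  "hit_count b c \<alpha> \<beta> C P \<phi> =
     card {T \<in> lattice_triangles b c \<alpha> \<beta>. T \<inter> placed \<alpha> C P \<phi> \<noteq> {}}"

definition random_throw :: "real \<Rightarrow> real \<Rightarrow> real \<Rightarrow> (point \<times> real) measure" where
  "random_throw b c \<alpha> =
     uniform_measure lborel (lattice_parallelogram b c \<alpha>) \<Otimes>\<^sub>M uniform_measure lborel {0..2 * pi}"

definition hit_prob :: "real \<Rightarrow> real \<Rightarrow> real \<Rightarrow> real \<Rightarrow> point set \<Rightarrow> nat \<Rightarrow> real" where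
  "hit_prob b c \<alpha> \<beta> C i =
     measure (random_throw b c \<alpha>) {(P, \<phi>). hit_count b c \<alpha> \<beta> C P \<phi> = i}"

end

theory Submission
  imports Defs
begin

text \<open>In the skew coordinates $s$, $t$ along two sides of the triangle the three families of lines become
$s \in \<int>$, $t \in \<int>$ and $s + t \in \<int>$, and the position of the reference point is uniform in
the unit square. Fix the direction of the body and let $A$, $B$, $w$ be its widths measured by $s$, $t$ and
$s + t$. Since the body fits into a triangle, it crosses, outside a null set of positions, at most one line of
each family and covers at most one lattice point. If it covers no lattice point, each crossed line adds one triangle, so that it hits
$1 + N$ triangles where $N \<le> 3$ is the number of crossed lines; around a covered lattice point it hits all
six triangles (lemma \<open>count_generic\<close>, built on the lemmas of the third section).

A single family is crossed with probability $A$, $B$ or $w$, and two families are crossed independently,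
because any two of $s$, $t$, $s + t$ are independent and uniform modulo 1 (\<open>emeasure_cross\<close>). The positions
with $N = 0$ form two corner triangles (\<open>emeasure_no_cross\<close>). Here the rectangle enters: it is centrally
symmetric, so the triangle circumscribed about it has size $c^* = c (A + B + w) / 2$, the same for both
orientations, and the two corner triangles are congruent with joint area $(1 - (A + B + w) / 2)^2$. The
probability of covering a lattice point is the area of the body in skew coordinates, $F / Q$.
Inclusion-exclusion over the three families then determines the probability of every count for the fixed
direction as a quadratic polynomial in $A$, $B$, $w$ (\<open>count_prob\<close>).

It remains to average over the direction. The widths are multiples of
$g |\sin x| + h |\cos x|$ at angles which differ by the angles of the triangle, so only the integrals of
products of two such functions are needed (\<open>has_integral_rect_width_mult\<close>). The integral of
$|\sin x \cos (x + \delta)|$ has different closed forms for acute and for obtuse $\delta$; this is why the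
formulas assume that $\alpha$ is not acute. The laws of sines and cosines turn the result into the stated
form.\<close>

section \<open>Sides and angles of a triangle\<close>

text \<open>The strict bounds on the angle come from the strict Cauchy-Schwarz inequality for vectors that are
not collinear.\<close>

lemma angle_at_law_of_cosines:
  fixes A B C :: point
  assumes nc: "\<not> collinear {A, B, C}"
  shows "dist A B * dist C A * cos (angle_at A B C) = ((dist C A)\<^sup>2 + (dist A B)\<^sup>2 - (dist B C)\<^sup>2) / 2"
    and "0 < angle_at A B C" and "angle_at A B C < pi"
    and "dist A B > 0"
proof -
  define x y where "x = B - A" and "y = C - A"
  have "\<not> collinear {0, x, y}"
    using nc collinear_3[of B A C] by (simp add: x_def y_def insert_commute)
  then have less: "\<bar>x \<bullet> y\<bar> < norm x * norm y"
    using Cauchy_Schwarz_ineq2[of x y] norm_cauchy_schwarz_equal[of x y] by linarith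
  then have pos: "norm x * norm y > 0" by linarith
  have q: "-1 < (x \<bullet> y) / (norm x * norm y)" "(x \<bullet> y) / (norm x * norm y) < 1"
    using less pos by (simp_all add: pos_less_divide_eq pos_divide_less_eq abs_less_iff)
  have ang: "angle_at A B C = arccos ((x \<bullet> y) / (norm x * norm y))"
    by (simp add: angle_at_def x_def y_def)
  have d: "dist A B = norm x" "dist C A = norm y" "dist B C = norm (x - y)"
    by (simp_all add: x_def y_def dist_norm norm_minus_commute)
  show "0 < angle_at A B C" "angle_at A B C < pi"
    using arccos_lt_bounded[OF q] by (simp_all add: ang)
  show "dist A B > 0" using pos by (auto simp: d)
  have "cos (angle_at A B C) = (x \<bullet> y) / (norm x * norm y)"
    using q by (simp add: ang cos_arccos)
  moreover have e: "(x \<bullet> y) * 2 = (norm y)\<^sup>2 + (norm x)\<^sup>2 - (norm (x - y))\<^sup>2"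
    by (simp add: dot_norm_neg)
  ultimately show "dist A B * dist C A * cos (angle_at A B C) = ((dist C A)\<^sup>2 + (dist A B)\<^sup>2 - (dist B C)\<^sup>2) / 2"
    using pos e unfolding d by simp
qed

text \<open>By the law of cosines the square of $2 a b \sin \gamma$ is a symmetric polynomial in the squares of the
sides (Heron's formula), so the three expressions for twice the area agree. From them and the addition theorems
$\cos (\alpha + \beta) = - \cos \gamma$ and $\sin (\alpha + \beta) = \sin \gamma > 0$, whence
the sum of the angles.\<close>

lemma triangle_laws:
  assumes "triangle_sides_angles a b c \<alpha> \<beta> \<gamma>"
  shows "0 < a" "0 < b" "0 < c" "0 < \<alpha>" "\<alpha> < pi" "0 < \<beta>" "\<beta> < pi" "0 < \<gamma>" "\<gamma> < pi"
    and "2 * b * c * cos \<alpha> = b\<^sup>2 + c\<^sup>2 - a\<^sup>2"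
    and "2 * c * a * cos \<beta> = c\<^sup>2 + a\<^sup>2 - b\<^sup>2"
    and "2 * a * b * cos \<gamma> = a\<^sup>2 + b\<^sup>2 - c\<^sup>2"
    and "b * c * sin \<alpha> = a * b * sin \<gamma>" "c * a * sin \<beta> = a * b * sin \<gamma>"
    and "\<alpha> + \<beta> + \<gamma> = pi"
proof -
  obtain A B C :: point where nc: "\<not> collinear {A, B, C}" and
    eq: "a = dist B C" "b = dist C A" "c = dist A B"
    "\<alpha> = angle_at A B C" "\<beta> = angle_at B C A" "\<gamma> = angle_at C A B"
    using assms unfolding triangle_sides_angles_def by blast
  have nc': "\<not> collinear {B, C, A}" "\<not> collinear {C, A, B}"
    using nc by (simp_all add: insert_commute)
  note facts = angle_at_law_of_cosines[OF nc, folded eq] angle_at_law_of_cosines[OF nc'(1), folded eq]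
    angle_at_law_of_cosines[OF nc'(2), folded eq]
  show pos: "0 < a" "0 < b" "0 < c" and al: "0 < \<alpha>" "\<alpha> < pi" and be: "0 < \<beta>" "\<beta> < pi"
    and ga: "0 < \<gamma>" "\<gamma> < pi" by (fact facts)+
  show cosa: "2 * b * c * cos \<alpha> = b\<^sup>2 + c\<^sup>2 - a\<^sup>2"
    and cosb: "2 * c * a * cos \<beta> = c\<^sup>2 + a\<^sup>2 - b\<^sup>2"
    and cosc: "2 * a * b * cos \<gamma> = a\<^sup>2 + b\<^sup>2 - c\<^sup>2"
    using facts by (simp_all add: algebra_simps)
  have sq: "(2 * x * y * sin t)\<^sup>2 = 4 * x\<^sup>2 * y\<^sup>2 - (2 * x * y * cos t)\<^sup>2" for x y t :: real
    by (simp only: power_mult_distrib sin_squared_eq right_diff_distrib) simp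
  have sina: "sin \<alpha> > 0" "sin \<beta> > 0" "sin \<gamma> > 0"
    using al be ga by (auto intro: sin_gt_zero)
  have heron: "(2 * b * c * sin \<alpha>)\<^sup>2 = (2 * a * b * sin \<gamma>)\<^sup>2" "(2 * c * a * sin \<beta>)\<^sup>2 = (2 * a * b * sin \<gamma>)\<^sup>2"
    unfolding sq cosa cosb cosc by algebra+
  have "2 * b * c * sin \<alpha> = 2 * a * b * sin \<gamma>"
    by (rule power2_eq_imp_eq[OF heron(1)]) (use pos sina in simp_all)
  then show area: "b * c * sin \<alpha> = a * b * sin \<gamma>" by simp
  have "2 * c * a * sin \<beta> = 2 * a * b * sin \<gamma>"
    by (rule power2_eq_imp_eq[OF heron(2)]) (use pos sina in simp_all)
  then show area': "c * a * sin \<beta> = a * b * sin \<gamma>" by simp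
  have "2 * (a * b * c\<^sup>2) * sin (\<alpha> + \<beta>) =
      (b * c * sin \<alpha>) * (2 * c * a * cos \<beta>) + (2 * b * c * cos \<alpha>) * (c * a * sin \<beta>)"
    by (simp add: sin_add power2_eq_square algebra_simps)
  also have "\<dots> = 2 * (a * b * c\<^sup>2) * sin \<gamma>"
    unfolding area area' cosa cosb by (simp add: algebra_simps power2_eq_square)
  finally have s: "sin (\<alpha> + \<beta>) = sin \<gamma>" using pos by simp
  have "4 * (a * b * c\<^sup>2) * cos (\<alpha> + \<beta>) =
      (2 * b * c * cos \<alpha>) * (2 * c * a * cos \<beta>) - 4 * (b * c * sin \<alpha>) * (c * a * sin \<beta>)"
    by (simp add: cos_add power2_eq_square algebra_simps)
  moreover have "4 * (b * c * sin \<alpha>) * (c * a * sin \<beta>) = (2 * a * b * sin \<gamma>)\<^sup>2"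
    unfolding area area' by (simp add: power2_eq_square)
  moreover have "(b\<^sup>2 + c\<^sup>2 - a\<^sup>2) * (c\<^sup>2 + a\<^sup>2 - b\<^sup>2) - (4 * a\<^sup>2 * b\<^sup>2 - (a\<^sup>2 + b\<^sup>2 - c\<^sup>2)\<^sup>2)
      = - (2 * c\<^sup>2) * (a\<^sup>2 + b\<^sup>2 - c\<^sup>2)"
    by algebra
  moreover have "- (2 * c\<^sup>2) * (2 * a * b * cos \<gamma>) = 4 * (a * b * c\<^sup>2) * (- cos \<gamma>)"
    by simp
  ultimately have "4 * (a * b * c\<^sup>2) * cos (\<alpha> + \<beta>) = 4 * (a * b * c\<^sup>2) * (- cos \<gamma>)"
    by (simp only: sq cosa cosb cosc)
  then have "cos (\<alpha> + \<beta>) = - cos \<gamma>"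
    using pos by (subst (asm) mult_left_cancel) auto
  then have ceq: "cos (\<alpha> + \<beta>) = cos (pi - \<gamma>)" by simp
  have lt: "\<alpha> + \<beta> < pi"
  proof (rule ccontr)
    assume "\<not> \<alpha> + \<beta> < pi"
    then have "sin (\<alpha> + \<beta> - pi) \<ge> 0" using al be by (intro sin_ge_zero) auto
    then show False using s sina by simp
  qed
  have "\<alpha> + \<beta> = pi - \<gamma>"
    by (rule cos_inj_pi[OF _ _ _ _ ceq]) (use lt al be ga in linarith)+
  then show "\<alpha> + \<beta> + \<gamma> = pi" by simp
qed

section \<open>The lattice in skew coordinates\<close>

text \<open>The intersection of three strips, one from each family of lines. It has interior points for a
suitable position of the strips only, namely for indices in \<open>cell_index\<close>; these cells are the triangles
of the lattice in skew coordinates.\<close>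

definition cell :: "int \<times> int \<times> int \<Rightarrow> point set" where
  "cell = (\<lambda>(i, j, k). {z. of_int i \<le> fst z \<and> fst z \<le> of_int i + 1 \<and> of_int j \<le> snd z \<and> snd z \<le> of_int j + 1 \<and>
     of_int k \<le> fst z + snd z \<and> fst z + snd z \<le> of_int k + 1})"

definition open_cell :: "int \<times> int \<times> int \<Rightarrow> point set" where
  "open_cell = (\<lambda>(i, j, k). {z. of_int i < fst z \<and> fst z < of_int i + 1 \<and> of_int j < snd z \<and> snd z < of_int j + 1 \<and>
     of_int k < fst z + snd z \<and> fst z + snd z < of_int k + 1})"

definition cell_index :: "(int \<times> int \<times> int) set" where
  "cell_index = {(i, j, k). k = i + j \<or> k = i + j + 1}"

definition cell_count :: "point set \<Rightarrow> nat" where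
  "cell_count X = card {n \<in> cell_index. cell n \<inter> X \<noteq> {}}"

text \<open>The coordinates $s$ and $t$: multiplied by $c$ and $b$ they are the components along the sides
$c$ and $b$, with $(0, 0)$ as origin.\<close>

definition skew_coords :: "real \<Rightarrow> real \<Rightarrow> real \<Rightarrow> point \<Rightarrow> point" where
  "skew_coords b c \<alpha> P = ((fst P * sin \<alpha> - snd P * cos \<alpha>) / (c * sin \<alpha>), snd P / (b * sin \<alpha>))"

definition from_skew :: "real \<Rightarrow> real \<Rightarrow> real \<Rightarrow> point \<Rightarrow> point" where
  "from_skew b c \<alpha> z = (fst z * c + snd z * (b * cos \<alpha>), snd z * (b * sin \<alpha>))"

lemma linear_skew_coords: "linear (skew_coords b c \<alpha>)"
  by (rule linearI) (auto simp: skew_coords_def algebra_simps add_divide_distrib diff_divide_distrib)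

lemma linear_from_skew: "linear (from_skew b c \<alpha>)"
  by (rule linearI) (auto simp: from_skew_def algebra_simps)

lemma skew_coords_inverse:
  assumes "b > 0" "c > 0" "sin \<alpha> > 0"
  shows "skew_coords b c \<alpha> (from_skew b c \<alpha> z) = z" "from_skew b c \<alpha> (skew_coords b c \<alpha> P) = P"
  using assms by (auto simp: skew_coords_def from_skew_def field_simps prod_eq_iff)

lemma from_skew_image:
  assumes "b > 0" "c > 0" "sin \<alpha> > 0"
  shows "from_skew b c \<alpha> ` X = skew_coords b c \<alpha> -` X"
proof (intro equalityI subsetI)
  show "P \<in> skew_coords b c \<alpha> -` X" if "P \<in> from_skew b c \<alpha> ` X" for P
    using that skew_coords_inverse(1)[OF assms] by (elim imageE) simp
  show "P \<in> from_skew b c \<alpha> ` X" if "P \<in> skew_coords b c \<alpha> -` X" for P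
    by (rule image_eqI[of _ _ "skew_coords b c \<alpha> P"])
       (use that skew_coords_inverse(2)[OF assms] in simp_all)
qed

lemma halfplane_cells:
  "cell (i, j, k) = {z. (1, 0) \<bullet> z \<ge> of_int i} \<inter> {z. (1, 0) \<bullet> z \<le> of_int i + 1} \<inter>
     {z. (0, 1) \<bullet> z \<ge> of_int j} \<inter> {z. (0, 1) \<bullet> z \<le> of_int j + 1} \<inter>
     {z. (1, 1) \<bullet> z \<ge> of_int k} \<inter> {z. (1, 1) \<bullet> z \<le> of_int k + (1::real)}"
  "open_cell (i, j, k) = {z. (1, 0) \<bullet> z > of_int i} \<inter> {z. (1, 0) \<bullet> z < of_int i + 1} \<inter>
     {z. (0, 1) \<bullet> z > of_int j} \<inter> {z. (0, 1) \<bullet> z < of_int j + 1} \<inter>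
     {z. (1, 1) \<bullet> z > of_int k} \<inter> {z. (1, 1) \<bullet> z < of_int k + (1::real)}"
  by (auto simp: cell_def open_cell_def inner_prod_def)

lemma interior_cell: "interior (cell n) = open_cell n"
proof (cases n)
  case (fields i j k)
  have "(1::real, 0::real) \<noteq> 0" "(0::real, 1::real) \<noteq> 0" "(1::real, 1::real) \<noteq> 0"
    by (simp_all add: zero_prod_def)
  then show ?thesis unfolding fields halfplane_cells interior_Int by simp
qed

lemma closed_cell: "closed (cell n)" and convex_cell: "convex (cell n)"
  and convex_open_cell: "convex (open_cell n)"
  by (cases n; simp add: halfplane_cells closed_Int closed_halfspace_le closed_halfspace_ge
      convex_Int convex_halfspace_le convex_halfspace_ge convex_halfspace_lt convex_halfspace_gt)+

lemma open_cell_nonempty: "n \<in> cell_index \<Longrightarrow> open_cell n \<noteq> {}"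
proof -
  assume "n \<in> cell_index"
  then obtain i j k where n: "n = (i, j, k)" "k = i + j \<or> k = i + j + 1"
    by (auto simp: cell_index_def)
  then have "(of_int i + 1/3, of_int j + 1/3) \<in> open_cell n \<or> (of_int i + 2/3, of_int j + 2/3) \<in> open_cell n"
    by (auto simp: open_cell_def)
  then show ?thesis by blast
qed

lemma open_cell_disjoint: "z \<in> open_cell m \<Longrightarrow> z \<in> open_cell n \<Longrightarrow> m = n"
proof -
  have "i = \<lfloor>fst z\<rfloor> \<and> j = \<lfloor>snd z\<rfloor> \<and> k = \<lfloor>fst z + snd z\<rfloor>" if "z \<in> open_cell (i, j, k)" for i j k
    using that by (auto simp: open_cell_def intro!: floor_unique[symmetric])
  then show "z \<in> open_cell m \<Longrightarrow> z \<in> open_cell n \<Longrightarrow> m = n"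
    by (cases m; cases n) metis
qed

lemma closure_open_cell: "n \<in> cell_index \<Longrightarrow> closure (open_cell n) = cell n"
  using convex_closure_interior[OF convex_cell, of n] open_cell_nonempty[of n] closed_cell[of n]
  by (simp add: interior_cell closure_closed)

lemma Union_open_cells:
  "(\<Union>n\<in>cell_index. open_cell n) = {z. fst z \<notin> \<int> \<and> snd z \<notin> \<int> \<and> fst z + snd z \<notin> \<int>}" (is "?L = ?R")
proof (intro equalityI subsetI)
  have non_int: "x \<notin> \<int>" if "of_int i < x" "x < of_int i + 1" for x :: real and i :: int
  proof
    assume "x \<in> \<int>"
    then obtain m :: int where "x = of_int m" by (elim Ints_cases)
    then have "i < m" "m < i + 1" using that by linarith+
    then show False by simp
  qed
  show "z \<in> ?R" if "z \<in> ?L" for z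
    using that by (auto simp: open_cell_def dest: non_int[rotated 1])
next
  fix z assume z: "z \<in> ?R"
  have fl: "of_int \<lfloor>x\<rfloor> < x" "x < of_int \<lfloor>x\<rfloor> + 1" if "x \<notin> \<int>" for x :: real
    using that of_int_floor_le[of x] by (metis Ints_of_int less_le, linarith)
  have "\<lfloor>fst z + snd z\<rfloor> = \<lfloor>fst z\<rfloor> + \<lfloor>snd z\<rfloor> \<or> \<lfloor>fst z + snd z\<rfloor> = \<lfloor>fst z\<rfloor> + \<lfloor>snd z\<rfloor> + 1"
    by linarith
  then have "(\<lfloor>fst z\<rfloor>, \<lfloor>snd z\<rfloor>, \<lfloor>fst z + snd z\<rfloor>) \<in> cell_index"
    by (simp add: cell_index_def)
  moreover have "z \<in> open_cell (\<lfloor>fst z\<rfloor>, \<lfloor>snd z\<rfloor>, \<lfloor>fst z + snd z\<rfloor>)"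
    using z fl by (simp add: open_cell_def)
  ultimately show "z \<in> ?L" by blast
qed

text \<open>The hypothesis \<open>area\<close> equates two expressions for the altitude on the side $a$. It makes
$s + t$ equal to $(x \sin \beta + y \cos \beta) / (c \sin \beta)$, so that the third family of lines
becomes $s + t \in \<int>$.\<close>

lemma tri_lattice_skew:
  assumes pos: "b > 0" "c > 0" "sin \<alpha> > 0" "sin \<beta> > 0" and area: "b * sin (\<alpha> + \<beta>) = c * sin \<beta>"
  shows "- tri_lattice b c \<alpha> \<beta> = from_skew b c \<alpha> ` (\<Union>n\<in>cell_index. open_cell n)"
proof -
  have r: "(x * sin \<beta> + y * cos \<beta>) / (c * sin \<beta>) = fst (skew_coords b c \<alpha> (x, y)) + snd (skew_coords b c \<alpha> (x, y))" for x y
  proof -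
    have "x * sin \<beta> + y * cos \<beta> = ((x * sin \<alpha> - y * cos \<alpha>) * sin \<beta> + y * sin (\<alpha> + \<beta>)) / sin \<alpha>"
      using pos by (simp add: sin_add field_simps)
    then have "(x * sin \<beta> + y * cos \<beta>) / (c * sin \<beta>)
        = (x * sin \<alpha> - y * cos \<alpha>) / (c * sin \<alpha>) + y * sin (\<alpha> + \<beta>) / (sin \<alpha> * (c * sin \<beta>))"
      using pos by (simp add: add_divide_distrib mult.commute)
    also have "y * sin (\<alpha> + \<beta>) / (sin \<alpha> * (c * sin \<beta>)) = y / (b * sin \<alpha>)"
    proof -
      have "sin (\<alpha> + \<beta>) \<noteq> 0" using pos area by (metis mult_pos_pos less_irrefl mult_zero_right)
      then show ?thesis using pos unfolding area[symmetric] by simp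
    qed
    finally show ?thesis by (simp add: skew_coords_def)
  qed
  have ints: "(\<exists>k::int. X = of_int k * d) \<longleftrightarrow> X / d \<in> \<int>" if "d > 0" for X d :: real
    using that by (auto simp: field_simps elim!: Ints_cases)
  have "(x, y) \<in> tri_lattice b c \<alpha> \<beta> \<longleftrightarrow>
      (let z = skew_coords b c \<alpha> (x, y) in fst z \<in> \<int> \<or> snd z \<in> \<int> \<or> fst z + snd z \<in> \<int>)" for x y
  proof -
    have "(x, y) \<in> tri_lattice b c \<alpha> \<beta> \<longleftrightarrow> (x * sin \<beta> + y * cos \<beta>) / (c * sin \<beta>) \<in> \<int> \<or>
        (x * sin \<alpha> - y * cos \<alpha>) / (c * sin \<alpha>) \<in> \<int> \<or> y / (b * sin \<alpha>) \<in> \<int>"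
      using pos by (simp add: tri_lattice_def ints)
    then show ?thesis unfolding r by (auto simp: skew_coords_def Let_def)
  qed
  then have "- tri_lattice b c \<alpha> \<beta> = skew_coords b c \<alpha> -` (\<Union>n\<in>cell_index. open_cell n)"
    unfolding Union_open_cells by (auto simp: Let_def)
  also have "\<dots> = from_skew b c \<alpha> ` (\<Union>n\<in>cell_index. open_cell n)"
    by (simp add: from_skew_image[OF pos(1-3)])
  finally show ?thesis .
qed

text \<open>The open cells are open, connected and pairwise disjoint, hence they are the components of their
union.\<close>

lemma lattice_triangles_skew:
  assumes pos: "b > 0" "c > 0" "sin \<alpha> > 0" "sin \<beta> > 0" and area: "b * sin (\<alpha> + \<beta>) = c * sin \<beta>"
  shows "lattice_triangles b c \<alpha> \<beta> = (\<lambda>n. from_skew b c \<alpha> ` cell n) ` cell_index"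
proof -
  let ?L = "from_skew b c \<alpha>"
  have inj: "inj ?L" using skew_coords_inverse(1)[OF pos(1-3)] by (metis injI)
  note img = from_skew_image[OF pos(1-3)]
  have "components (- tri_lattice b c \<alpha> \<beta>) = (\<lambda>n. ?L ` open_cell n) ` cell_index"
  proof (rule components_open_unique)
    show "pairwise disjnt ((\<lambda>n. ?L ` open_cell n) ` cell_index)"
    proof (rule pairwise_imageI)
      fix m n :: "int \<times> int \<times> int" assume "m \<noteq> n"
      then have "open_cell m \<inter> open_cell n = {}" using open_cell_disjoint by blast
      then show "disjnt (?L ` open_cell m) (?L ` open_cell n)"
        unfolding img disjnt_def by (simp flip: vimage_Int)
    qed
    show "\<Union> ((\<lambda>n. ?L ` open_cell n) ` cell_index) = - tri_lattice b c \<alpha> \<beta>"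
      unfolding tri_lattice_skew[OF assms] by blast
  next
    fix X assume "X \<in> (\<lambda>n. ?L ` open_cell n) ` cell_index"
    then obtain n where n: "n \<in> cell_index" "X = ?L ` open_cell n" by blast
    have "open (open_cell n)" by (simp flip: interior_cell)
    then have "open (?L ` open_cell n)"
      unfolding img
      by (intro open_vimage linear_continuous_on linear_conv_bounded_linear[THEN iffD1] linear_skew_coords)
    moreover have "connected (?L ` open_cell n)"
      using convex_open_cell linear_from_skew by (intro convex_connected convex_linear_image)
    ultimately show "open X \<and> connected X \<and> X \<noteq> {}" using n open_cell_nonempty by simp
  qed
  then have "lattice_triangles b c \<alpha> \<beta> = (\<lambda>n. closure (?L ` open_cell n)) ` cell_index"
    unfolding lattice_triangles_def by (simp add: image_image)
  also have "\<dots> = (\<lambda>n. ?L ` cell n) ` cell_index"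
    by (intro image_cong refl) (simp add: closure_injective_linear_image[OF linear_from_skew inj, symmetric] closure_open_cell)
  finally show ?thesis .
qed

lemma hit_count_skew:
  assumes pos: "b > 0" "c > 0" "sin \<alpha> > 0" "sin \<beta> > 0" and area: "b * sin (\<alpha> + \<beta>) = c * sin \<beta>"
  shows "hit_count b c \<alpha> \<beta> C P \<phi> = cell_count (skew_coords b c \<alpha> ` placed \<alpha> C P \<phi>)"
proof -
  let ?L = "from_skew b c \<alpha>" and ?Y = "placed \<alpha> C P \<phi>"
  have inj: "inj ?L" using skew_coords_inverse(1)[OF pos(1-3)] by (metis injI)
  have "inj_on (\<lambda>n. ?L ` cell n) cell_index"
  proof (rule inj_onI)
    fix m n assume mn: "m \<in> cell_index" "n \<in> cell_index" "?L ` cell m = ?L ` cell n"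
    then have "cell m = cell n" using inj by (simp add: inj_image_eq_iff)
    then have "open_cell m = open_cell n" by (metis interior_cell)
    then show "m = n" using open_cell_disjoint open_cell_nonempty mn by blast
  qed
  then have "inj_on (\<lambda>n. ?L ` cell n) {n \<in> cell_index. ?L ` cell n \<inter> ?Y \<noteq> {}}"
    by (rule inj_on_subset) blast
  moreover have "{T \<in> lattice_triangles b c \<alpha> \<beta>. T \<inter> ?Y \<noteq> {}} =
      (\<lambda>n. ?L ` cell n) ` {n \<in> cell_index. ?L ` cell n \<inter> ?Y \<noteq> {}}"
    unfolding lattice_triangles_skew[OF assms] by blast
  ultimately have "hit_count b c \<alpha> \<beta> C P \<phi> = card {n \<in> cell_index. ?L ` cell n \<inter> ?Y \<noteq> {}}"
    unfolding hit_count_def by (simp add: card_image)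
  also have "{n \<in> cell_index. ?L ` cell n \<inter> ?Y \<noteq> {}} = {n \<in> cell_index. cell n \<inter> skew_coords b c \<alpha> ` ?Y \<noteq> {}}"
  proof -
    have "?L ` cell n \<inter> ?Y \<noteq> {} \<longleftrightarrow> cell n \<inter> skew_coords b c \<alpha> ` ?Y \<noteq> {}" for n
      unfolding from_skew_image[OF pos(1-3)] by blast
    then show ?thesis by simp
  qed
  finally show ?thesis by (simp add: cell_count_def)
qed

text \<open>The parameters for which a compact body meets a closed cell form a closed set, as the projection
of a closed set along a compact one, and there are only countably many cells. Exact Borel measurability matters
because the distribution of a random throw is not completed.\<close>

lemma measurable_cell_count:
  fixes h :: "point \<times> 'a::euclidean_space \<Rightarrow> point"
  assumes K: "compact K" and h: "continuous_on UNIV h"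
  shows "(\<lambda>x. cell_count ((\<lambda>p. h (p, x)) ` K)) \<in> borel \<rightarrow>\<^sub>M count_space UNIV"
proof -
  define S where "S x = to_nat ` {n \<in> cell_index. cell n \<inter> (\<lambda>p. h (p, x)) ` K \<noteq> {}}" for x
  have card: "cell_count ((\<lambda>p. h (p, x)) ` K) = card (S x)" for x
    by (simp add: S_def cell_count_def card_image)
  have "{x. i \<in> S x} \<in> sets borel" for i
  proof (cases "\<exists>n \<in> cell_index. i = to_nat n")
    case True
    then obtain n where n: "n \<in> cell_index" "i = to_nat n" by blast
    have "{x. i \<in> S x} = {x. \<exists>p. p \<in> K \<and> (p, x) \<in> h -` cell n}"
      using n by (auto simp: S_def image_iff)
    also have "closed \<dots>"
      by (intro closed_compact_projection[OF K] closed_vimage closed_cell h)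
    finally show ?thesis by (rule borel_closed)
  next
    case False
    then have "{x. i \<in> S x} = {}" by (auto simp: S_def)
    then show ?thesis by simp
  qed
  then show ?thesis unfolding card by (intro measurable_card) simp
qed

lemma cell_count_swap: "cell_count (prod.swap ` X) = cell_count X"
proof -
  define f where "f = (\<lambda>(i, j, k). (j, i, k) :: int \<times> int \<times> int)"
  have f: "f (f n) = n" "cell (f n) = prod.swap -` cell n" "f n \<in> cell_index \<longleftrightarrow> n \<in> cell_index" for n
    by (cases n; simp add: f_def cell_def cell_index_def add.commute set_eq_iff conj_ac)+
  have swap: "prod.swap -` Y \<inter> prod.swap ` X = prod.swap ` (Y \<inter> X)" for Y :: "point set"
    by (auto simp: image_iff)
  have "bij_betw f {n \<in> cell_index. cell n \<inter> prod.swap ` X \<noteq> {}} {n \<in> cell_index. cell n \<inter> X \<noteq> {}}"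
  proof (rule bij_betw_byWitness[where f' = f])
    show "f ` {n \<in> cell_index. cell n \<inter> prod.swap ` X \<noteq> {}} \<subseteq> {n \<in> cell_index. cell n \<inter> X \<noteq> {}}"
    proof (intro image_subsetI CollectI conjI)
      fix n assume n: "n \<in> {n \<in> cell_index. cell n \<inter> prod.swap ` X \<noteq> {}}"
      show "f n \<in> cell_index" using n f by simp
      have "cell (f (f n)) \<inter> prod.swap ` X \<noteq> {}" using n f(1) by simp
      then show "cell (f n) \<inter> X \<noteq> {}" unfolding f(2)[of "f n"] swap by simp
    qed
    show "f ` {n \<in> cell_index. cell n \<inter> X \<noteq> {}} \<subseteq> {n \<in> cell_index. cell n \<inter> prod.swap ` X \<noteq> {}}"
      by (intro image_subsetI CollectI conjI) (simp_all add: f swap)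
  qed (simp_all add: f(1))
  then show ?thesis unfolding cell_count_def by (rule bij_betw_same_card)
qed

lemma cell_count_translate:
  fixes m n :: int
  shows "cell_count ((+) (of_int m, of_int n) ` X) = cell_count X"
proof -
  define f where "f = (\<lambda>(m, n) (i, j, k). (i + m, j + n, k + m + n) :: int \<times> int \<times> int)"
  have f: "f (- m, - n) (f (m, n) l) = l" "f (m, n) (f (- m, - n) l) = l"
    "f (m, n) l \<in> cell_index \<longleftrightarrow> l \<in> cell_index" "f (- m, - n) l \<in> cell_index \<longleftrightarrow> l \<in> cell_index"
    for l m n
    by (cases l; auto simp: f_def cell_index_def)+
  have mem: "(of_int m, of_int n) + z \<in> cell (f (m, n) l) \<longleftrightarrow> z \<in> cell l" for z l
    by (cases l; cases z) (simp add: f_def cell_def algebra_simps)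
  have hit: "cell (f (m, n) l) \<inter> (+) (of_int m, of_int n) ` X \<noteq> {} \<longleftrightarrow> cell l \<inter> X \<noteq> {}" for l
    using mem by blast
  have "bij_betw (f (m, n)) {l \<in> cell_index. cell l \<inter> X \<noteq> {}}
      {l \<in> cell_index. cell l \<inter> (+) (of_int m, of_int n) ` X \<noteq> {}}"
  proof (rule bij_betw_byWitness[where f' = "f (- m, - n)"])
    show "f (m, n) ` {l \<in> cell_index. cell l \<inter> X \<noteq> {}} \<subseteq> {l \<in> cell_index. cell l \<inter> (+) (of_int m, of_int n) ` X \<noteq> {}}"
      by (intro image_subsetI CollectI conjI) (simp_all add: f hit)
    show "f (- m, - n) ` {l \<in> cell_index. cell l \<inter> (+) (of_int m, of_int n) ` X \<noteq> {}} \<subseteq> {l \<in> cell_index. cell l \<inter> X \<noteq> {}}"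
    proof (intro image_subsetI CollectI conjI)
      fix l assume l: "l \<in> {l \<in> cell_index. cell l \<inter> (+) (of_int m, of_int n) ` X \<noteq> {}}"
      show "f (- m, - n) l \<in> cell_index" using l f by simp
      show "cell (f (- m, - n) l) \<inter> X \<noteq> {}" using l hit[of "f (- m, - n) l"] by (simp add: f)
    qed
  qed (simp_all add: f)
  then show ?thesis unfolding cell_count_def by (rule bij_betw_same_card[symmetric])
qed

section \<open>Counting the cells met by a convex set\<close>

text \<open>A convex body between the lines 0 and 2 of the first two families: of these families it can cross only
$s = 1$ and $t = 1$. In each of the following lemmas the strips that meet the body leave a short list of
candidates among the cells; a convex body that reaches both sides of a line contains a point of it, and
such points show which candidates are met.\<close>

context
  fixes X :: "point set"
  assumes conv: "convex X"
    and box: "\<And>z. z \<in> X \<Longrightarrow> 0 < fst z \<and> fst z < 2 \<and> 0 < snd z \<and> snd z < 2"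
begin

lemma hitI:
  assumes "z \<in> X" "of_int i \<le> fst z" "fst z \<le> of_int i + 1" "of_int j \<le> snd z" "snd z \<le> of_int j + 1"
    "of_int k \<le> fst z + snd z" "fst z + snd z \<le> of_int k + 1"
  shows "cell (i, j, k) \<inter> X \<noteq> {}"
  using assms by (auto simp: cell_def)

lemma hitE:
  assumes "cell (i, j, k) \<inter> X \<noteq> {}"
  obtains z where "z \<in> X" "of_int i \<le> fst z" "fst z \<le> of_int i + 1" "of_int j \<le> snd z" "snd z \<le> of_int j + 1"
    "of_int k \<le> fst z + snd z" "fst z + snd z \<le> of_int k + 1"
    "0 < fst z" "fst z < 2" "0 < snd z" "snd z < 2" "i = 0 \<or> i = 1" "j = 0 \<or> j = 1"
proof -
  obtain z where z: "z \<in> X" "z \<in> cell (i, j, k)" using assms by blast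
  note b = box[OF z(1)]
  have "of_int i < (2::real)" "of_int j < (2::real)" "0 < of_int i + (1::real)" "0 < of_int j + (1::real)"
    using z b by (auto simp: cell_def)
  then have "i = 0 \<or> i = 1" "j = 0 \<or> j = 1" by linarith+
  then show ?thesis using that z b by (auto simp: cell_def)
qed

lemma cross_fst:
  assumes "p \<in> X" "fst p \<le> m" "q \<in> X" "m \<le> fst q"
  obtains z where "z \<in> X" "fst z = m"
  using connected_ivt_hyperplane[OF convex_connected[OF conv] assms(1,3), of "(1, 0)" m] assms
  by (auto simp: inner_prod_def)

lemma cross_snd:
  assumes "p \<in> X" "snd p \<le> m" "q \<in> X" "m \<le> snd q"
  obtains z where "z \<in> X" "snd z = m"
  using connected_ivt_hyperplane[OF convex_connected[OF conv] assms(1,3), of "(0, 1)" m] assms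
  by (auto simp: inner_prod_def)

lemma cross_sum:
  assumes "p \<in> X" "fst p + snd p \<le> m" "q \<in> X" "m \<le> fst q + snd q"
  obtains z where "z \<in> X" "fst z + snd z = m"
  using connected_ivt_hyperplane[OF convex_connected[OF conv] assms(1,3), of "(1, 1)" m] assms
  by (auto simp: inner_prod_def)

lemma cell_count_eqI:
  assumes "\<And>i j k. k = i + j \<or> k = i + j + 1 \<Longrightarrow> cell (i, j, k) \<inter> X \<noteq> {} \<Longrightarrow> (i, j, k) \<in> N"
    and "\<And>n. n \<in> N \<Longrightarrow> n \<in> cell_index \<and> cell n \<inter> X \<noteq> {}" and "card N = c"
  shows "cell_count X = c"
proof -
  have "{n \<in> cell_index. cell n \<inter> X \<noteq> {}} = N"
  proof (intro equalityI subsetI)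
    fix n assume "n \<in> {n \<in> cell_index. cell n \<inter> X \<noteq> {}}"
    then show "n \<in> N" by (cases n) (use assms(1) in \<open>auto simp: cell_index_def\<close>)
  qed (use assms(2) in blast)
  then show ?thesis using assms(3) by (simp add: cell_count_def)
qed

lemma count_none:
  assumes ne: "X \<noteq> {}" and s: "\<And>z. z \<in> X \<Longrightarrow> fst z < 1" and t: "\<And>z. z \<in> X \<Longrightarrow> snd z < 1"
    and r: "\<And>z. z \<in> X \<Longrightarrow> of_int m < fst z + snd z \<and> fst z + snd z < of_int m + 1"
  shows "cell_count X = 1"
proof -
  obtain z where z: "z \<in> X" using ne by blast
  have "of_int m < (2::real)" "0 < of_int m + (1::real)"
    using s[OF z] t[OF z] r[OF z] box[OF z] by linarith+
  then have m: "m = 0 \<or> m = 1" by linarith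
  show ?thesis
  proof (rule cell_count_eqI[where N = "{(0, 0, m)}"])
    fix i j k :: int assume "cell (i, j, k) \<inter> X \<noteq> {}"
    then obtain z where z: "z \<in> X" "of_int i \<le> fst z" "of_int j \<le> snd z"
      "of_int k \<le> fst z + snd z" "fst z + snd z \<le> of_int k + 1" "i = 0 \<or> i = 1" "j = 0 \<or> j = 1"
      by (rule hitE)
    have "i = 0" "j = 0" using z s[OF z(1)] t[OF z(1)] by auto
    moreover have "k = m" using z r[OF z(1)] by linarith
    ultimately show "(i, j, k) \<in> {(0, 0, m)}" by simp
  next
    fix n assume "n \<in> {(0 :: int, 0 :: int, m)}"
    then show "n \<in> cell_index \<and> cell n \<inter> X \<noteq> {}"
      using m hitI[OF z, of 0 0 m] s[OF z] t[OF z] r[OF z] box[OF z] by (auto simp: cell_index_def)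
  qed simp
qed

lemma count_sum:
  assumes s: "\<And>z. z \<in> X \<Longrightarrow> fst z < 1" and t: "\<And>z. z \<in> X \<Longrightarrow> snd z < 1"
    and p: "p \<in> X" "fst p + snd p < of_int m" and q: "q \<in> X" "of_int m < fst q + snd q"
  shows "cell_count X = 2"
proof -
  have "of_int m < (2::real)" "0 < (of_int m::real)"
    using s[OF q(1)] t[OF q(1)] box[OF p(1)] p q by linarith+
  then have m: "m = 1" by linarith
  note pq = p(2)[unfolded m of_int_1] q(2)[unfolded m of_int_1]
  show ?thesis
  proof (rule cell_count_eqI[where N = "{(0, 0, 0), (0, 0, 1)}"])
    fix i j k :: int assume k: "k = i + j \<or> k = i + j + 1" and "cell (i, j, k) \<inter> X \<noteq> {}"
    then obtain z where z: "z \<in> X" "of_int i \<le> fst z" "of_int j \<le> snd z" "i = 0 \<or> i = 1" "j = 0 \<or> j = 1"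
      by (elim hitE)
    have "i = 0" "j = 0" using z s[OF z(1)] t[OF z(1)] by auto
    then show "(i, j, k) \<in> {(0, 0, 0), (0, 0, 1)}" using k by auto
  next
    fix n :: "int \<times> int \<times> int" assume "n \<in> {(0, 0, 0), (0, 0, 1)}"
    then show "n \<in> cell_index \<and> cell n \<inter> X \<noteq> {}"
      using m hitI[OF p(1), of 0 0 0] hitI[OF q(1), of 0 0 1] s[OF p(1)] t[OF p(1)] s[OF q(1)] t[OF q(1)]
        box[OF p(1)] box[OF q(1)] pq by (auto simp: cell_index_def)
  qed simp
qed

lemma count_fst:
  assumes t: "\<And>z. z \<in> X \<Longrightarrow> snd z < 1" and p: "p \<in> X" "fst p < 1" and q: "q \<in> X" "1 < fst q"
    and r: "\<And>z. z \<in> X \<Longrightarrow> of_int m < fst z + snd z \<and> fst z + snd z < of_int m + 1"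
  shows "cell_count X = 2"
proof -
  have "of_int m < (2::real)" "0 < (of_int m :: real)"
    using t[OF p(1)] r[OF p(1)] r[OF q(1)] box[OF p(1)] box[OF q(1)] p q by linarith+
  then have m: "m = 1" by linarith
  note rs = r[OF p(1), unfolded m of_int_1] r[OF q(1), unfolded m of_int_1]
  show ?thesis
  proof (rule cell_count_eqI[where N = "{(0, 0, 1), (1, 0, 1)}"])
    fix i j k :: int assume "cell (i, j, k) \<inter> X \<noteq> {}"
    then obtain z where z: "z \<in> X" "of_int j \<le> snd z"
      "of_int k \<le> fst z + snd z" "fst z + snd z \<le> of_int k + 1" "i = 0 \<or> i = 1" "j = 0 \<or> j = 1"
      by (rule hitE)
    have "j = 0" using z t[OF z(1)] by auto
    moreover have "k = m" using z r[OF z(1)] by linarith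
    ultimately show "(i, j, k) \<in> {(0, 0, 1), (1, 0, 1)}" using z m by auto
  next
    fix n :: "int \<times> int \<times> int" assume "n \<in> {(0, 0, 1), (1, 0, 1)}"
    then show "n \<in> cell_index \<and> cell n \<inter> X \<noteq> {}"
      using m hitI[OF p(1), of 0 0 1] hitI[OF q(1), of 1 0 1] rs t[OF p(1)] t[OF q(1)]
        box[OF p(1)] box[OF q(1)] p q by (auto simp: cell_index_def)
  qed simp
qed

lemma count_fst_sum:
  assumes t: "\<And>z. z \<in> X \<Longrightarrow> snd z < 1" and p: "p \<in> X" "fst p < 1" and q: "q \<in> X" "1 < fst q"
    and r: "\<And>z. z \<in> X \<Longrightarrow> of_int m - 1 < fst z + snd z \<and> fst z + snd z < of_int m + 1"
    and p': "p' \<in> X" "fst p' + snd p' < of_int m" and q': "q' \<in> X" "of_int m < fst q' + snd q'"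
  shows "cell_count X = 3"
proof -
  have "of_int m < (3::real)" "0 < (of_int m :: real)"
    using t[OF q'(1)] box[OF p'(1)] box[OF q'(1)] p' q' by linarith+
  then have m: "m = 1 \<or> m = 2" by linarith
  obtain y where y: "y \<in> X" "fst y = 1" using cross_fst[of p 1 q] p q by auto
  have N: "(i, j, k) \<in> {(0, 0, m - 1), (0, 0, 1), (1, 0, 1), (1, 0, m)}"
    if k: "k = i + j \<or> k = i + j + 1" and "cell (i, j, k) \<inter> X \<noteq> {}" for i j k
  proof -
    obtain z where z: "z \<in> X" "of_int j \<le> snd z"
      "of_int k \<le> fst z + snd z" "fst z + snd z \<le> of_int k + 1" "i = 0 \<or> i = 1" "j = 0 \<or> j = 1"
      using \<open>cell (i, j, k) \<inter> X \<noteq> {}\<close> by (rule hitE)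
    have "j = 0" using z t[OF z(1)] by auto
    moreover have "k = m \<or> k = m - 1" using z r[OF z(1)] by linarith
    ultimately show ?thesis using z(5) m k by (elim disjE) simp_all
  qed
  have y01: "cell (0, 0, 1) \<inter> X \<noteq> {}" "cell (1, 0, 1) \<inter> X \<noteq> {}"
    using hitI[OF y(1), of 0 0 1] hitI[OF y(1), of 1 0 1] y t[OF y(1)] box[OF y(1)] by auto
  have pq: "cell (0, 0, m - 1) \<inter> X \<noteq> {}" "cell (1, 0, m) \<inter> X \<noteq> {}"
  proof -
    show "cell (0, 0, m - 1) \<inter> X \<noteq> {}"
      using m y01 hitI[OF p'(1), of 0 0 0] t[OF p'(1)] box[OF p'(1)] p' by auto
    show "cell (1, 0, m) \<inter> X \<noteq> {}"
      using m y01 hitI[OF q'(1), of 1 0 2] t[OF q'(1)] box[OF q'(1)] q' by auto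
  qed
  show ?thesis
  proof (rule cell_count_eqI[where N = "{(0, 0, m - 1), (0, 0, 1), (1, 0, 1), (1, 0, m)}", OF N])
    show "n \<in> cell_index \<and> cell n \<inter> X \<noteq> {}" if "n \<in> {(0, 0, m - 1), (0, 0, 1), (1, 0, 1), (1, 0, m)}" for n
      using that m y01 pq by (auto simp: cell_index_def)
  qed (use m in auto)
qed

lemma count_fst_snd:
  assumes p: "p \<in> X" "fst p < 1" and q: "q \<in> X" "1 < fst q" and p': "p' \<in> X" "snd p' < 1" and q': "q' \<in> X" "1 < snd q'"
    and r: "\<And>z. z \<in> X \<Longrightarrow> of_int m < fst z + snd z \<and> fst z + snd z < of_int m + 1"
  shows "cell_count X = 3"
proof -
  obtain y where y: "y \<in> X" "fst y = 1" using cross_fst[of p 1 q] p q by auto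
  obtain x where x: "x \<in> X" "snd x = 1" using cross_snd[of p' 1 q'] p' q' by auto
  have "of_int m < (3::real)" "0 < (of_int m :: real)"
    using box[OF y(1)] r[OF y(1)] r[OF q(1)] box[OF q(1)] y q by linarith+
  then have m: "m = 1 \<or> m = 2" by linarith
  have N: "(i, j, k) \<in> {(0, 1, m), (1, 0, m), (m - 1, m - 1, m)}"
    if k: "k = i + j \<or> k = i + j + 1" and "cell (i, j, k) \<inter> X \<noteq> {}" for i j k
  proof -
    obtain z where z: "z \<in> X"
      "of_int k \<le> fst z + snd z" "fst z + snd z \<le> of_int k + 1" "i = 0 \<or> i = 1" "j = 0 \<or> j = 1"
      using \<open>cell (i, j, k) \<inter> X \<noteq> {}\<close> by (rule hitE)
    have "k = m" using z r[OF z(1)] by linarith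
    with z(4,5) m k show ?thesis by (elim disjE) simp_all
  qed
  have H: "cell (0, 1, m) \<inter> X \<noteq> {} \<and> cell (1, 0, m) \<inter> X \<noteq> {} \<and> cell (m - 1, m - 1, m) \<inter> X \<noteq> {}"
    using m
  proof
    assume m: "m = 1"
    note b = x(2) y(2) box[OF x(1)] box[OF y(1)] r[OF x(1)] r[OF y(1)]
    have "cell (0, 1, 1) \<inter> X \<noteq> {}" "cell (0, 0, 1) \<inter> X \<noteq> {}"
      using hitI[OF x(1), of 0 1 1] hitI[OF x(1), of 0 0 1] b m by simp_all
    moreover have "cell (1, 0, 1) \<inter> X \<noteq> {}"
      using hitI[OF y(1), of 1 0 1] b m by simp
    ultimately show ?thesis using m by simp
  next
    assume m: "m = 2"
    note b = x(2) y(2) box[OF x(1)] box[OF y(1)] r[OF x(1)] r[OF y(1)]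
    have "cell (1, 0, 2) \<inter> X \<noteq> {}" "cell (1, 1, 2) \<inter> X \<noteq> {}"
      using hitI[OF x(1), of 1 0 2] hitI[OF x(1), of 1 1 2] b m by simp_all
    moreover have "cell (0, 1, 2) \<inter> X \<noteq> {}"
      using hitI[OF y(1), of 0 1 2] b m by simp
    ultimately show ?thesis using m by simp
  qed
  show ?thesis
  proof (rule cell_count_eqI[where N = "{(0, 1, m), (1, 0, m), (m - 1, m - 1, m)}", OF N])
    show "n \<in> cell_index \<and> cell n \<inter> X \<noteq> {}" if "n \<in> {(0, 1, m), (1, 0, m), (m - 1, m - 1, m)}" for n
      using that m H by (auto simp: cell_index_def)
  qed (use m in auto)
qed

text \<open>The crossed line of the third family is $s + t = 1$ or $s + t = 3$, so the three crossed lines are not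
concurrent.\<close>

lemma count_all_away_from_vertex:
  assumes p: "p \<in> X" "fst p < 1" and q: "q \<in> X" "1 < fst q" and p': "p' \<in> X" "snd p' < 1" and q': "q' \<in> X" "1 < snd q'"
    and r: "\<And>z. z \<in> X \<Longrightarrow> of_int m - 1 < fst z + snd z \<and> fst z + snd z < of_int m + 1"
    and p2: "p2 \<in> X" "fst p2 + snd p2 < of_int m" and q2: "q2 \<in> X" "of_int m < fst q2 + snd q2"
    and m: "m \<noteq> 2"
  shows "cell_count X = 4"
proof -
  obtain y where y: "y \<in> X" "fst y = 1" using cross_fst[of p 1 q] p q by auto
  obtain x where x: "x \<in> X" "snd x = 1" using cross_snd[of p' 1 q'] p' q' by auto
  have "of_int m < (4::real)" "0 < (of_int m :: real)"
    using box[OF p2(1)] box[OF q2(1)] p2 q2 by linarith+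
  then have m: "m = 1 \<or> m = 3" using m by linarith
  define l where "l = (if m = 1 then 0 else 1 :: int)"
  define k' where "k' = (if m = 1 then 0 else 3 :: int)"
  let ?N = "{(0, 1, l + 1), (1, 0, l + 1), (l, l, l + 1), (l, l, k')}"
  have N: "(i, j, k) \<in> ?N"
    if k: "k = i + j \<or> k = i + j + 1" and "cell (i, j, k) \<inter> X \<noteq> {}" for i j k
  proof -
    obtain z where z: "z \<in> X"
      "of_int k \<le> fst z + snd z" "fst z + snd z \<le> of_int k + 1" "i = 0 \<or> i = 1" "j = 0 \<or> j = 1"
      using \<open>cell (i, j, k) \<inter> X \<noteq> {}\<close> by (rule hitE)
    have "k = m \<or> k = m - 1" using z r[OF z(1)] by linarith
    with z(4,5) m k show ?thesis by (elim disjE) (simp_all add: l_def k'_def)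
  qed
  have H: "cell (0, 1, l + 1) \<inter> X \<noteq> {} \<and> cell (1, 0, l + 1) \<inter> X \<noteq> {} \<and> cell (l, l, l + 1) \<inter> X \<noteq> {}"
    using m
  proof
    assume m: "m = 1"
    note b = x(2) y(2) box[OF x(1)] box[OF y(1)] r[OF x(1)] r[OF y(1)]
    have "cell (0, 1, 1) \<inter> X \<noteq> {}" "cell (0, 0, 1) \<inter> X \<noteq> {}"
      using hitI[OF x(1), of 0 1 1] hitI[OF x(1), of 0 0 1] b m by simp_all
    moreover have "cell (1, 0, 1) \<inter> X \<noteq> {}"
      using hitI[OF y(1), of 1 0 1] b m by simp
    ultimately show ?thesis using m by (simp add: l_def)
  next
    assume m: "m = 3"
    note b = x(2) y(2) box[OF x(1)] box[OF y(1)] r[OF x(1)] r[OF y(1)]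
    have "cell (1, 0, 2) \<inter> X \<noteq> {}" "cell (1, 1, 2) \<inter> X \<noteq> {}"
      using hitI[OF x(1), of 1 0 2] hitI[OF x(1), of 1 1 2] b m by simp_all
    moreover have "cell (0, 1, 2) \<inter> X \<noteq> {}"
      using hitI[OF y(1), of 0 1 2] b m by simp
    ultimately show ?thesis using m by (simp add: l_def)
  qed
  have H': "cell (l, l, k') \<inter> X \<noteq> {}"
    using m
  proof
    assume "m = 1"
    then show ?thesis
      using hitI[OF p2(1), of 0 0 0] p2 box[OF p2(1)] by (auto simp: l_def k'_def)
  next
    assume "m = 3"
    then show ?thesis
      using hitI[OF q2(1), of 1 1 3] q2 box[OF q2(1)] by (auto simp: l_def k'_def)
  qed
  show ?thesis
  proof (rule cell_count_eqI[where N = ?N, OF N])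
    show "n \<in> cell_index \<and> cell n \<inter> X \<noteq> {}" if "n \<in> ?N" for n
      using that m H H' by (auto simp: cell_index_def l_def k'_def)
  qed (use m in \<open>auto simp: l_def k'_def\<close>)
qed

text \<open>Between the lines $s + t = 1$ and $s + t = 3$ of the third family only the six cells with the vertex
$(1, 1)$ remain.\<close>

lemma cells_around_vertex:
  assumes r: "\<And>z. z \<in> X \<Longrightarrow> 1 < fst z + snd z \<and> fst z + snd z < 3"
  shows "{n \<in> cell_index. cell n \<inter> X \<noteq> {}} =
    {n \<in> {(0, 0, 1), (1, 0, 1), (1, 0, 2), (0, 1, 1), (0, 1, 2), (1, 1, 2)}. cell n \<inter> X \<noteq> {}}"
proof -
  have six: "(i, j, k) \<in> {(0, 0, 1), (1, 0, 1), (1, 0, 2), (0, 1, 1), (0, 1, 2), (1, 1, 2)}"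
    if k: "k = i + j \<or> k = i + j + 1" and "cell (i, j, k) \<inter> X \<noteq> {}" for i j k
  proof -
    obtain z where z: "z \<in> X"
      "of_int k \<le> fst z + snd z" "fst z + snd z \<le> of_int k + 1" "i = 0 \<or> i = 1" "j = 0 \<or> j = 1"
      using \<open>cell (i, j, k) \<inter> X \<noteq> {}\<close> by (rule hitE)
    have "k = 1 \<or> k = 2" using z r[OF z(1)] by linarith
    with z(4,5) k show ?thesis by (elim disjE) simp_all
  qed
  have "n \<in> {(0, 0, 1), (1, 0, 1), (1, 0, 2), (0, 1, 1), (0, 1, 2), (1, 1, 2)}"
    if n: "n \<in> cell_index" "cell n \<inter> X \<noteq> {}" for n
  proof (cases n)
    case (fields i j k)
    show ?thesis unfolding fields
      by (rule six) (use n in \<open>simp_all add: fields cell_index_def\<close>)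
  qed
  moreover have "{(0, 0, 1), (1, 0, 1), (1, 0, 2), (0, 1, 1), (0, 1, 2), (1, 1, 2)} \<subseteq> cell_index"
    by (simp add: cell_index_def)
  ultimately show ?thesis by blast
qed

lemma count_at_vertex:
  assumes r: "\<And>z. z \<in> X \<Longrightarrow> 1 < fst z + snd z \<and> fst z + snd z < 3" and v: "(1, 1) \<in> X"
  shows "cell_count X = 6"
proof -
  have "{n \<in> {(0, 0, 1), (1, 0, 1), (1, 0, 2), (0, 1, 1), (0, 1, 2), (1, 1, 2)}. cell n \<inter> X \<noteq> {}}
      = {(0, 0, 1), (1, 0, 1), (1, 0, 2), (0, 1, 1), (0, 1, 2), (1, 1, 2)}"
    using hitI[OF v] by auto
  moreover have "cell_count X = card {n \<in> {(0, 0, 1), (1, 0, 1), (1, 0, 2), (0, 1, 1), (0, 1, 2), (1, 1, 2)}. cell n \<inter> X \<noteq> {}}"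
    unfolding cell_count_def by (rule arg_cong[of _ _ card], rule cells_around_vertex, rule r)
  ultimately show ?thesis by simp
qed

text \<open>The body meets the three lines through $(1, 1)$ but avoids the point itself, so it lies in an open half
plane $u (s - 1) + w (t - 1) > 0$. The lines form six rays, and the body meets precisely those rays that lie in the
half plane. Each of the six cells is near $(1, 1)$ the cone spanned by two neighbouring rays, hence it is met if
and only if one of these rays lies in the half plane. Three consecutive rays do, and they belong to four cells.\<close>

lemma count_around_vertex:
  assumes cl: "closed X"
    and p: "p \<in> X" "fst p < 1" and q: "q \<in> X" "1 < fst q" and p': "p' \<in> X" "snd p' < 1" and q': "q' \<in> X" "1 < snd q'"
    and r: "\<And>z. z \<in> X \<Longrightarrow> 1 < fst z + snd z \<and> fst z + snd z < 3"
    and p2: "p2 \<in> X" "fst p2 + snd p2 < 2" and q2: "q2 \<in> X" "2 < fst q2 + snd q2"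
    and v: "(1, 1) \<notin> X"
  shows "cell_count X = 4"
proof -
  obtain x where x: "x \<in> X" "snd x = 1" using cross_snd[of p' 1 q'] p' q' by auto
  obtain y where y: "y \<in> X" "fst y = 1" using cross_fst[of p 1 q] p q by auto
  obtain d where d: "d \<in> X" "fst d + snd d = 2" using cross_sum[of p2 2 q2] p2 q2 by auto
  obtain n b where n: "n \<bullet> (1, 1) < b" "\<And>z. z \<in> X \<Longrightarrow> b < n \<bullet> z"
    using separating_hyperplane_closed_point[OF conv cl v] by blast
  define u w where "u = fst n" and "w = snd n"
  have sep: "0 < u * (fst z - 1) + w * (snd z - 1)" if "z \<in> X" for z
    using n(1) n(2)[OF that] by (cases n; cases z) (auto simp: u_def w_def algebra_simps)
  have xs: "0 < u * (fst x - 1)" using sep[OF x(1)] x by simp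
  have ys: "0 < w * (snd y - 1)" using sep[OF y(1)] y by simp
  have sd: "snd d = 2 - fst d" using d by simp
  have ds: "0 < (u - w) * (fst d - 1)" using sep[OF d(1)] unfolding sd by (simp add: algebra_simps)
  have ne: "u \<noteq> 0" "w \<noteq> 0" "u \<noteq> w" using xs ys ds by auto
  have sx: "(u > 0 \<longrightarrow> fst x > 1) \<and> (u < 0 \<longrightarrow> fst x < 1)"
    using xs by (auto simp: zero_less_mult_iff)
  have sy: "(w > 0 \<longrightarrow> snd y > 1) \<and> (w < 0 \<longrightarrow> snd y < 1)"
    using ys by (auto simp: zero_less_mult_iff)
  have sd: "(u > w \<longrightarrow> fst d > 1) \<and> (u < w \<longrightarrow> fst d < 1)"
    using ds by (auto simp: zero_less_mult_iff)
  note bx = box[OF x(1)] box[OF y(1)] box[OF d(1)] r[OF x(1)] r[OF y(1)] r[OF d(1)]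
  have comb: "u * X + w * Y \<le> 0"
    if "(X \<ge> 0 \<and> u \<le> 0) \<or> (X \<le> 0 \<and> u \<ge> 0)" "(Y \<ge> 0 \<and> w \<le> 0) \<or> (Y \<le> 0 \<and> w \<ge> 0)" for X Y
    using that by (intro add_nonpos_nonpos) (auto intro: mult_nonneg_nonpos mult_nonpos_nonneg simp: mult_le_0_iff)
  have comb1: "u * X + w * Y \<le> 0"
    if "(X + Y \<ge> 0 \<and> u \<le> 0) \<or> (X + Y \<le> 0 \<and> u \<ge> 0)" "(Y \<ge> 0 \<and> w \<le> u) \<or> (Y \<le> 0 \<and> w \<ge> u)" for X Y
  proof -
    have "u * (X + Y) + (w - u) * Y \<le> 0"
      using that by (intro add_nonpos_nonpos) (auto simp: mult_le_0_iff)
    then show ?thesis by (simp add: algebra_simps)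
  qed
  have comb2: "u * X + w * Y \<le> 0"
    if "(X + Y \<ge> 0 \<and> w \<le> 0) \<or> (X + Y \<le> 0 \<and> w \<ge> 0)" "(X \<ge> 0 \<and> u \<le> w) \<or> (X \<le> 0 \<and> u \<ge> w)" for X Y
  proof -
    have "w * (X + Y) + (u - w) * X \<le> 0"
      using that by (intro add_nonpos_nonpos) (auto simp: mult_le_0_iff)
    then show ?thesis by (simp add: algebra_simps)
  qed
  have h001: "cell (0, 0, 1) \<inter> X \<noteq> {} \<longleftrightarrow> u < 0 \<or> w < 0"
  proof
    assume "cell (0, 0, 1) \<inter> X \<noteq> {}"
    then obtain z where "z \<in> X" "fst z \<le> 1" "snd z \<le> 1" by (rule hitE) auto
    then show "u < 0 \<or> w < 0" using sep[of z] comb[of "fst z - 1" "snd z - 1"] by linarith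
  next
    assume "u < 0 \<or> w < 0"
    then show "cell (0, 0, 1) \<inter> X \<noteq> {}"
      using hitI[OF x(1), of 0 0 1] hitI[OF y(1), of 0 0 1] x y sx sy bx by auto
  qed
  have h112: "cell (1, 1, 2) \<inter> X \<noteq> {} \<longleftrightarrow> u > 0 \<or> w > 0"
  proof
    assume "cell (1, 1, 2) \<inter> X \<noteq> {}"
    then obtain z where "z \<in> X" "fst z \<ge> 1" "snd z \<ge> 1" by (rule hitE) auto
    then show "u > 0 \<or> w > 0" using sep[of z] comb[of "fst z - 1" "snd z - 1"] by linarith
  next
    assume "u > 0 \<or> w > 0"
    then show "cell (1, 1, 2) \<inter> X \<noteq> {}"
      using hitI[OF x(1), of 1 1 2] hitI[OF y(1), of 1 1 2] x y sx sy bx by auto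
  qed
  have h102: "cell (1, 0, 2) \<inter> X \<noteq> {} \<longleftrightarrow> u > 0 \<or> u > w"
  proof
    assume "cell (1, 0, 2) \<inter> X \<noteq> {}"
    then obtain z where "z \<in> X" "snd z \<le> 1" "2 \<le> fst z + snd z" by (rule hitE) auto
    then show "u > 0 \<or> u > w" using sep[of z] comb1[of "fst z - 1" "snd z - 1"] by linarith
  next
    assume "u > 0 \<or> u > w"
    then show "cell (1, 0, 2) \<inter> X \<noteq> {}"
      using hitI[OF x(1), of 1 0 2] hitI[OF d(1), of 1 0 2] x d sx sd bx by auto
  qed
  have h101: "cell (1, 0, 1) \<inter> X \<noteq> {} \<longleftrightarrow> w < 0 \<or> u > w"
  proof
    assume "cell (1, 0, 1) \<inter> X \<noteq> {}"
    then obtain z where "z \<in> X" "fst z \<ge> 1" "2 \<ge> fst z + snd z" by (rule hitE) auto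
    then show "w < 0 \<or> u > w" using sep[of z] comb2[of "fst z - 1" "snd z - 1"] by linarith
  next
    assume "w < 0 \<or> u > w"
    then show "cell (1, 0, 1) \<inter> X \<noteq> {}"
      using hitI[OF y(1), of 1 0 1] hitI[OF d(1), of 1 0 1] y d sy sd bx by auto
  qed
  have h012: "cell (0, 1, 2) \<inter> X \<noteq> {} \<longleftrightarrow> w > 0 \<or> u < w"
  proof
    assume "cell (0, 1, 2) \<inter> X \<noteq> {}"
    then obtain z where "z \<in> X" "fst z \<le> 1" "2 \<le> fst z + snd z" by (rule hitE) auto
    then show "w > 0 \<or> u < w" using sep[of z] comb2[of "fst z - 1" "snd z - 1"] by linarith
  next
    assume "w > 0 \<or> u < w"
    then show "cell (0, 1, 2) \<inter> X \<noteq> {}"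
      using hitI[OF y(1), of 0 1 2] hitI[OF d(1), of 0 1 2] y d sy sd bx by auto
  qed
  have h011: "cell (0, 1, 1) \<inter> X \<noteq> {} \<longleftrightarrow> u < 0 \<or> u < w"
  proof
    assume "cell (0, 1, 1) \<inter> X \<noteq> {}"
    then obtain z where "z \<in> X" "snd z \<ge> 1" "2 \<ge> fst z + snd z" by (rule hitE) auto
    then show "u < 0 \<or> u < w" using sep[of z] comb1[of "fst z - 1" "snd z - 1"] by linarith
  next
    assume "u < 0 \<or> u < w"
    then show "cell (0, 1, 1) \<inter> X \<noteq> {}"
      using hitI[OF x(1), of 0 1 1] hitI[OF d(1), of 0 1 1] x d sx sd bx by auto
  qed
  have "cell_count X = card {n \<in> {(0, 0, 1), (1, 0, 1), (1, 0, 2), (0, 1, 1), (0, 1, 2), (1, 1, 2)}. cell n \<inter> X \<noteq> {}}"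
    unfolding cell_count_def by (rule arg_cong[of _ _ card], rule cells_around_vertex, rule r)
  also have "\<dots> = (\<Sum>n\<in>{(0, 0, 1), (1, 0, 1), (1, 0, 2), (0, 1, 1), (0, 1, 2), (1, 1, 2)}. if cell n \<inter> X \<noteq> {} then 1 else 0)"
    by (simp only: card_eq_sum sum.inter_filter finite_insert finite.emptyI)
  also have "\<dots> = 4"
    using ne by (simp add: h001 h112 h102 h101 h012 h011)
  finally show ?thesis .
qed

end

section \<open>Integration over the plane\<close>

text \<open>A translation by an integer moves the window to $[r, r + 1)$ with $0 \<le> r \<le> 1$; what it contains
beyond 1 is moved back to $[0, r)$.\<close>

lemma nn_integral_period_window:
  fixes f :: "real \<Rightarrow> ennreal"
  assumes f[measurable]: "f \<in> borel_measurable borel" and per: "\<And>x. f (x + 1) = f x"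
  shows "(\<integral>\<^sup>+x. f x * indicator {a..<a + 1} x \<partial>lborel) = (\<integral>\<^sup>+x. f x * indicator {0..<1} x \<partial>lborel)"
proof -
  have per_nat: "f (x + of_nat n) = f x" for x n
  proof (induction n)
    case (Suc n)
    have "x + of_nat (Suc n) = x + of_nat n + 1" by simp
    then show ?case using per[of "x + of_nat n"] Suc by (simp only:)
  qed simp
  have per_int: "f (x + of_int m) = f x" for x m
  proof (cases m)
    case (nonneg n)
    then show ?thesis using per_nat[of x n] by simp
  next
    case (neg n)
    have "x + of_int m + of_nat (Suc n) = x" by (simp add: neg)
    then show ?thesis using per_nat[of "x + of_int m" "Suc n"] by (simp only:)
  qed
  have shift: "(\<integral>\<^sup>+x. f x * indicator {u + of_int m..<v + of_int m} x \<partial>lborel) = (\<integral>\<^sup>+x. f x * indicator {u..<v} x \<partial>lborel)" for u v m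
    by (subst nn_integral_real_affine[where c = 1 and t = "of_int m"])
       (auto simp: per_int add.commute[of "of_int m"] intro!: nn_integral_cong split: split_indicator)
  have split: "(\<integral>\<^sup>+x. f x * indicator {u..<v} x \<partial>lborel) + (\<integral>\<^sup>+x. f x * indicator {v..<w} x \<partial>lborel) =
     (\<integral>\<^sup>+x. f x * indicator {u..<w} x \<partial>lborel)" if "u \<le> v" "v \<le> w" for u v w
    using that by (subst nn_integral_add[symmetric]) (auto intro!: nn_integral_cong split: split_indicator)
  define r where "r = frac a"
  have r: "0 \<le> r" "r \<le> 1" by (auto simp: r_def frac_ge_0 less_imp_le frac_lt_1)
  have "a = r + of_int \<lfloor>a\<rfloor>" by (simp add: r_def frac_def)
  then have "(\<integral>\<^sup>+x. f x * indicator {a..<a + 1} x \<partial>lborel) = (\<integral>\<^sup>+x. f x * indicator {r..<r + 1} x \<partial>lborel)"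
    using shift[of r "\<lfloor>a\<rfloor>" "r + 1"] by (simp add: algebra_simps)
  also have "\<dots> = (\<integral>\<^sup>+x. f x * indicator {r..<1} x \<partial>lborel) + (\<integral>\<^sup>+x. f x * indicator {1..<r + 1} x \<partial>lborel)"
    using r by (intro split[symmetric]) auto
  also have "(\<integral>\<^sup>+x. f x * indicator {1..<r + 1} x \<partial>lborel) = (\<integral>\<^sup>+x. f x * indicator {0..<r} x \<partial>lborel)"
    using shift[of 0 1 r] by simp
  also have "(\<integral>\<^sup>+x. f x * indicator {r..<1} x \<partial>lborel) + \<dots> = (\<integral>\<^sup>+x. f x * indicator {0..<1} x \<partial>lborel)"
    using r by (subst add.commute, intro split) auto
  finally show ?thesis .
qed

lemma borel_measurable_comp_continuous:
  fixes f :: "point \<Rightarrow> ennreal" and h :: "'a :: topological_space \<Rightarrow> point"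
  assumes "f \<in> borel_measurable borel" "continuous_on UNIV h"
  shows "(\<lambda>x. f (h x)) \<in> borel_measurable borel"
  by (rule measurable_compose[OF borel_measurable_continuous_onI[OF assms(2)] assms(1)])

lemma nn_integral_plane:
  fixes f :: "point \<Rightarrow> ennreal"
  assumes [measurable]: "f \<in> borel_measurable borel"
  shows "(\<integral>\<^sup>+z. f z \<partial>lborel) = (\<integral>\<^sup>+x. (\<integral>\<^sup>+y. f (x, y) \<partial>lborel) \<partial>lborel)"
    and "(\<integral>\<^sup>+z. f z \<partial>lborel) = (\<integral>\<^sup>+y. (\<integral>\<^sup>+x. f (x, y) \<partial>lborel) \<partial>lborel)"
    and "(\<lambda>x. (\<integral>\<^sup>+y. f (x, y) \<partial>lborel)) \<in> borel_measurable borel"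
    and "(\<lambda>y. (\<integral>\<^sup>+x. f (x, y) \<partial>lborel)) \<in> borel_measurable borel"
proof -
  have m: "f \<in> borel_measurable (lborel \<Otimes>\<^sub>M lborel)"
    and m': "(\<lambda>(y, x). f (x, y)) \<in> borel_measurable (lborel \<Otimes>\<^sub>M lborel)"
    using borel_measurable_comp_continuous[OF assms, of "\<lambda>z. (snd z, fst z)"]
    by (simp_all add: lborel_prod case_prod_beta continuous_on_Pair continuous_on_fst continuous_on_snd)
  show "(\<integral>\<^sup>+z. f z \<partial>lborel) = (\<integral>\<^sup>+x. (\<integral>\<^sup>+y. f (x, y) \<partial>lborel) \<partial>lborel)"
    by (subst lborel_prod[symmetric]) (rule lborel.nn_integral_fst[OF m, symmetric])
  show "(\<integral>\<^sup>+z. f z \<partial>lborel) = (\<integral>\<^sup>+y. (\<integral>\<^sup>+x. f (x, y) \<partial>lborel) \<partial>lborel)"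
    by (subst lborel_prod[symmetric]) (rule lborel_pair.nn_integral_snd[symmetric], use m in \<open>simp add: case_prod_beta\<close>)
  show "(\<lambda>x. (\<integral>\<^sup>+y. f (x, y) \<partial>lborel)) \<in> borel_measurable borel"
    using lborel.borel_measurable_nn_integral_fst[OF m] by simp
  show "(\<lambda>y. (\<integral>\<^sup>+x. f (x, y) \<partial>lborel)) \<in> borel_measurable borel"
    using lborel.borel_measurable_nn_integral[OF m'] by simp
qed

lemma nn_integral_period_square:
  fixes f :: "point \<Rightarrow> ennreal"
  assumes f: "f \<in> borel_measurable borel"
    and per: "\<And>x y. f (x + 1, y) = f (x, y)" "\<And>x y. f (x, y + 1) = f (x, y)"
  shows "(\<integral>\<^sup>+z. f z * indicator ({a..<a + 1} \<times> {b..<b + 1}) z \<partial>lborel) =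
    (\<integral>\<^sup>+z. f z * indicator ({0..<1} \<times> {0..<1}) z \<partial>lborel)"
proof -
  have pm[measurable]: "(\<lambda>x. f (x, y)) \<in> borel_measurable borel" for y
    by (rule borel_measurable_comp_continuous[OF f]) (intro continuous_intros)
  have ind: "indicator ({a..<a + 1} \<times> {b..<b + 1}) (x, y) = (indicator {a..<a + 1} x * indicator {b..<b + 1} y :: ennreal)" for a b x y :: real
    by (auto split: split_indicator)
  have sq: "{a..<a + 1} \<times> {b..<b + 1} \<in> sets (borel :: point measure)" for a b :: real
    by (simp add: borel_Times)
  have fb: "(\<integral>\<^sup>+z. f z * indicator ({a..<a + 1} \<times> {b..<b + 1}) z \<partial>lborel) =
     (\<integral>\<^sup>+y. (\<integral>\<^sup>+x. f (x, y) * indicator {a..<a + 1} x \<partial>lborel) * indicator {b..<b + 1} y \<partial>lborel)" for a b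
  proof (subst nn_integral_plane(2))
    show "(\<lambda>z. f z * indicator ({a..<a + 1} \<times> {b..<b + 1}) z) \<in> borel_measurable borel"
      using f sq by (intro borel_measurable_times_ennreal borel_measurable_indicator)
  qed (auto simp: ind mult.assoc[symmetric] nn_integral_multc intro!: nn_integral_cong)
  have inner: "(\<integral>\<^sup>+x. f (x, y) * indicator {a..<a + 1} x \<partial>lborel) = (\<integral>\<^sup>+x. f (x, y) * indicator {0..<1} x \<partial>lborel)" for y
    by (rule nn_integral_period_window) (auto simp: per)
  have m: "(\<lambda>y. (\<integral>\<^sup>+x. f (x, y) * indicator {0..<1} x \<partial>lborel)) \<in> borel_measurable borel"
  proof -
    have "{0..<1} \<times> UNIV \<in> sets (borel :: point measure)"
      by (rule borel_Times) auto
    then have "(\<lambda>z. f z * indicator ({0..<1} \<times> UNIV) z) \<in> borel_measurable borel"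
      using f by (intro borel_measurable_times_ennreal borel_measurable_indicator)
    from nn_integral_plane(4)[OF this] show ?thesis by (simp add: indicator_times)
  qed
  have "(\<integral>\<^sup>+z. f z * indicator ({a..<a + 1} \<times> {b..<b + 1}) z \<partial>lborel) =
     (\<integral>\<^sup>+y. (\<integral>\<^sup>+x. f (x, y) * indicator {0..<1} x \<partial>lborel) * indicator {b..<b + 1} y \<partial>lborel)"
    unfolding fb inner ..
  also have "\<dots> = (\<integral>\<^sup>+y. (\<integral>\<^sup>+x. f (x, y) * indicator {0..<1} x \<partial>lborel) * indicator {0..<1} y \<partial>lborel)"
    by (rule nn_integral_period_window[OF m]) (simp add: per)
  also have "\<dots> = (\<integral>\<^sup>+z. f z * indicator ({0..<1} \<times> {0..<1}) z \<partial>lborel)"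
    using fb[of 0 0] by simp
  finally show ?thesis .
qed

text \<open>If $p \<noteq> 0$, substituting in the first variable and then in the second one reduces the claim to
the one-dimensional case, the two factors being $|p|$ and $|(p s - q r) / p|$. If $p = 0$, then $q \<noteq> 0$
and the roles of the variables are exchanged.\<close>

lemma nn_integral_plane_affine:
  fixes f :: "point \<Rightarrow> ennreal"
  assumes f: "f \<in> borel_measurable borel" and det: "p * s - q * r \<noteq> 0"
  shows "(\<integral>\<^sup>+z. f z \<partial>lborel) =
    ennreal \<bar>p * s - q * r\<bar> * (\<integral>\<^sup>+z. f (p * fst z + q * snd z + e1, r * fst z + s * snd z + e2) \<partial>lborel)"
proof -
  have mm: "(\<lambda>z. f (p * fst z + q * snd z + e1, r * fst z + s * snd z + e2)) \<in> borel_measurable borel" for p q r s e1 e2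
    by (rule borel_measurable_comp_continuous[OF f]) (intro continuous_intros)
  have main: "(\<integral>\<^sup>+z. f z \<partial>lborel) =
    ennreal \<bar>p * s - q * r\<bar> * (\<integral>\<^sup>+y. (\<integral>\<^sup>+x. f (p * x + q * y + e1, r * x + s * y + e2) \<partial>lborel) \<partial>lborel)"
    if det: "p * s - q * r \<noteq> 0" and p: "p \<noteq> 0" for p q r s
  proof -
    define k d where "k = (p * s - q * r) / p" and "d = e2 - r * e1 / p"
    have k: "k \<noteq> 0" using det p by (simp add: k_def)
    define F where "F z = f (fst z, r / p * fst z + k * snd z + d)" for z
    have F: "F \<in> borel_measurable borel"
      unfolding F_def by (rule borel_measurable_comp_continuous[OF f]) (intro continuous_intros)
    have F1: "(\<lambda>x. F (x, y)) \<in> borel_measurable borel" for y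
      by (rule borel_measurable_comp_continuous[OF F]) (intro continuous_intros)
    have f2: "(\<lambda>y. f (x, y)) \<in> borel_measurable borel" for x
      by (rule borel_measurable_comp_continuous[OF f]) (intro continuous_intros)
    have Feq: "F (q * y + e1 + p * x, y) = f (p * x + q * y + e1, r * x + s * y + e2)" for x y
    proof -
      have "r / p * (q * y + e1 + p * x) + k * y + d = r * x + s * y + e2"
        using p by (simp add: k_def d_def field_simps)
      then show ?thesis by (simp add: F_def ac_simps)
    qed
    have inner: "(\<integral>\<^sup>+x. F (x, y) \<partial>lborel) =
      ennreal \<bar>p\<bar> * (\<integral>\<^sup>+x. f (p * x + q * y + e1, r * x + s * y + e2) \<partial>lborel)" for y
      unfolding Feq[symmetric] by (rule nn_integral_real_affine[OF F1 p])
    have inner2: "(\<integral>\<^sup>+y. f (x, y) \<partial>lborel) = ennreal \<bar>k\<bar> * (\<integral>\<^sup>+y. F (x, y) \<partial>lborel)" for x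
      using nn_integral_real_affine[OF f2 k, of x "r / p * x + d"] by (simp add: F_def ac_simps)
    have "\<bar>k\<bar> * \<bar>p\<bar> = \<bar>p * s - q * r\<bar>" using p unfolding abs_mult[symmetric] by (simp add: k_def)
    then have "ennreal \<bar>p * s - q * r\<bar> * (\<integral>\<^sup>+y. (\<integral>\<^sup>+x. f (p * x + q * y + e1, r * x + s * y + e2) \<partial>lborel) \<partial>lborel)
      = ennreal \<bar>k\<bar> * (ennreal \<bar>p\<bar> * (\<integral>\<^sup>+y. (\<integral>\<^sup>+x. f (p * x + q * y + e1, r * x + s * y + e2) \<partial>lborel) \<partial>lborel))"
      by (simp add: mult.assoc[symmetric] ennreal_mult[symmetric])
    also have "ennreal \<bar>p\<bar> * (\<integral>\<^sup>+y. (\<integral>\<^sup>+x. f (p * x + q * y + e1, r * x + s * y + e2) \<partial>lborel) \<partial>lborel)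
      = (\<integral>\<^sup>+y. (\<integral>\<^sup>+x. F (x, y) \<partial>lborel) \<partial>lborel)"
      unfolding inner by (rule nn_integral_cmult[symmetric]) (use nn_integral_plane(4)[OF mm, of p q e1 r s e2] in simp)
    also have "\<dots> = (\<integral>\<^sup>+x. (\<integral>\<^sup>+y. F (x, y) \<partial>lborel) \<partial>lborel)"
      using nn_integral_plane(1,2)[OF F] by simp
    also have "ennreal \<bar>k\<bar> * \<dots> = (\<integral>\<^sup>+z. f z \<partial>lborel)"
      unfolding nn_integral_plane(1)[OF f] inner2
      by (rule nn_integral_cmult[symmetric]) (use nn_integral_plane(3)[OF F] in simp)
    finally show ?thesis ..
  qed
  show ?thesis
  proof (cases "p = 0")
    case False
    then show ?thesis using main[OF det] nn_integral_plane(2)[OF mm, of p q e1 r s e2] by simp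
  next
    case True
    then have ne: "q * r - p * s \<noteq> 0" "q \<noteq> 0" using det by auto
    show ?thesis
      using main[OF ne] nn_integral_plane(1)[OF mm, of p q e1 r s e2]
      by (simp add: abs_minus_commute add.commute add.left_commute)
  qed
qed

lemma AE_plane_line:
  fixes n :: point
  assumes "n \<noteq> 0"
  shows "AE z in lborel. n \<bullet> z \<noteq> c"
proof -
  have "negligible {z. n \<bullet> z = c}" using assms by (simp add: negligible_hyperplane)
  then have "{z. n \<bullet> z = c} \<in> null_sets (completion lborel)" by (simp add: negligible_iff_null_sets)
  then have "{z. n \<bullet> z = c} \<in> null_sets lborel"
    by (subst (asm) null_sets_completion_iff) (simp_all add: closed_hyperplane borel_closed)
  then show ?thesis by (rule AE_I') auto
qed

lemma AE_plane_coords: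
  "AE z::point in lborel. fst z \<noteq> c" "AE z::point in lborel. snd z \<noteq> c" "AE z::point in lborel. fst z + snd z \<noteq> c"
  using AE_plane_line[of "(1, 0)" c] AE_plane_line[of "(0, 1)" c] AE_plane_line[of "(1, 1)" c]
  by (simp_all add: inner_prod_def zero_prod_def)

lemma emeasure_plane_Times:
  fixes I J :: "real set"
  assumes "I \<in> sets borel" "J \<in> sets borel"
  shows "emeasure lborel (I \<times> J) = emeasure lborel I * emeasure lborel J"
  using assms by (subst lborel_prod[symmetric]) (simp add: lborel.emeasure_pair_measure_Times)

text \<open>Inclusion-exclusion, solved for the probabilities that exactly three, two or one of the events occur; the
probability $z$ that none occurs replaces that of the triple intersection.\<close>

lemma (in prob_space) prob_count_of_three_events:
  assumes ev: "S \<in> events" "T \<in> events" "R \<in> events"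
  defines "sg \<equiv> prob S + prob T + prob R" and "pr \<equiv> prob (S \<inter> T) + prob (S \<inter> R) + prob (T \<inter> R)"
    and "z \<equiv> prob (space M - (S \<union> T \<union> R))"
  shows "prob (S \<inter> T \<inter> R) = 1 - sg + pr - z"
    and "prob ((S \<inter> T \<union> S \<inter> R \<union> T \<inter> R) - S \<inter> T \<inter> R) = pr - 3 * (1 - sg + pr - z)"
    and "prob ((S \<union> T \<union> R) - (S \<inter> T \<union> S \<inter> R \<union> T \<inter> R)) = sg - 2 * pr + 3 * (1 - sg + pr - z)"
proof -
  have fm: "X \<in> fmeasurable M" if "X \<in> events" for X
    using that by (simp add: fmeasurable_eq_sets)
  have un3: "prob (X \<union> Y \<union> Z) = prob X + prob Y + prob Z - (prob (X \<inter> Y) + prob (X \<inter> Z) + prob (Y \<inter> Z)) + prob (X \<inter> Y \<inter> Z)"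
    if "X \<in> events" "Y \<in> events" "Z \<in> events" for X Y Z
  proof -
    have "prob ((X \<union> Y) \<inter> Z) = prob (X \<inter> Z) + prob (Y \<inter> Z) - prob (X \<inter> Y \<inter> Z)"
      unfolding Int_Un_distrib2 using that
      by (subst measure_Un3) (auto simp: fm Int_ac intro!: arg_cong[of _ _ prob])
    then show ?thesis
      using that by (simp add: measure_Un3 fm)
  qed
  have un: "prob (S \<union> T \<union> R) = sg - pr + prob (S \<inter> T \<inter> R)"
    using un3[OF ev] by (simp add: sg_def pr_def)
  have zz: "z = 1 - prob (S \<union> T \<union> R)"
    unfolding z_def using ev by (intro prob_compl) auto
  show 3: "prob (S \<inter> T \<inter> R) = 1 - sg + pr - z" using un zz by simp
  have ev2: "S \<inter> T \<in> events" "S \<inter> R \<in> events" "T \<inter> R \<in> events" using ev by auto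
  have inter: "S \<inter> T \<inter> (S \<inter> R) = S \<inter> T \<inter> R" "S \<inter> R \<inter> (T \<inter> R) = S \<inter> T \<inter> R"
    "S \<inter> T \<inter> (T \<inter> R) = S \<inter> T \<inter> R" "S \<inter> T \<inter> R \<inter> (S \<inter> T \<inter> R) = S \<inter> T \<inter> R"
    "S \<inter> T \<inter> (S \<inter> R) \<inter> (T \<inter> R) = S \<inter> T \<inter> R" by auto
  have two: "prob (S \<inter> T \<union> S \<inter> R \<union> T \<inter> R) = pr - 2 * prob (S \<inter> T \<inter> R)"
    using un3[OF ev2] unfolding inter by (simp add: pr_def Int_ac)
  show "prob ((S \<inter> T \<union> S \<inter> R \<union> T \<inter> R) - S \<inter> T \<inter> R) = pr - 3 * (1 - sg + pr - z)"
    using ev2 ev by (subst finite_measure_Diff) (auto simp: two 3)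
  show "prob ((S \<union> T \<union> R) - (S \<inter> T \<union> S \<inter> R \<union> T \<inter> R)) = sg - 2 * pr + 3 * (1 - sg + pr - z)"
    using ev2 ev by (subst finite_measure_Diff) (auto simp: two un 3)
qed

text \<open>A translate of an interval of length $w \<le> 1$ by a uniform number captures an integer with probability
$w$: by periodicity the translation may be taken from a period in which only the integer 0 can be
captured.\<close>

lemma measure_crossing_shifts:
  fixes c w :: real
  assumes w: "0 \<le> w" "w \<le> 1"
  shows "emeasure lborel {x. 0 \<le> x \<and> x < 1 \<and> (\<exists>m::int. x + c < of_int m \<and> of_int m < x + c + w)} = ennreal w"
proof -
  let ?f = "\<lambda>x. indicator {x. \<exists>m::int. x + c < of_int m \<and> of_int m < x + c + w} x :: ennreal"
  have open_E: "open {x. \<exists>m::int. x + c < of_int m \<and> of_int m < x + c + w}"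
  proof -
    have "{x. \<exists>m::int. x + c < of_int m \<and> of_int m < x + c + w} = (\<Union>m::int. {of_int m - c - w<..<of_int m - c})"
    proof (intro set_eqI)
      have "x + c < m \<and> m < x + c + w \<longleftrightarrow> x \<in> {m - c - w<..<m - c}" for x m :: real
        by auto
      then show "x \<in> {x. \<exists>m::int. x + c < of_int m \<and> of_int m < x + c + w} \<longleftrightarrow>
          x \<in> (\<Union>m::int. {of_int m - c - w<..<of_int m - c})" for x
        by simp
    qed
    also have "open \<dots>" by (intro open_UN ballI open_greaterThanLessThan)
    finally show ?thesis .
  qed
  have "emeasure lborel {x. 0 \<le> x \<and> x < 1 \<and> (\<exists>m::int. x + c < of_int m \<and> of_int m < x + c + w)} =
     (\<integral>\<^sup>+x. ?f x * indicator {0..<1} x \<partial>lborel)"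
  proof -
    have "{x. 0 \<le> x \<and> x < 1 \<and> (\<exists>m::int. x + c < of_int m \<and> of_int m < x + c + w)} =
        {x. \<exists>m::int. x + c < of_int m \<and> of_int m < x + c + w} \<inter> {0..<1}" by auto
    then show ?thesis
      using open_E by (simp add: nn_integral_indicator[symmetric] borel_open indicator_inter_arith del: nn_integral_indicator)
  qed
  also have "\<dots> = (\<integral>\<^sup>+x. ?f x * indicator {- c - w..<- c - w + 1} x \<partial>lborel)"
  proof (rule nn_integral_period_window[symmetric])
    show "?f (x + 1) = ?f x" for x
    proof -
      have "(\<exists>m::int. x + 1 + c < of_int m \<and> of_int m < x + 1 + c + w) \<longleftrightarrow>
            (\<exists>m::int. x + c < of_int m \<and> of_int m < x + c + w)"
      proof
        assume "\<exists>m::int. x + 1 + c < of_int m \<and> of_int m < x + 1 + c + w"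
        then obtain m :: int where "x + 1 + c < of_int m" "of_int m < x + 1 + c + w" by blast
        then show "\<exists>m::int. x + c < of_int m \<and> of_int m < x + c + w"
          by (intro exI[of _ "m - 1"]) simp
      next
        assume "\<exists>m::int. x + c < of_int m \<and> of_int m < x + c + w"
        then obtain m :: int where "x + c < of_int m" "of_int m < x + c + w" by blast
        then show "\<exists>m::int. x + 1 + c < of_int m \<and> of_int m < x + 1 + c + w"
          by (intro exI[of _ "m + 1"]) simp
      qed
      then show ?thesis by (simp add: indicator_def)
    qed
    show "?f \<in> borel_measurable borel" using open_E by (simp add: borel_open)
  qed
  also have "\<dots> = (\<integral>\<^sup>+x. indicator {- c - w<..<- c} x \<partial>lborel)"
  proof (rule nn_integral_cong)
    fix x :: real
    have "(\<exists>m::int. x + c < of_int m \<and> of_int m < x + c + w) \<and> - c - w \<le> x \<and> x < - c - w + 1 \<longleftrightarrow> - c - w < x \<and> x < - c"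
    proof safe
      fix m :: int assume m: "x + c < of_int m" "of_int m < x + c + w" "- c - w \<le> x" "x < - c - w + 1"
      have "of_int m < (1::real)" "- 1 < (of_int m::real)" using m w by linarith+
      then have "m = 0" by linarith
      with m show "- c - w < x" "x < - c" by auto
    next
      assume x: "- c - w < x" "x < - c"
      then show "\<exists>m::int. x + c < of_int m \<and> of_int m < x + c + w" by (intro exI[of _ 0]) auto
    qed (use w in auto)
    then show "?f x * indicator {- c - w..<- c - w + 1} x = indicator {- c - w<..<- c} x"
      by (auto simp: indicator_def)
  qed
  also have "\<dots> = ennreal w" using w by (subst nn_integral_indicator) auto
  finally show ?thesis .
qed

lemma emeasure_corner_triangle:
  assumes d: "0 \<le> d"
  shows "emeasure lborel {z::point. 0 \<le> fst z \<and> 0 \<le> snd z \<and> fst z + snd z \<le> d} = ennreal (d\<^sup>2 / 2)"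
proof -
  have cl: "closed {z::point. 0 \<le> fst z \<and> 0 \<le> snd z \<and> fst z + snd z \<le> d}"
    by (intro closed_Collect_conj closed_Collect_le continuous_intros)
  have "emeasure lborel {z::point. 0 \<le> fst z \<and> 0 \<le> snd z \<and> fst z + snd z \<le> d} =
     (\<integral>\<^sup>+x. (\<integral>\<^sup>+y. indicator {z::point. 0 \<le> fst z \<and> 0 \<le> snd z \<and> fst z + snd z \<le> d} (x, y) \<partial>lborel) \<partial>lborel)"
    using cl by (subst nn_integral_plane(1)[symmetric]) (auto simp: borel_closed)
  also have "\<dots> = (\<integral>\<^sup>+x. ennreal (d - x) * indicator {0..d} x \<partial>lborel)"
  proof (rule nn_integral_cong)
    fix x :: real
    have "(\<integral>\<^sup>+y. indicator {z::point. 0 \<le> fst z \<and> 0 \<le> snd z \<and> fst z + snd z \<le> d} (x, y) \<partial>lborel) =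
       (\<integral>\<^sup>+y. indicator {0..d} x * indicator {0..d - x} y \<partial>lborel)"
      by (rule nn_integral_cong) (auto split: split_indicator)
    also have "\<dots> = indicator {0..d} x * ennreal (d - x)"
      by (auto simp: nn_integral_cmult split: split_indicator)
    finally show "(\<integral>\<^sup>+y. indicator {z::point. 0 \<le> fst z \<and> 0 \<le> snd z \<and> fst z + snd z \<le> d} (x, y) \<partial>lborel) =
      ennreal (d - x) * indicator {0..d} x" by (simp add: mult.commute)
  qed
  also have "\<dots> = ennreal ((d * d - d\<^sup>2 / 2) - (d * 0 - 0\<^sup>2 / 2))"
    using d by (intro nn_integral_FTC_Icc[where F = "\<lambda>x. d * x - x\<^sup>2 / 2"]) (auto intro!: derivative_eq_intros)
  finally show ?thesis by (simp add: power2_eq_square)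
qed

section \<open>A body at a random position in the unit square\<close>

text \<open>The probabilities of the counts for a body of fixed direction with widths $A$, $B$, $w$ and area $v$, all
in skew coordinates. The value for 1 is the probability that no line is crossed; those for 2, 3 and 4 (with
$v$ added to the last one) then follow by inclusion-exclusion.\<close>

definition count_prob :: "real \<Rightarrow> real \<Rightarrow> real \<Rightarrow> real \<Rightarrow> nat \<Rightarrow> real" where
  "count_prob A B w v k =
    (let s1 = A + B + w; s2 = A\<^sup>2 + B\<^sup>2 + w\<^sup>2; s11 = A * B + A * w + B * w in
     if k = 1 then (1 - s1 / 2)\<^sup>2
     else if k = 2 then s1 - s11 / 2 - 3 * s2 / 4
     else if k = 3 then 3 * s2 / 4 - s11 / 2
     else if k = 4 then s11 / 2 - s2 / 4 - v
     else if k = 6 then v else 0)"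

text \<open>A body in skew coordinates, moved such that the least values of $s$ and $t$ on it are 0. Its range of
$s + t$ is centred at $(A + B) / 2$, as for every centrally symmetric body, and $A + B + w \<le> 2$ says that
it fits into a cell of either orientation.\<close>

locale normal_body =
  fixes K :: "point set" and A B w v :: real
  assumes convex: "convex K" and compact: "compact K"
    and pos: "0 < A" "0 < B" "0 < w" and small: "A + B + w \<le> 2"
    and bounds: "\<And>z. z \<in> K \<Longrightarrow> 0 \<le> fst z \<and> fst z \<le> A \<and> 0 \<le> snd z \<and> snd z \<le> B \<and>
      (A + B - w) / 2 \<le> fst z + snd z \<and> fst z + snd z \<le> (A + B + w) / 2"
    and attained: "\<exists>z\<in>K. fst z = 0" "\<exists>z\<in>K. fst z = A" "\<exists>z\<in>K. snd z = 0" "\<exists>z\<in>K. snd z = B"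
      "\<exists>z\<in>K. fst z + snd z = (A + B - w) / 2" "\<exists>z\<in>K. fst z + snd z = (A + B + w) / 2"
    and area: "emeasure lborel K = ennreal v" "0 \<le> v"
begin

definition "r0 = (A + B - w) / 2"
definition "r1 = (A + B + w) / 2"

lemma widths: "A \<le> r1" "B \<le> r1" "r1 \<le> 1" "0 \<le> r0" "r0 \<le> A" "r0 \<le> B" "r1 = r0 + w" "w \<le> 1" "A \<le> 1" "B \<le> 1" "r0 + r1 = A + B"
proof -
  show "A \<le> r1" "B \<le> r1" "0 \<le> r0" "r0 \<le> A" "r0 \<le> B"
    using attained bounds unfolding r0_def r1_def by fastforce+
  then show "r1 \<le> 1" "r1 = r0 + w" "w \<le> 1" "A \<le> 1" "B \<le> 1" "r0 + r1 = A + B"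
    using small pos by (auto simp: r0_def r1_def field_simps)
qed

definition "cross_s z \<longleftrightarrow> 1 < fst (z::point) + A"
definition "cross_t z \<longleftrightarrow> 1 < snd (z::point) + B"
definition "cross_r z \<longleftrightarrow> (\<exists>m::int. fst (z::point) + snd z + r0 < of_int m \<and> of_int m < fst z + snd z + r1)"
definition "vertex_in z \<longleftrightarrow> (1 - fst z, 1 - snd z) \<in> K"

text \<open>Positions inside the square in which no supporting line of the body in the three directions is a line of the
lattice.\<close>

definition "generic z \<longleftrightarrow> 0 < fst (z::point) \<and> fst z < 1 \<and> 0 < snd z \<and> snd z < 1 \<and> fst z + A \<noteq> 1 \<and> snd z + B \<noteq> 1 \<and>
  (\<forall>m::int. fst z + snd z + r0 \<noteq> of_int m \<and> fst z + snd z + r1 \<noteq> of_int m)"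

lemma vertex_crosses:
  assumes g: "generic z" and V: "vertex_in z"
  shows "cross_s z" "cross_t z" "cross_r z" "fst z + snd z + r0 < 2" "2 < fst z + snd z + r1"
proof -
  have "0 \<le> 1 - fst z \<and> 1 - fst z \<le> A \<and> 1 - snd z \<le> B \<and> r0 \<le> (1 - fst z) + (1 - snd z) \<and> (1 - fst z) + (1 - snd z) \<le> r1"
    using bounds[OF V[unfolded vertex_in_def]] by (simp add: r0_def r1_def)
  moreover have "fst z + snd z + r0 \<noteq> 2" "fst z + snd z + r1 \<noteq> 2" "fst z + A \<noteq> 1" "snd z + B \<noteq> 1"
    using g unfolding generic_def by (metis of_int_numeral, metis of_int_numeral, auto)
  ultimately show "cross_s z" "cross_t z" and two: "fst z + snd z + r0 < 2" "2 < fst z + snd z + r1"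
    unfolding cross_s_def cross_t_def by linarith+
  show "cross_r z" unfolding cross_r_def using two by (intro exI[of _ 2]) simp
qed

text \<open>A lattice point in the body forces all three lines through it to be crossed, and otherwise every crossed
line adds one cell. If the second family is crossed but not the first, exchanging the coordinates leads back to the
lemmas on convex sets above.\<close>

lemma count_generic:
  assumes g: "generic z"
  shows "cell_count ((+) z ` K) = (if vertex_in z then 6 else Suc (of_bool (cross_s z) + of_bool (cross_t z) + of_bool (cross_r z)))"
proof -
  define X where "X = (+) z ` K"
  have conv: "convex X" unfolding X_def using convex by (rule convex_translation)
  have cl: "closed X" unfolding X_def using compact by (intro compact_imp_closed compact_translation)
  have z: "0 < fst z" "fst z < 1" "0 < snd z" "snd z < 1" "fst z + A \<noteq> 1" "snd z + B \<noteq> 1"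
    "\<And>m::int. fst z + snd z + r0 \<noteq> of_int m" "\<And>m::int. fst z + snd z + r1 \<noteq> of_int m"
    using g unfolding generic_def by auto
  have X: "fst z \<le> fst x \<and> fst x \<le> fst z + A \<and> snd z \<le> snd x \<and> snd x \<le> snd z + B \<and>
      fst z + snd z + r0 \<le> fst x + snd x \<and> fst x + snd x \<le> fst z + snd z + r1" if x: "x \<in> X" for x
  proof -
    obtain k where "k \<in> K" "x = z + k" using x unfolding X_def by blast
    then show ?thesis using bounds[of k] by (simp add: r0_def r1_def)
  qed
  have att: "\<exists>x\<in>X. fst x = fst z" "\<exists>x\<in>X. fst x = fst z + A" "\<exists>x\<in>X. snd x = snd z" "\<exists>x\<in>X. snd x = snd z + B"
     "\<exists>x\<in>X. fst x + snd x = fst z + snd z + r0" "\<exists>x\<in>X. fst x + snd x = fst z + snd z + r1"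
    using attained by (auto simp: X_def r0_def r1_def algebra_simps)
  then obtain ps qs pt qt pr qr where
    ps: "ps \<in> X" "fst ps = fst z" and qs: "qs \<in> X" "fst qs = fst z + A" and
    pt: "pt \<in> X" "snd pt = snd z" and qt: "qt \<in> X" "snd qt = snd z + B" and
    pr: "pr \<in> X" "fst pr + snd pr = fst z + snd z + r0" and qr: "qr \<in> X" "fst qr + snd qr = fst z + snd z + r1"
    by blast
  have box: "0 < fst x \<and> fst x < 2 \<and> 0 < snd x \<and> snd x < 2" if "x \<in> X" for x
    using X[OF that] z(1-4) widths by linarith
  have ne: "X \<noteq> {}" using ps by blast
  have S0: "fst x < 1" if "\<not> cross_s z" "x \<in> X" for x
    using that(1) X[OF that(2)] z(5) unfolding cross_s_def by linarith
  have T0: "snd x < 1" if "\<not> cross_t z" "x \<in> X" for x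
    using that(1) X[OF that(2)] z(6) unfolding cross_t_def by linarith
  have S1: "fst ps < 1" "1 < fst qs" if "cross_s z"
    using that z ps qs unfolding cross_s_def by linarith+
  have T1: "snd pt < 1" "1 < snd qt" if "cross_t z"
    using that z pt qt unfolding cross_t_def by linarith+
  have R1: "fst pr + snd pr < of_int m" "of_int m < fst qr + snd qr"
    "\<And>x. x \<in> X \<Longrightarrow> of_int m - 1 < fst x + snd x \<and> fst x + snd x < of_int m + 1"
    if m: "fst z + snd z + r0 < of_int m" "of_int m < fst z + snd z + r1" for m :: int
  proof -
    show "fst pr + snd pr < of_int m" "of_int m < fst qr + snd qr" using that pr qr by simp_all
    show "of_int m - 1 < fst x + snd x \<and> fst x + snd x < of_int m + 1" if "x \<in> X" for x
      using X[OF that] m widths by linarith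
  qed
  \<comment> \<open>If no line of the third family is crossed, the whole body lies between the lines $m_0$ and
      $m_0 + 1$.\<close>
  define m0 where "m0 = \<lfloor>fst z + snd z + r0\<rfloor>"
  have R0: "of_int m0 < fst x + snd x \<and> fst x + snd x < of_int m0 + 1" if "\<not> cross_r z" "x \<in> X" for x
  proof -
    have "of_int m0 < fst z + snd z + r0" "fst z + snd z + r0 < of_int m0 + 1"
      using z(7)[of m0] unfolding m0_def by linarith+
    moreover have "fst z + snd z + r1 < of_int m0 + 1"
      using that(1) calculation(2) z(8)[of "m0 + 1"] unfolding cross_r_def
      by (metis linorder_neqE_linordered_idom of_int_1 of_int_add)
    ultimately show ?thesis using X[OF that(2)] by linarith
  qed
  have conv': "convex (prod.swap ` X)"
  proof -
    have "linear (prod.swap :: point \<Rightarrow> point)" by (intro linearI) auto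
    then show ?thesis using conv by (rule convex_linear_image)
  qed
  have box': "0 < fst x \<and> fst x < 2 \<and> 0 < snd x \<and> snd x < 2" if "x \<in> prod.swap ` X" for x
    using that box by force
  have V_iff: "(1, 1) \<in> X \<longleftrightarrow> vertex_in z"
  proof
    assume "(1, 1) \<in> X"
    then obtain k where k: "k \<in> K" "(1, 1) = z + k" by (auto simp: X_def)
    then have "k = (1 - fst z, 1 - snd z)" by (cases k; cases z) auto
    then show "vertex_in z" using k by (simp add: vertex_in_def)
  next
    assume "vertex_in z"
    then have "z + (1 - fst z, 1 - snd z) \<in> X" by (auto simp: X_def vertex_in_def)
    then show "(1, 1) \<in> X" by (cases z) simp
  qed
  show ?thesis
  proof (cases "vertex_in z")
    case True
    note v = vertex_crosses[OF g True]
    have "cell_count X = 6"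
    proof (rule count_at_vertex[OF conv box])
      show "1 < fst x + snd x \<and> fst x + snd x < 3" if "x \<in> X" for x
        using R1(3)[of 2 x] v that by simp
      show "(1, 1) \<in> X" using True V_iff by simp
    qed
    then show ?thesis using True by (simp add: X_def)
  next
    case nV: False
    have "cell_count X = Suc (of_bool (cross_s z) + of_bool (cross_t z) + of_bool (cross_r z))"
    proof (cases "cross_r z")
      case r: True
      then obtain m :: int where m: "fst z + snd z + r0 < of_int m" "of_int m < fst z + snd z + r1"
        unfolding cross_r_def by blast
      note R = R1[OF m]
      show ?thesis
      proof (cases "cross_s z"; cases "cross_t z")
        assume s: "cross_s z" and t: "cross_t z"
        have "cell_count X = 4"
        proof (cases "m = 2")
          case True
          show ?thesis
            by (rule count_around_vertex[OF conv box cl ps(1) S1(1)[OF s] qs(1) S1(2)[OF s] pt(1) T1(1)[OF t] qt(1) T1(2)[OF t] _ pr(1) _ qr(1)])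
               (use R True nV V_iff in simp_all)
        next
          case False
          show ?thesis
            by (rule count_all_away_from_vertex[OF conv box ps(1) S1(1)[OF s] qs(1) S1(2)[OF s] pt(1) T1(1)[OF t] qt(1) T1(2)[OF t] R(3) pr(1) R(1) qr(1) R(2) False])
        qed
        then show ?thesis using r s t by simp
      next
        assume s: "cross_s z" and t: "\<not> cross_t z"
        have "cell_count X = 3"
          by (rule count_fst_sum[OF conv box T0[OF t] ps(1) S1(1)[OF s] qs(1) S1(2)[OF s] R(3) pr(1) R(1) qr(1) R(2)])
        then show ?thesis using r s t by simp
      next
        assume s: "\<not> cross_s z" and t: "cross_t z"
        have "cell_count (prod.swap ` X) = 3"
          by (rule count_fst_sum[OF conv' box', of "prod.swap pt" "prod.swap qt" m "prod.swap pr" "prod.swap qr"])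
             (use S0[OF s] T1[OF t] pt qt pr qr R in \<open>auto simp: add.commute\<close>)
        then show ?thesis using r s t by (simp add: cell_count_swap)
      next
        assume s: "\<not> cross_s z" and t: "\<not> cross_t z"
        have "cell_count X = 2"
          by (rule count_sum[OF conv box S0[OF s] T0[OF t] pr(1) R(1) qr(1) R(2)])
        then show ?thesis using r s t by simp
      qed
    next
      case r: False
      show ?thesis
      proof (cases "cross_s z"; cases "cross_t z")
        assume s: "cross_s z" and t: "cross_t z"
        have "cell_count X = 3"
          by (rule count_fst_snd[OF conv box ps(1) S1(1)[OF s] qs(1) S1(2)[OF s] pt(1) T1(1)[OF t] qt(1) T1(2)[OF t] R0[OF r]])
        then show ?thesis using r s t by simp
      next
        assume s: "cross_s z" and t: "\<not> cross_t z"
        have "cell_count X = 2"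
          by (rule count_fst[OF conv box T0[OF t] ps(1) S1(1)[OF s] qs(1) S1(2)[OF s] R0[OF r]])
        then show ?thesis using r s t by simp
      next
        assume s: "\<not> cross_s z" and t: "cross_t z"
        have "cell_count (prod.swap ` X) = 2"
          by (rule count_fst[OF conv' box', of "prod.swap pt" "prod.swap qt" m0])
             (use S0[OF s] T1[OF t] pt qt R0[OF r] in \<open>auto simp: add.commute\<close>)
        then show ?thesis using r s t by (simp add: cell_count_swap)
      next
        assume s: "\<not> cross_s z" and t: "\<not> cross_t z"
        have "cell_count X = 1"
          by (rule count_none[OF conv box ne S0[OF s] T0[OF t] R0[OF r]])
        then show ?thesis using r s t by simp
      qed
    qed
    then show ?thesis using nV by (simp add: X_def)
  qed
qed

definition "unit_square = ({0..<1} \<times> {0..<1} :: point set)"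

lemma unit_square_borel: "unit_square \<in> sets borel"
  unfolding unit_square_def by (rule borel_Times) auto

lemma prob_space_unit_square: "prob_space (restrict_space lborel unit_square)"
  by (rule prob_space_restrict_space)
     (use unit_square_borel in \<open>auto simp: unit_square_def emeasure_plane_Times\<close>)

lemma cross_borel:
  "{z. cross_s z} \<in> sets borel" "{z. cross_t z} \<in> sets borel" "{z. cross_r z} \<in> sets borel" "{z. vertex_in z} \<in> sets borel"
proof -
  have "open {z. cross_s z}" "open {z. cross_t z}"
    unfolding cross_s_def cross_t_def by (intro open_Collect_less continuous_intros)+
  then show "{z. cross_s z} \<in> sets borel" "{z. cross_t z} \<in> sets borel" by (auto intro: borel_open)
  have "open {z. cross_r z}"
    unfolding cross_r_def by (intro open_Collect_ex open_Collect_conj open_Collect_less continuous_intros)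
  then show "{z. cross_r z} \<in> sets borel" by (rule borel_open)
  have "{z. vertex_in z} = (\<lambda>z. (1 - fst z, 1 - snd z)) -` K" by (auto simp: vertex_in_def)
  also have "closed \<dots>" using compact
    by (intro closed_vimage compact_imp_closed continuous_intros)
  finally show "{z. vertex_in z} \<in> sets borel" by (rule borel_closed)
qed

text \<open>For every fixed value of one coordinate the other one still makes $s + t$ uniform modulo 1. Hence the
third family is crossed with probability $w$ independently of either coordinate.\<close>

lemma emeasure_cross_r:
  assumes I: "I \<in> sets borel"
  shows "emeasure lborel {z. fst z \<in> I \<and> 0 \<le> snd z \<and> snd z < 1 \<and> cross_r z} = emeasure lborel I * ennreal w"
    and "emeasure lborel {z. snd z \<in> I \<and> 0 \<le> fst z \<and> fst z < 1 \<and> cross_r z} = emeasure lborel I * ennreal w"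
proof -
  let ?X = "{z. fst z \<in> I \<and> 0 \<le> snd z \<and> snd z < 1 \<and> cross_r z}"
    and ?Y = "{z. snd z \<in> I \<and> 0 \<le> fst z \<and> fst z < 1 \<and> cross_r z}"
    and ?Z = "\<lambda>x. {y. 0 \<le> y \<and> y < 1 \<and> (\<exists>m::int. y + (x + r0) < of_int m \<and> of_int m < y + (x + r0) + w)}"
  have w: "0 \<le> w" "w \<le> 1" using pos widths by auto
  have "?X = (I \<times> {0..<1}) \<inter> {z. cross_r z}"
    "?Y = ({0..<1} \<times> I) \<inter> {z. cross_r z}" by auto
  then have m: "?X \<in> sets borel"
    "?Y \<in> sets borel"
    using I by (simp_all add: sets.Int cross_borel borel_Times)
  have c: "emeasure lborel (?Z x) = ennreal w" for x
    by (rule measure_crossing_shifts[OF w])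
  have bm: "(?Z x) \<in> sets borel" for x
  proof -
    have "open {y. \<exists>m::int. y + (x + r0) < of_int m \<and> of_int m < y + (x + r0) + w}"
      by (intro open_Collect_ex open_Collect_conj open_Collect_less continuous_intros)
    moreover have "(?Z x) =
      {0..<1} \<inter> {y. \<exists>m::int. y + (x + r0) < of_int m \<and> of_int m < y + (x + r0) + w}" by auto
    ultimately show ?thesis by (simp add: borel_open sets.Int)
  qed
  have r: "cross_r (x, y) \<longleftrightarrow> (\<exists>m::int. y + (x + r0) < of_int m \<and> of_int m < y + (x + r0) + w)"
    "cross_r (y, x) \<longleftrightarrow> (\<exists>m::int. y + (x + r0) < of_int m \<and> of_int m < y + (x + r0) + w)" for x y
    unfolding cross_r_def widths(7) by (simp_all add: algebra_simps)
  have "emeasure lborel ?X =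
    (\<integral>\<^sup>+x. (\<integral>\<^sup>+y. indicator ?X (x, y) \<partial>lborel) \<partial>lborel)"
    using m by (subst nn_integral_plane(1)[symmetric]) auto
  also have "\<dots> = (\<integral>\<^sup>+x. ennreal w * indicator I x \<partial>lborel)"
  proof (rule nn_integral_cong)
    fix x
    have "(\<integral>\<^sup>+y. indicator ?X (x, y) \<partial>lborel)
      = (\<integral>\<^sup>+y. indicator I x * indicator (?Z x) y \<partial>lborel)"
      by (rule nn_integral_cong) (simp add: indicator_def r(1))
    also have "\<dots> = ennreal w * indicator I x"
      using bm[of x] by (simp add: nn_integral_cmult c mult.commute)
    finally show "(\<integral>\<^sup>+y. indicator ?X (x, y) \<partial>lborel) = ennreal w * indicator I x" .
  qed
  also have "\<dots> = emeasure lborel I * ennreal w" using I by (simp add: nn_integral_cmult_indicator mult.commute)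
  finally show "emeasure lborel ?X = emeasure lborel I * ennreal w" .
  have "emeasure lborel ?Y =
    (\<integral>\<^sup>+x. (\<integral>\<^sup>+y. indicator ?Y (y, x) \<partial>lborel) \<partial>lborel)"
    using m by (subst nn_integral_plane(2)[symmetric]) auto
  also have "\<dots> = (\<integral>\<^sup>+x. ennreal w * indicator I x \<partial>lborel)"
  proof (rule nn_integral_cong)
    fix x
    have "(\<integral>\<^sup>+y. indicator ?Y (y, x) \<partial>lborel)
      = (\<integral>\<^sup>+y. indicator I x * indicator (?Z x) y \<partial>lborel)"
      by (rule nn_integral_cong) (simp add: indicator_def r(2))
    also have "\<dots> = ennreal w * indicator I x"
      using bm[of x] by (simp add: nn_integral_cmult c mult.commute)
    finally show "(\<integral>\<^sup>+y. indicator ?Y (y, x) \<partial>lborel) = ennreal w * indicator I x" .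
  qed
  also have "\<dots> = emeasure lborel I * ennreal w" using I by (simp add: nn_integral_cmult_indicator mult.commute)
  finally show "emeasure lborel ?Y = emeasure lborel I * ennreal w" .
qed

lemma emeasure_cross:
  "emeasure lborel (unit_square \<inter> {z. cross_s z}) = ennreal A"
  "emeasure lborel (unit_square \<inter> {z. cross_t z}) = ennreal B"
  "emeasure lborel (unit_square \<inter> {z. cross_r z}) = ennreal w"
  "emeasure lborel (unit_square \<inter> {z. cross_s z} \<inter> (unit_square \<inter> {z. cross_t z})) = ennreal (A * B)"
  "emeasure lborel (unit_square \<inter> {z. cross_s z} \<inter> (unit_square \<inter> {z. cross_r z})) = ennreal (A * w)"
  "emeasure lborel (unit_square \<inter> {z. cross_t z} \<inter> (unit_square \<inter> {z. cross_r z})) = ennreal (B * w)"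
proof -
  have "unit_square \<inter> {z. cross_s z} = {1 - A<..<1} \<times> {0..<1}"
    "unit_square \<inter> {z. cross_t z} = {0..<1} \<times> {1 - B<..<1}"
    "unit_square \<inter> {z. cross_s z} \<inter> (unit_square \<inter> {z. cross_t z}) = {1 - A<..<1} \<times> {1 - B<..<1}"
    "unit_square \<inter> {z. cross_r z} = {z. fst z \<in> {0..<1} \<and> 0 \<le> snd z \<and> snd z < 1 \<and> cross_r z}"
    "unit_square \<inter> {z. cross_s z} \<inter> (unit_square \<inter> {z. cross_r z}) = {z. fst z \<in> {1 - A<..<1} \<and> 0 \<le> snd z \<and> snd z < 1 \<and> cross_r z}"
    "unit_square \<inter> {z. cross_t z} \<inter> (unit_square \<inter> {z. cross_r z}) = {z. snd z \<in> {1 - B<..<1} \<and> 0 \<le> fst z \<and> fst z < 1 \<and> cross_r z}"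
    using widths pos by (auto simp: unit_square_def cross_s_def cross_t_def)
  then show
    "emeasure lborel (unit_square \<inter> {z. cross_s z}) = ennreal A"
    "emeasure lborel (unit_square \<inter> {z. cross_t z}) = ennreal B"
    "emeasure lborel (unit_square \<inter> {z. cross_r z}) = ennreal w"
    "emeasure lborel (unit_square \<inter> {z. cross_s z} \<inter> (unit_square \<inter> {z. cross_t z})) = ennreal (A * B)"
    "emeasure lborel (unit_square \<inter> {z. cross_s z} \<inter> (unit_square \<inter> {z. cross_r z})) = ennreal (A * w)"
    "emeasure lborel (unit_square \<inter> {z. cross_t z} \<inter> (unit_square \<inter> {z. cross_r z})) = ennreal (B * w)"
    using pos emeasure_cross_r[of "{0..<1}"] emeasure_cross_r[of "{1 - A<..<1}"] emeasure_cross_r[of "{1 - B<..<1}"]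
    by (simp_all add: emeasure_plane_Times ennreal_mult)
qed

text \<open>The body lies inside the lower or inside the upper triangle of the square. The positions of
either kind form a corner triangle with legs $1 - (A + B + w) / 2$, and the point reflection
$(s, t) \mapsto (1 - A - s, 1 - B - t)$ exchanges the two.\<close>

lemma emeasure_no_cross:
  "emeasure lborel (unit_square - (unit_square \<inter> {z. cross_s z} \<union> unit_square \<inter> {z. cross_t z} \<union> unit_square \<inter> {z. cross_r z}))
    = ennreal ((1 - (A + B + w) / 2)\<^sup>2)"
proof -
  define T where "T = {z::point. 0 \<le> fst z \<and> 0 \<le> snd z \<and> fst z + snd z \<le> 1 - r1}"
  define T' where "T' = (\<lambda>z. (- 1 * fst z + 0 * snd z + (1 - A), 0 * fst z + - 1 * snd z + (1 - B))) -` T"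
  have clT: "closed T" unfolding T_def by (intro closed_Collect_conj closed_Collect_le continuous_intros)
  have clT': "closed T'" unfolding T'_def by (intro closed_vimage clT continuous_intros)
  have "unit_square - (unit_square \<inter> {z. cross_s z} \<union> unit_square \<inter> {z. cross_t z} \<union> unit_square \<inter> {z. cross_r z}) = T \<union> T'"
  proof (intro set_eqI iffI)
    fix z assume "z \<in> unit_square - (unit_square \<inter> {z. cross_s z} \<union> unit_square \<inter> {z. cross_t z} \<union> unit_square \<inter> {z. cross_r z})"
    then have z: "0 \<le> fst z" "0 \<le> snd z" "fst z + A \<le> 1" "snd z + B \<le> 1" "\<not> cross_r z"
      by (auto simp: unit_square_def cross_s_def cross_t_def)
    have "\<not> (fst z + snd z + r0 < 1 \<and> 1 < fst z + snd z + r1)"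
      using z(5) unfolding cross_r_def by (metis of_int_1)
    then have "1 \<le> fst z + snd z + r0 \<or> fst z + snd z + r1 \<le> 1" by linarith
    then show "z \<in> T \<union> T'" using z widths(11) by (auto simp: T_def T'_def)
  next
    fix z assume z: "z \<in> T \<union> T'"
    then consider (T) "0 \<le> fst z" "0 \<le> snd z" "fst z + snd z \<le> 1 - r1"
      | (T') "fst z \<le> 1 - A" "snd z \<le> 1 - B" "1 - r0 \<le> fst z + snd z"
      using widths(11) by (auto simp: T_def T'_def)
    then have b: "0 \<le> fst z" "0 \<le> snd z" "fst z \<le> 1 - A" "snd z \<le> 1 - B"
       "fst z + snd z + r1 \<le> 1 \<or> 1 \<le> fst z + snd z + r0"
      by (cases; use widths in linarith)+
    have "\<not> cross_r z" unfolding cross_r_def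
    proof safe
      fix m :: int assume m: "fst z + snd z + r0 < of_int m" "of_int m < fst z + snd z + r1"
      have "0 < (of_int m :: real)" "of_int m < (2::real)" using m b widths by linarith+
      then have "m = 1" by linarith
      then show False using m b(5) by simp
    qed
    then show "z \<in> unit_square - (unit_square \<inter> {z. cross_s z} \<union> unit_square \<inter> {z. cross_t z} \<union> unit_square \<inter> {z. cross_r z})"
      using b pos by (cases z) (auto simp: unit_square_def cross_s_def cross_t_def)
  qed
  also have "emeasure lborel (T \<union> T') = emeasure lborel T + emeasure lborel T'"
  proof (rule plus_emeasure[symmetric])
    show "T \<inter> T' = {}" using widths(7,11) pos by (auto simp: T_def T'_def)
  qed (use clT clT' in \<open>simp_all add: borel_closed\<close>)
  also have "emeasure lborel T' = emeasure lborel T"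
  proof -
    have ind: "indicator T (- 1 * fst z + 0 * snd z + (1 - A), 0 * fst z + - 1 * snd z + (1 - B)) = (indicator T' z :: ennreal)" for z
      unfolding T'_def by (simp add: indicator_def)
    have "emeasure lborel T' = (\<integral>\<^sup>+z. indicator T (- 1 * fst z + 0 * snd z + (1 - A), 0 * fst z + - 1 * snd z + (1 - B)) \<partial>lborel)"
      unfolding ind using clT' by (simp add: borel_closed)
    also have "\<dots> = (\<integral>\<^sup>+z. indicator T z \<partial>lborel)"
      using clT nn_integral_plane_affine[of "indicator T" "- 1" "- 1" 0 0 "1 - A" "1 - B"] by (simp add: borel_closed)
    finally show ?thesis using clT by (simp add: borel_closed)
  qed
  also have "emeasure lborel T = ennreal ((1 - r1)\<^sup>2 / 2)"
    unfolding T_def using widths by (intro emeasure_corner_triangle) simp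
  also have "ennreal ((1 - r1)\<^sup>2 / 2) + ennreal ((1 - r1)\<^sup>2 / 2) = ennreal ((1 - (A + B + w) / 2)\<^sup>2)"
    by (simp add: r1_def flip: ennreal_plus)
  finally show ?thesis .
qed

lemma AE_generic: "AE z in lborel. z \<in> unit_square \<longrightarrow> generic z"
proof -
  have "AE z::point in lborel. \<forall>m::int. fst z + snd z \<noteq> of_int m - r0 \<and> fst z + snd z \<noteq> of_int m - r1"
    by (subst AE_all_countable) (auto intro: AE_conjI AE_plane_coords)
  then show ?thesis
    using AE_plane_coords(1)[of 0] AE_plane_coords(2)[of 0] AE_plane_coords(1)[of "1 - A"] AE_plane_coords(2)[of "1 - B"]
  proof eventually_elim
    case (elim z)
    have "fst z + snd z + r0 \<noteq> of_int m \<and> fst z + snd z + r1 \<noteq> of_int m" for m :: int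
      using elim(1)[rule_format, of m] by (simp add: eq_diff_eq)
    with elim(2-) show ?case by (cases z) (auto simp: generic_def unit_square_def eq_diff_eq)
  qed
qed

text \<open>The positions that bring the body over $(1, 1)$ form a reflected copy of the body, and this copy lies in
the unit square.\<close>

lemma emeasure_vertex: "emeasure lborel (unit_square \<inter> {z. vertex_in z}) = ennreal v"
proof -
  have cl: "closed K" using compact by (rule compact_imp_closed)
  have "emeasure lborel (unit_square \<inter> {z. vertex_in z}) = emeasure lborel {z. vertex_in z}"
  proof (rule emeasure_eq_AE)
    show "AE z in lborel. (z \<in> unit_square \<inter> {z. vertex_in z}) = (z \<in> {z. vertex_in z})"
      using AE_plane_coords(1)[of 1] AE_plane_coords(2)[of 1]
    proof eventually_elim
      case (elim z)
      then show ?case using bounds[of "(1 - fst z, 1 - snd z)"] widths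
        by (cases z) (auto simp: vertex_in_def unit_square_def)
    qed
  qed (use unit_square_borel cross_borel(4) in \<open>auto simp: sets.Int\<close>)
  also have "\<dots> = (\<integral>\<^sup>+z. indicator K (- 1 * fst z + 0 * snd z + 1, 0 * fst z + - 1 * snd z + 1) \<partial>lborel)"
  proof -
    have ind: "indicator K (- 1 * fst z + 0 * snd z + 1, 0 * fst z + - 1 * snd z + 1) = (indicator {z. vertex_in z} z :: ennreal)" for z
      by (simp add: indicator_def vertex_in_def)
    show ?thesis unfolding ind using cross_borel(4) by simp
  qed
  also have "\<dots> = (\<integral>\<^sup>+z. indicator K z \<partial>lborel)"
    using cl nn_integral_plane_affine[of "indicator K" "- 1" "- 1" 0 0 1 1] by (simp add: borel_closed)
  also have "\<dots> = ennreal v" using cl area by (simp add: borel_closed)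
  finally show ?thesis .
qed

lemma measurable_count: "{z. cell_count ((+) z ` K) = k} \<in> sets borel"
proof -
  have "(\<lambda>z. cell_count ((\<lambda>p. snd (p, z) + fst (p, z)) ` K)) \<in> borel \<rightarrow>\<^sub>M count_space UNIV"
    using measurable_cell_count[OF compact, of "\<lambda>q. snd q + fst q"] by (simp add: continuous_intros)
  then show ?thesis using measurable_sets[of _ borel "count_space UNIV" "{k}"] by (simp add: vimage_def)
qed

lemma emeasure_count_eq:
  assumes "X \<in> sets borel" "X \<subseteq> unit_square"
    and "\<And>z. z \<in> unit_square \<Longrightarrow> generic z \<Longrightarrow> (cell_count ((+) z ` K) = k) = (z \<in> X)"
  shows "emeasure lborel (unit_square \<inter> {z. cell_count ((+) z ` K) = k}) = emeasure lborel X"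
proof (rule emeasure_eq_AE)
  show "AE z in lborel. (z \<in> unit_square \<inter> {z. cell_count ((+) z ` K) = k}) = (z \<in> X)"
    using AE_generic by eventually_elim (use assms in auto)
qed (use assms(1) unit_square_borel measurable_count in \<open>auto simp: sets.Int\<close>)

text \<open>Outside the null set of positions that are not generic, the event of each count is a Boolean combination
of the three crossings and the event that $(1, 1)$ is covered.\<close>

lemma emeasure_count:
  assumes k: "1 \<le> k" "k \<le> 6"
  shows "emeasure lborel (unit_square \<inter> {z. cell_count ((+) z ` K) = k}) = ennreal (count_prob A B w v k) \<and>
    0 \<le> count_prob A B w v k"
proof -
  let ?N = "restrict_space lborel unit_square"
  interpret N: prob_space ?N by (rule prob_space_unit_square)
  define S T R V where "S = unit_square \<inter> {z. cross_s z}" and "T = unit_square \<inter> {z. cross_t z}"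
    and "R = unit_square \<inter> {z. cross_r z}" and "V = unit_square \<inter> {z. vertex_in z}"
  have borel: "S \<in> sets borel" "T \<in> sets borel" "R \<in> sets borel" "V \<in> sets borel"
    using unit_square_borel cross_borel by (auto simp: S_def T_def R_def V_def)
  have sub: "S \<subseteq> unit_square" "T \<subseteq> unit_square" "R \<subseteq> unit_square" "V \<subseteq> unit_square"
    by (auto simp: S_def T_def R_def V_def)
  have ev_iff: "X \<in> N.events \<longleftrightarrow> X \<in> sets borel \<and> X \<subseteq> unit_square" for X
    using unit_square_borel by (subst sets_restrict_space_iff) auto
  have ev: "S \<in> N.events" "T \<in> N.events" "R \<in> N.events" "V \<in> N.events"
    using borel sub ev_iff by auto
  have sp: "space ?N = unit_square" by (simp add: space_restrict_space)
  have em: "emeasure lborel X = ennreal (N.prob X)" if "X \<in> N.events" for X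
    using that N.emeasure_eq_measure[of X] unit_square_borel ev_iff by (simp add: emeasure_restrict_space)
  have prob: "N.prob X = r" if "X \<in> N.events" "emeasure lborel X = ennreal r" "0 \<le> r" for X r
  proof -
    have "ennreal (N.prob X) = ennreal r" using em[OF that(1)] that(2) by simp
    then show ?thesis using that(3) by (subst (asm) ennreal_inj) simp_all
  qed
  have P: "N.prob S = A" "N.prob T = B" "N.prob R = w" "N.prob (S \<inter> T) = A * B" "N.prob (S \<inter> R) = A * w"
     "N.prob (T \<inter> R) = B * w" "N.prob (space ?N - (S \<union> T \<union> R)) = (1 - (A + B + w) / 2)\<^sup>2" "N.prob V = v"
  proof -
    note e = emeasure_cross[folded S_def T_def R_def] emeasure_no_cross[folded S_def T_def R_def]
      emeasure_vertex[folded V_def]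
    show "N.prob S = A" by (rule prob[OF ev(1) e(1)]) (use pos in simp)
    show "N.prob T = B" by (rule prob[OF ev(2) e(2)]) (use pos in simp)
    show "N.prob R = w" by (rule prob[OF ev(3) e(3)]) (use pos in simp)
    show "N.prob (S \<inter> T) = A * B" by (rule prob[OF sets.Int[OF ev(1,2)] e(4)]) (use pos in simp)
    show "N.prob (S \<inter> R) = A * w" by (rule prob[OF sets.Int[OF ev(1,3)] e(5)]) (use pos in simp)
    show "N.prob (T \<inter> R) = B * w" by (rule prob[OF sets.Int[OF ev(2,3)] e(6)]) (use pos in simp)
    show "N.prob (space ?N - (S \<union> T \<union> R)) = (1 - (A + B + w) / 2)\<^sup>2"
      unfolding sp
      by (rule prob[OF _ e(7)]) (use sets.compl_sets[OF sets.Un[OF sets.Un[OF ev(1,2)] ev(3)]] sp in simp_all)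
    show "N.prob V = v" by (rule prob[OF ev(4) e(8) area(2)])
  qed
  note cnt = N.prob_count_of_three_events[OF ev(1-3), unfolded P]
  have STR: "N.prob (S \<inter> T \<inter> R) = (A * B + A * w + B * w) / 2 - (A\<^sup>2 + B\<^sup>2 + w\<^sup>2) / 4"
    unfolding cnt by (simp add: power2_eq_square field_simps)
  have two: "N.prob ((S \<inter> T \<union> S \<inter> R \<union> T \<inter> R) - S \<inter> T \<inter> R) = 3 * (A\<^sup>2 + B\<^sup>2 + w\<^sup>2) / 4 - (A * B + A * w + B * w) / 2"
    unfolding cnt by (simp add: power2_eq_square field_simps)
  have one: "N.prob ((S \<union> T \<union> R) - (S \<inter> T \<union> S \<inter> R \<union> T \<inter> R)) =
      (A + B + w) - (A * B + A * w + B * w) / 2 - 3 * (A\<^sup>2 + B\<^sup>2 + w\<^sup>2) / 4"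
    unfolding cnt by (simp add: power2_eq_square field_simps)
  have Vsub: "z \<in> S \<and> z \<in> T \<and> z \<in> R" if "z \<in> V" "generic z" for z
    using that vertex_crosses(1-3)[OF that(2)] by (simp add: S_def T_def R_def V_def)
  have VSTR: "N.prob (V \<inter> (S \<inter> T \<inter> R)) = v"
  proof (rule prob)
    have "emeasure lborel (V \<inter> (S \<inter> T \<inter> R)) = emeasure lborel V"
    proof (rule emeasure_eq_AE)
      show "AE z in lborel. (z \<in> V \<inter> (S \<inter> T \<inter> R)) = (z \<in> V)"
        using AE_generic by eventually_elim (use Vsub sub in blast)
    qed (use borel in \<open>auto simp: sets.Int\<close>)
    then show "emeasure lborel (V \<inter> (S \<inter> T \<inter> R)) = ennreal v"
      by (simp add: emeasure_vertex[folded V_def])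
  qed (use ev area(2) in auto)
  have four: "N.prob (S \<inter> T \<inter> R - V) = (A * B + A * w + B * w) / 2 - (A\<^sup>2 + B\<^sup>2 + w\<^sup>2) / 4 - v"
    using N.finite_measure_Diff'[of "S \<inter> T \<inter> R" V] ev by (simp add: STR VSTR Int_commute[of _ V])
  have cc: "cell_count ((+) z ` K) = (if z \<in> V then 6 else Suc (of_bool (z \<in> S) + of_bool (z \<in> T) + of_bool (z \<in> R)))"
    if "z \<in> unit_square" "generic z" for z
    using count_generic[OF that(2)] that(1) by (simp add: S_def T_def R_def V_def)
  have fin: "emeasure lborel (unit_square \<inter> {z. cell_count ((+) z ` K) = k}) = ennreal (count_prob A B w v k) \<and>
      0 \<le> count_prob A B w v k"
    if X: "X \<in> N.events" "N.prob X = count_prob A B w v k"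
      "\<And>z. z \<in> unit_square \<Longrightarrow> generic z \<Longrightarrow> (cell_count ((+) z ` K) = k) = (z \<in> X)" for X
  proof
    show "emeasure lborel (unit_square \<inter> {z. cell_count ((+) z ` K) = k}) = ennreal (count_prob A B w v k)"
      using emeasure_count_eq[of X k] em[OF X(1)] X ev_iff by simp
    show "0 \<le> count_prob A B w v k" unfolding X(2)[symmetric] by (rule measure_nonneg)
  qed
  consider "k = 1" | "k = 2" | "k = 3" | "k = 4" | "k = 5" | "k = 6" using k by linarith
  then show ?thesis
  proof cases
    case 1
    have X: "unit_square - (S \<union> T \<union> R) \<in> N.events" using sets.compl_sets[OF sets.Un[OF sets.Un[OF ev(1,2)] ev(3)]] sp by simp
    have p: "N.prob (unit_square - (S \<union> T \<union> R)) = count_prob A B w v k" using 1 by (simp add: P[unfolded sp] count_prob_def)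
    show ?thesis
    proof (rule fin[OF X p])
      fix z assume z: "z \<in> unit_square" "generic z"
      show "(cell_count ((+) z ` K) = k) = (z \<in> unit_square - (S \<union> T \<union> R))"
        using Vsub[OF _ z(2)] z(1) unfolding cc[OF z] 1
        by (cases "z \<in> V"; cases "z \<in> S"; cases "z \<in> T"; cases "z \<in> R") simp_all
    qed
  next
    case 2
    have X: "(S \<union> T \<union> R) - (S \<inter> T \<union> S \<inter> R \<union> T \<inter> R) \<in> N.events" using ev by auto
    have p: "N.prob ((S \<union> T \<union> R) - (S \<inter> T \<union> S \<inter> R \<union> T \<inter> R)) = count_prob A B w v k" using 2 by (simp add: one count_prob_def)
    show ?thesis
    proof (rule fin[OF X p])
      fix z assume z: "z \<in> unit_square" "generic z"
      show "(cell_count ((+) z ` K) = k) = (z \<in> (S \<union> T \<union> R) - (S \<inter> T \<union> S \<inter> R \<union> T \<inter> R))"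
        using Vsub[OF _ z(2)] z(1) unfolding cc[OF z] 2
        by (cases "z \<in> V"; cases "z \<in> S"; cases "z \<in> T"; cases "z \<in> R") simp_all
    qed
  next
    case 3
    have X: "(S \<inter> T \<union> S \<inter> R \<union> T \<inter> R) - S \<inter> T \<inter> R \<in> N.events" using ev by auto
    have p: "N.prob ((S \<inter> T \<union> S \<inter> R \<union> T \<inter> R) - S \<inter> T \<inter> R) = count_prob A B w v k" using 3 by (simp add: two count_prob_def)
    show ?thesis
    proof (rule fin[OF X p])
      fix z assume z: "z \<in> unit_square" "generic z"
      show "(cell_count ((+) z ` K) = k) = (z \<in> (S \<inter> T \<union> S \<inter> R \<union> T \<inter> R) - S \<inter> T \<inter> R)"
        using Vsub[OF _ z(2)] z(1) unfolding cc[OF z] 3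
        by (cases "z \<in> V"; cases "z \<in> S"; cases "z \<in> T"; cases "z \<in> R") simp_all
    qed
  next
    case 4
    have X: "S \<inter> T \<inter> R - V \<in> N.events" using ev by auto
    have p: "N.prob (S \<inter> T \<inter> R - V) = count_prob A B w v k" using 4 by (simp add: four count_prob_def)
    show ?thesis
    proof (rule fin[OF X p])
      fix z assume z: "z \<in> unit_square" "generic z"
      show "(cell_count ((+) z ` K) = k) = (z \<in> S \<inter> T \<inter> R - V)"
        using Vsub[OF _ z(2)] z(1) unfolding cc[OF z] 4
        by (cases "z \<in> V"; cases "z \<in> S"; cases "z \<in> T"; cases "z \<in> R") simp_all
    qed
  next
    case 5
    have X: "{} \<in> N.events" using ev by auto
    have p: "N.prob ({}) = count_prob A B w v k" using 5 by (simp add:  count_prob_def)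
    show ?thesis
    proof (rule fin[OF X p])
      fix z assume z: "z \<in> unit_square" "generic z"
      show "(cell_count ((+) z ` K) = k) = (z \<in> {})"
        using Vsub[OF _ z(2)] z(1) unfolding cc[OF z] 5
        by (cases "z \<in> V"; cases "z \<in> S"; cases "z \<in> T"; cases "z \<in> R") simp_all
    qed
  next
    case 6
    have X: "V \<in> N.events" using ev by auto
    have p: "N.prob (V) = count_prob A B w v k" using 6 by (simp add: P count_prob_def)
    show ?thesis
    proof (rule fin[OF X p])
      fix z assume z: "z \<in> unit_square" "generic z"
      show "(cell_count ((+) z ` K) = k) = (z \<in> V)"
        using Vsub[OF _ z(2)] z(1) unfolding cc[OF z] 6
        by (cases "z \<in> V"; cases "z \<in> S"; cases "z \<in> T"; cases "z \<in> R") simp_all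
    qed
  qed
qed

end

section \<open>Integrals over all directions\<close>

text \<open>The two windows differ by intervals which are translates of each other by the period.\<close>

lemma integral_over_period:
  fixes f :: "real \<Rightarrow> real"
  assumes cont: "continuous_on UNIV f" and per: "\<And>x. f (x + T) = f x" and T: "0 \<le> T" and "a \<le> b"
  shows "integral {a..a + T} f = integral {b..b + T} f"
proof -
  have int: "f integrable_on {x..y}" for x y
    using cont by (intro integrable_continuous_real) (auto intro: continuous_on_subset)
  have shift: "integral {a..b} f = integral {a + T..b + T} f"
    using integral_shift[of a T b f] cont per by (auto simp: o_def intro: continuous_on_subset)
  have "integral {a..b} f + integral {b..b + T} f = integral {a..b + T} f"
    using assms int by (intro Henstock_Kurzweil_Integration.integral_combine) auto
  moreover have "integral {a..a + T} f + integral {a + T..b + T} f = integral {a..b + T} f"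
    using assms int by (intro Henstock_Kurzweil_Integration.integral_combine) auto
  ultimately show ?thesis using shift by simp
qed

lemma has_integral_shift_period:
  fixes f :: "real \<Rightarrow> real"
  assumes cont: "continuous_on UNIV f" and per: "\<And>x. f (x + T) = f x" and T: "0 \<le> T"
    and I: "(f has_integral I) {b..b + T}"
  shows "((\<lambda>x. f (x + k)) has_integral I) {0..T}"
proof -
  have "integral {0..T} (f \<circ> (\<lambda>x. x + k)) = integral {0 + k..T + k} f"
    by (intro integral_shift continuous_on_subset[OF cont]) auto
  also have "\<dots> = integral {k..k + T} f" by (simp add: add.commute)
  also have "\<dots> = integral {b..b + T} f"
    using integral_over_period[OF cont per T, of b k] integral_over_period[OF cont per T, of k b]
    by linarith
  also have "\<dots> = I" using I by (rule integral_unique)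
  finally have "integral {0..T} (\<lambda>x. f (x + k)) = I" by (simp add: o_def)
  moreover have "(\<lambda>x. f (x + k)) integrable_on {0..T}"
    using cont by (intro integrable_continuous_real continuous_on_compose2[OF cont] continuous_intros) auto
  ultimately show ?thesis by (simp add: has_integral_integrable_integral)
qed

text \<open>Integrate from $- \pi / 2$ to $3 \pi / 2$, after a shift that makes the factors $\cos x$ and
$\cos (x - \delta)$; the product changes sign at $\delta - \pi / 2$, $\pi / 2$ and $\pi / 2 + \delta$.\<close>

lemma has_integral_abs_cos_cos:
  assumes d: "0 \<le> \<delta>" "\<delta> \<le> pi"
  shows "((\<lambda>x. \<bar>cos (x + k) * cos (x + k + \<delta>)\<bar>) has_integral 2 * sin \<delta> + (pi - 2 * \<delta>) * cos \<delta>) {0..2 * pi}"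
proof -
  define G where "G x = x * cos \<delta> / 2 + sin (2 * x - \<delta>) / 4" for x
  have deriv: "(G has_vector_derivative cos x * cos (x - \<delta>)) (at x within S)" for x S
  proof -
    have "(G has_vector_derivative (cos \<delta> + cos (2 * x - \<delta>)) / 2) (at x within S)"
      unfolding G_def has_real_derivative_iff_has_vector_derivative[symmetric]
      by (auto intro!: derivative_eq_intros)
    also have "(cos \<delta> + cos (2 * x - \<delta>)) / 2 = cos x * cos (x - \<delta>)"
      using cos_times_cos[of x "x - \<delta>"] by (simp add: algebra_simps)
    finally show ?thesis .
  qed
  let ?f = "\<lambda>x. \<bar>cos (x - \<delta>) * cos x\<bar>"
  have pos: "(?f has_integral G v - G u) {u..v}"
    if "u \<le> v" "\<And>x. u \<le> x \<Longrightarrow> x \<le> v \<Longrightarrow> 0 \<le> cos x * cos (x - \<delta>)" for u v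
    by (rule has_integral_eq[OF _ fundamental_theorem_of_calculus[OF that(1) deriv]])
       (use that(2) in \<open>simp add: mult.commute\<close>)
  have neg: "(?f has_integral - (G v - G u)) {u..v}"
    if "u \<le> v" "\<And>x. u \<le> x \<Longrightarrow> x \<le> v \<Longrightarrow> cos x * cos (x - \<delta>) \<le> 0" for u v
    by (rule has_integral_eq[OF _ has_integral_neg[OF fundamental_theorem_of_calculus[OF that(1) deriv]]])
       (use that(2) in \<open>simp add: mult.commute\<close>)
  have cos_neg: "cos x \<le> 0" if "pi / 2 \<le> x" "x \<le> 3 * pi / 2" for x
    using cos_ge_zero[of "x - pi"] that by simp
  have cos_neg': "cos x \<le> 0" if "- (3 * pi / 2) \<le> x" "x \<le> - (pi / 2)" for x
    using cos_ge_zero[of "x + pi"] that by simp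
  have "(?f has_integral - (G (\<delta> - pi / 2) - G (- pi / 2)) + (G (pi / 2) - G (\<delta> - pi / 2))
     + - (G (pi / 2 + \<delta>) - G (pi / 2)) + (G (3 * pi / 2) - G (pi / 2 + \<delta>))) {- pi / 2..3 * pi / 2}"
    apply (rule has_integral_combine[of _ "pi / 2 + \<delta>"])
    subgoal using d by simp
    subgoal using d by simp
     apply (rule has_integral_combine[of _ "pi / 2"])
    subgoal using d by simp
    subgoal using d by simp
      apply (rule has_integral_combine[of _ "\<delta> - pi / 2"])
    subgoal using d by simp
    subgoal using d by simp
    subgoal by (rule neg) (use d in \<open>auto intro!: mult_nonneg_nonpos cos_ge_zero cos_neg'\<close>)
    subgoal by (rule pos) (use d in \<open>auto intro!: mult_nonneg_nonneg cos_ge_zero\<close>)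
    subgoal by (rule neg) (use d in \<open>auto intro!: mult_nonpos_nonneg cos_ge_zero cos_neg\<close>)
    subgoal by (rule pos) (use d in \<open>auto intro!: mult_nonpos_nonpos cos_ge_zero cos_neg\<close>)
    done
  moreover have "sin (3 * pi - \<delta>) = sin \<delta>"
    using sin_periodic[of "pi - \<delta>"] by (simp add: algebra_simps)
  moreover have "sin (- pi - \<delta>) = sin \<delta>"
    using sin_minus[of "pi + \<delta>"] by simp
  ultimately have "(?f has_integral 2 * sin \<delta> + (pi - 2 * \<delta>) * cos \<delta>) {- pi / 2..- pi / 2 + 2 * pi}"
    by (simp add: G_def algebra_simps add_divide_distrib diff_divide_distrib)
  then have "((\<lambda>x. ?f (x + (k + \<delta>))) has_integral 2 * sin \<delta> + (pi - 2 * \<delta>) * cos \<delta>) {0..2 * pi}"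
    by (rule has_integral_shift_period[rotated 3]) (auto intro!: continuous_intros simp: cos_add sin_add cos_diff abs_mult algebra_simps)
  then show ?thesis by (simp add: algebra_simps)
qed

text \<open>The width, in the direction of angle $\pi / 2 - x$, of a rectangle with sides $g$ and $h$ along the
axes.\<close>

definition rect_width :: "real \<Rightarrow> real \<Rightarrow> real \<Rightarrow> real" where
  "rect_width g h x = g * \<bar>sin x\<bar> + h * \<bar>cos x\<bar>"

lemma has_integral_rect_width:
  "((\<lambda>x. rect_width g h (x + k)) has_integral 4 * (g + h)) {0..2 * pi}"
proof -
  have c: "((\<lambda>x. \<bar>cos x\<bar>) has_integral (sin (pi/2) - sin (- pi/2)) + (- sin (3 * pi / 2) - (- sin (pi/2)))) {- pi / 2..3 * pi / 2}"
  proof (rule has_integral_combine[of _ "pi / 2"])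
    have "((\<lambda>x. cos x) has_integral (sin (pi/2) - sin (- pi/2))) {- pi / 2..pi/2}"
      by (rule fundamental_theorem_of_calculus)
         (auto intro!: derivative_eq_intros simp: has_real_derivative_iff_has_vector_derivative[symmetric])
    then show "((\<lambda>x. \<bar>cos x\<bar>) has_integral (sin (pi/2) - sin (- pi/2))) {- pi / 2..pi/2}"
      by (rule has_integral_eq[rotated]) (auto intro!: cos_ge_zero abs_of_nonneg[symmetric])
    have "((\<lambda>x. - cos x) has_integral (- sin (3 * pi / 2) - (- sin (pi/2)))) {pi / 2..3 * pi/2}"
      by (rule fundamental_theorem_of_calculus)
         (auto intro!: derivative_eq_intros simp: has_real_derivative_iff_has_vector_derivative[symmetric])
    then show "((\<lambda>x. \<bar>cos x\<bar>) has_integral (- sin (3 * pi / 2) - (- sin (pi/2)))) {pi / 2..3 * pi/2}"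
    proof (rule has_integral_eq[rotated])
      fix x assume "x \<in> {pi / 2..3 * pi/2}"
      then show "- cos x = \<bar>cos x\<bar>" using cos_ge_zero[of "x - pi"] by simp
    qed
  qed auto
  have s: "sin (3 * pi / 2) = - 1" using sin_periodic_pi[of "pi / 2"] by (simp add: algebra_simps)
  have c': "((\<lambda>x. \<bar>cos x\<bar>) has_integral 4) {- pi / 2..- pi / 2 + 2 * pi}"
    using c s by simp
  have cos: "((\<lambda>x. \<bar>cos (x + k)\<bar>) has_integral 4) {0..2 * pi}" for k
    by (rule has_integral_shift_period[OF _ _ _ c']) (auto intro!: continuous_intros)
  have "\<bar>sin y\<bar> = \<bar>cos (y + pi / 2)\<bar>" for y by (simp add: cos_add)
  then have "((\<lambda>x. \<bar>sin (x + k)\<bar>) has_integral 4) {0..2 * pi}"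
    using cos[of "k + pi / 2"] by (simp add: add.assoc)
  from has_integral_add[OF has_integral_mult_right[OF this, of g] has_integral_mult_right[OF cos[of k], of h]]
  show ?thesis by (simp add: rect_width_def algebra_simps)
qed

text \<open>The integral of $|\sin x \cos (x + \delta)|$ over a period.\<close>

definition sin_cos_integral :: "real \<Rightarrow> real" where
  "sin_cos_integral \<delta> = (if \<delta> \<le> pi / 2 then 2 * cos \<delta> + 2 * \<delta> * sin \<delta> else - 2 * cos \<delta> + (2 * pi - 2 * \<delta>) * sin \<delta>)"

text \<open>Up to sign the sine is a cosine shifted by $\pi / 2$ in either direction; the direction is chosen such
that $\delta$ stays between 0 and $\pi$.\<close>

lemma has_integral_abs_sin_cos:
  assumes d: "0 \<le> \<delta>" "\<delta> \<le> pi"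
  shows "((\<lambda>x. \<bar>sin (x + k) * cos (x + k + \<delta>)\<bar>) has_integral sin_cos_integral \<delta>) {0..2 * pi}"
    and "((\<lambda>x. \<bar>cos (x + k) * sin (x + k + \<delta>)\<bar>) has_integral sin_cos_integral \<delta>) {0..2 * pi}"
proof -
  define \<epsilon> where "\<epsilon> = (if \<delta> \<le> pi / 2 then pi / 2 else - pi / 2)"
  have m: "2 * sin (\<delta> + \<epsilon>) + (pi - 2 * (\<delta> + \<epsilon>)) * cos (\<delta> + \<epsilon>) = sin_cos_integral \<delta>"
    by (simp add: sin_cos_integral_def \<epsilon>_def sin_add cos_add sin_diff cos_diff algebra_simps)
  have e: "0 \<le> \<delta> + \<epsilon>" "\<delta> + \<epsilon> \<le> pi" using d by (auto simp: \<epsilon>_def)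
  have a: "\<bar>cos (y - \<epsilon>)\<bar> = \<bar>sin y\<bar>" "\<bar>cos (y + \<epsilon>)\<bar> = \<bar>sin y\<bar>" for y
    by (simp_all add: \<epsilon>_def cos_add cos_diff)
  show "((\<lambda>x. \<bar>sin (x + k) * cos (x + k + \<delta>)\<bar>) has_integral sin_cos_integral \<delta>) {0..2 * pi}"
  proof -
    have "x + (k - \<epsilon>) + (\<delta> + \<epsilon>) = x + k + \<delta>" "x + (k - \<epsilon>) = x + k - \<epsilon>" for x by simp_all
    then show ?thesis
      using has_integral_abs_cos_cos[OF e, of "k - \<epsilon>"] by (simp only: m abs_mult a(1))
  qed
  have "x + k + (\<delta> + \<epsilon>) = x + k + \<delta> + \<epsilon>" for x by simp
  then show "((\<lambda>x. \<bar>cos (x + k) * sin (x + k + \<delta>)\<bar>) has_integral sin_cos_integral \<delta>) {0..2 * pi}"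
    using has_integral_abs_cos_cos[OF e, of k] by (simp only: m abs_mult a(2))
qed

lemma has_integral_rect_width_mult:
  assumes d: "0 \<le> \<delta>" "\<delta> \<le> pi"
  shows "((\<lambda>x. rect_width g h (x + k) * rect_width g h (x + k + \<delta>)) has_integral
     (g\<^sup>2 + h\<^sup>2) * (2 * sin \<delta> + (pi - 2 * \<delta>) * cos \<delta>) + 2 * g * h * sin_cos_integral \<delta>) {0..2 * pi}"
proof -
  have s: "\<bar>sin y\<bar> = \<bar>cos (y + pi / 2)\<bar>" for y by (simp add: cos_add)
  have "((\<lambda>x. \<bar>sin (x + k) * sin (x + k + \<delta>)\<bar>) has_integral 2 * sin \<delta> + (pi - 2 * \<delta>) * cos \<delta>) {0..2 * pi}"
    using has_integral_abs_cos_cos[OF d, of "k + pi / 2"]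
    by (simp only: abs_mult s) (simp add: algebra_simps)
  note sum = has_integral_add[OF has_integral_add[OF has_integral_mult_right[OF this, of "g\<^sup>2"]
      has_integral_mult_right[OF has_integral_abs_cos_cos[OF d, of k], of "h\<^sup>2"]]
     has_integral_mult_right[OF has_integral_add[OF has_integral_abs_sin_cos[OF d, of k]], of "g * h"]]
  show ?thesis
    by (rule has_integral_eq_rhs[OF has_integral_eq[OF _ sum]])
       (simp_all add: rect_width_def abs_mult power2_eq_square algebra_simps)
qed

section \<open>The rectangle in skew coordinates\<close>

text \<open>The linear form whose range on the rectangle has length \<open>rect_width\<close>: the component of $p$ in the
direction of angle $\pi / 2 - \eta$.\<close>

definition rect_form :: "real \<Rightarrow> point \<Rightarrow> real" where
  "rect_form \<eta> p = fst p * sin \<eta> + snd p * cos \<eta>"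

text \<open>The least value of the form: by central symmetry, its value at the centre minus half of the
width.\<close>

definition rect_low :: "real \<Rightarrow> real \<Rightarrow> real \<Rightarrow> real" where
  "rect_low g h \<eta> = (rect_form \<eta> (g, h) - rect_width g h \<eta>) / 2"

lemma rect_form_range:
  assumes "0 \<le> g" "0 \<le> h"
  shows "p \<in> {0..g} \<times> {0..h} \<Longrightarrow> rect_low g h \<eta> \<le> rect_form \<eta> p \<and> rect_form \<eta> p \<le> rect_low g h \<eta> + rect_width g h \<eta>"
    and "\<exists>p\<in>{0..g} \<times> {0..h}. rect_form \<eta> p = rect_low g h \<eta>"
    and "\<exists>p\<in>{0..g} \<times> {0..h}. rect_form \<eta> p = rect_low g h \<eta> + rect_width g h \<eta>"
proof -
  have lin: "(g * t - g * \<bar>t\<bar>) / 2 \<le> x * t \<and> x * t \<le> (g * t + g * \<bar>t\<bar>) / 2" if "0 \<le> x" "x \<le> g" for g x t :: real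
  proof (cases "0 \<le> t")
    case True
    then have "0 \<le> x * t" "x * t \<le> g * t" using that by (auto intro: mult_right_mono)
    then show ?thesis using True by simp
  next
    case False
    then have "x * t \<le> 0" "g * t \<le> x * t" using that by (auto intro: mult_right_mono_neg mult_nonneg_nonpos)
    then show ?thesis using False by simp
  qed
  show "rect_low g h \<eta> \<le> rect_form \<eta> p \<and> rect_form \<eta> p \<le> rect_low g h \<eta> + rect_width g h \<eta>" if "p \<in> {0..g} \<times> {0..h}"
  proof -
    have b: "0 \<le> fst p" "fst p \<le> g" "0 \<le> snd p" "snd p \<le> h" using that by auto
    show ?thesis
      using lin[OF b(1,2), of "sin \<eta>"] lin[OF b(3,4), of "cos \<eta>"]
      unfolding rect_low_def rect_form_def rect_width_def fst_conv snd_conv by argo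
  qed
  have low: "\<exists>x. 0 \<le> x \<and> x \<le> g \<and> x * t = (g * t - g * \<bar>t\<bar>) / 2" if "0 \<le> g" for g t :: real
    by (rule exI[of _ "if 0 \<le> t then 0 else g"]) (use that in auto)
  have high: "\<exists>x. 0 \<le> x \<and> x \<le> g \<and> x * t = (g * t + g * \<bar>t\<bar>) / 2" if "0 \<le> g" for g t :: real
    by (rule exI[of _ "if 0 \<le> t then g else 0"]) (use that in auto)
  obtain x y where xy: "0 \<le> x" "x \<le> g" "x * sin \<eta> = (g * sin \<eta> - g * \<bar>sin \<eta>\<bar>) / 2"
    "0 \<le> y" "y \<le> h" "y * cos \<eta> = (h * cos \<eta> - h * \<bar>cos \<eta>\<bar>) / 2"
    using low[OF assms(1), of "sin \<eta>"] low[OF assms(2), of "cos \<eta>"] by blast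
  show "\<exists>p\<in>{0..g} \<times> {0..h}. rect_form \<eta> p = rect_low g h \<eta>"
    by (rule bexI[of _ "(x, y)"]) (use xy in \<open>simp_all add: rect_low_def rect_form_def rect_width_def field_simps\<close>)
  obtain x y where xy: "0 \<le> x" "x \<le> g" "x * sin \<eta> = (g * sin \<eta> + g * \<bar>sin \<eta>\<bar>) / 2"
    "0 \<le> y" "y \<le> h" "y * cos \<eta> = (h * cos \<eta> + h * \<bar>cos \<eta>\<bar>) / 2"
    using high[OF assms(1), of "sin \<eta>"] high[OF assms(2), of "cos \<eta>"] by blast
  show "\<exists>p\<in>{0..g} \<times> {0..h}. rect_form \<eta> p = rect_low g h \<eta> + rect_width g h \<eta>"
    by (rule bexI[of _ "(x, y)"]) (use xy in \<open>simp_all add: rect_low_def rect_form_def rect_width_def field_simps\<close>)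
qed

lemma rect_width_pos: "0 < g \<Longrightarrow> 0 < h \<Longrightarrow> 0 < rect_width g h \<eta>"
proof -
  assume gh: "0 < g" "0 < h"
  have "sin \<eta> \<noteq> 0 \<or> cos \<eta> \<noteq> 0"
    by (metis add.right_neutral power_zero_numeral sin_cos_squared_add zero_neq_one)
  then show ?thesis unfolding rect_width_def
    using gh by (auto intro: add_pos_nonneg add_nonneg_pos)
qed

text \<open>The rectangle, turned by $\psi$, in skew coordinates and moved such that the least values of both
coordinates are 0. The parameters $b$ and $c$ stand for the sides divided by $Q$.\<close>

definition skew_rect :: "real \<Rightarrow> real \<Rightarrow> real \<Rightarrow> real \<Rightarrow> real \<Rightarrow> real \<Rightarrow> point \<Rightarrow> point" where
  "skew_rect g h b c \<alpha> \<psi> p =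
    (b * (rect_low g h (\<psi> - \<alpha>) + rect_width g h (\<psi> - \<alpha>) - rect_form (\<psi> - \<alpha>) p),
     c * (rect_form \<psi> p - rect_low g h \<psi>))"

text \<open>The relation \<open>rel\<close> expresses $s + t$ by the form in the direction normal to the side $a$. Applied to the
corner $(g, h)$, and hence to the centre, it gives the position of the range of $s + t$. The area is that of the
rectangle times the determinant $b c \sin \alpha$ of the transformation.\<close>

lemma normal_body_rectangle:
  assumes gh: "0 < g" "0 < h" and pos: "0 < a" "0 < b" "0 < c" "0 < sin \<alpha>"
    and rel: "\<And>p. a * rect_form (\<psi> + \<beta>) p = c * rect_form \<psi> p - b * rect_form (\<psi> - \<alpha>) p"
    and small: "b * rect_width g h (\<psi> - \<alpha>) + c * rect_width g h \<psi> + a * rect_width g h (\<psi> + \<beta>) \<le> 2"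
  shows "normal_body (skew_rect g h b c \<alpha> \<psi> ` ({0..g} \<times> {0..h})) (b * rect_width g h (\<psi> - \<alpha>))
    (c * rect_width g h \<psi>) (a * rect_width g h (\<psi> + \<beta>)) (b * c * sin \<alpha> * (g * h))"
proof
  let ?R = "{0..g} \<times> {0..h} :: point set" and ?f = "skew_rect g h b c \<alpha> \<psi>"
  define p q r s where "p = - b * sin (\<psi> - \<alpha>)" and "q = - b * cos (\<psi> - \<alpha>)" and "r = c * sin \<psi>" and "s = c * cos \<psi>"
  define e1 e2 where "e1 = b * (rect_low g h (\<psi> - \<alpha>) + rect_width g h (\<psi> - \<alpha>))" and "e2 = - c * rect_low g h \<psi>"
  have f_affine: "?f z = (p * fst z + q * snd z + e1, r * fst z + s * snd z + e2)" for z
    by (simp add: skew_rect_def rect_form_def p_def q_def r_def s_def e1_def e2_def algebra_simps)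
  have det: "p * s - q * r = b * c * sin \<alpha>"
  proof -
    have "p * s - q * r = b * c * sin (\<psi> - (\<psi> - \<alpha>))"
      unfolding p_def q_def r_def s_def sin_diff[of \<psi> "\<psi> - \<alpha>"] by (simp add: algebra_simps)
    then show ?thesis by simp
  qed
  have det0: "p * s - q * r > 0" unfolding det using pos by simp
  have rect: "compact ?R" "convex ?R"
    by (auto intro: compact_Times convex_Times)
  have cont: "continuous_on UNIV ?f" unfolding f_affine[abs_def] by (intro continuous_intros)
  show compact: "compact (?f ` ?R)"
    using rect(1) cont by (intro compact_continuous_image continuous_on_subset[OF cont]) auto
  have "?f ` ?R = (+) (e1, e2) ` ((\<lambda>z. (p * fst z + q * snd z, r * fst z + s * snd z)) ` ?R)"
    unfolding image_image f_affine by (simp add: algebra_simps)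
  moreover have "linear (\<lambda>z. (p * fst z + q * snd z, r * fst z + s * snd z))"
    by (intro linearI) (auto simp: algebra_simps)
  ultimately show "convex (?f ` ?R)"
    using rect(2) by (simp add: convex_translation convex_linear_image)
  show "0 < b * rect_width g h (\<psi> - \<alpha>)" "0 < c * rect_width g h \<psi>" "0 < a * rect_width g h (\<psi> + \<beta>)"
    using pos gh by (simp_all add: rect_width_pos)
  show "b * rect_width g h (\<psi> - \<alpha>) + c * rect_width g h \<psi> + a * rect_width g h (\<psi> + \<beta>) \<le> 2" by (fact small)
  have g0: "0 \<le> g" "0 \<le> h" using gh by auto
  note rng = rect_form_range[OF g0]
  have low: "a * rect_low g h (\<psi> + \<beta>) + b * (rect_low g h (\<psi> - \<alpha>) + rect_width g h (\<psi> - \<alpha>)) - c * rect_low g h \<psi> =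
    (b * rect_width g h (\<psi> - \<alpha>) + c * rect_width g h \<psi> - a * rect_width g h (\<psi> + \<beta>)) / 2"
    using rel[of "(g, h)"] unfolding rect_low_def by (simp add: field_simps)
  have sum: "fst (?f z) + snd (?f z) = a * (rect_form (\<psi> + \<beta>) z - rect_low g h (\<psi> + \<beta>)) +
     (b * rect_width g h (\<psi> - \<alpha>) + c * rect_width g h \<psi> - a * rect_width g h (\<psi> + \<beta>)) / 2" for z
    unfolding low[symmetric] using rel[of z] by (simp add: skew_rect_def algebra_simps)
  show "0 \<le> fst z \<and> fst z \<le> b * rect_width g h (\<psi> - \<alpha>) \<and> 0 \<le> snd z \<and> snd z \<le> c * rect_width g h \<psi> \<and>
      (b * rect_width g h (\<psi> - \<alpha>) + c * rect_width g h \<psi> - a * rect_width g h (\<psi> + \<beta>)) / 2 \<le> fst z + snd z \<and>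
      fst z + snd z \<le> (b * rect_width g h (\<psi> - \<alpha>) + c * rect_width g h \<psi> + a * rect_width g h (\<psi> + \<beta>)) / 2"
    if z: "z \<in> ?f ` ?R" for z
  proof -
    obtain x where x: "x \<in> ?R" "z = ?f x" using z by blast
    have "0 \<le> a * (rect_form (\<psi> + \<beta>) x - rect_low g h (\<psi> + \<beta>))"
      using rng(1)[OF x(1), of "\<psi> + \<beta>"] pos by simp
    moreover have "a * (rect_form (\<psi> + \<beta>) x - rect_low g h (\<psi> + \<beta>)) \<le> a * rect_width g h (\<psi> + \<beta>)"
      using rng(1)[OF x(1), of "\<psi> + \<beta>"] pos by (intro mult_left_mono) auto
    moreover have "0 \<le> fst z \<and> fst z \<le> b * rect_width g h (\<psi> - \<alpha>)"
      using rng(1)[OF x(1), of "\<psi> - \<alpha>"] pos unfolding x(2) skew_rect_def fst_conv by simp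
    moreover have "0 \<le> snd z \<and> snd z \<le> c * rect_width g h \<psi>"
      using rng(1)[OF x(1), of \<psi>] pos unfolding x(2) skew_rect_def snd_conv by simp
    ultimately show ?thesis unfolding x(2) using sum[of x] by argo
  qed
  show "\<exists>z\<in>?f ` ?R. fst z = 0" using rng(3)[of "\<psi> - \<alpha>"] by (auto simp: skew_rect_def intro!: bexI)
  show "\<exists>z\<in>?f ` ?R. fst z = b * rect_width g h (\<psi> - \<alpha>)" using rng(2)[of "\<psi> - \<alpha>"] by (force simp: skew_rect_def)
  show "\<exists>z\<in>?f ` ?R. snd z = 0" using rng(2)[of "\<psi>"] by (force simp: skew_rect_def)
  show "\<exists>z\<in>?f ` ?R. snd z = c * rect_width g h \<psi>" using rng(3)[of \<psi>] by (force simp: skew_rect_def)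
  show "\<exists>z\<in>?f ` ?R. fst z + snd z = (b * rect_width g h (\<psi> - \<alpha>) + c * rect_width g h \<psi> - a * rect_width g h (\<psi> + \<beta>)) / 2"
  proof -
    obtain x where x: "x \<in> ?R" "rect_form (\<psi> + \<beta>) x = rect_low g h (\<psi> + \<beta>)" using rng(2)[of "\<psi> + \<beta>"] by blast
    show ?thesis by (rule bexI[of _ "?f x"]) (use x sum[of x] in simp_all)
  qed
  show "\<exists>z\<in>?f ` ?R. fst z + snd z = (b * rect_width g h (\<psi> - \<alpha>) + c * rect_width g h \<psi> + a * rect_width g h (\<psi> + \<beta>)) / 2"
  proof -
    obtain x where x: "x \<in> ?R" "rect_form (\<psi> + \<beta>) x = rect_low g h (\<psi> + \<beta>) + rect_width g h (\<psi> + \<beta>)"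
      using rng(3)[of "\<psi> + \<beta>"] by blast
    show ?thesis by (rule bexI[of _ "?f x"]) (use x sum[of x] in \<open>simp_all add: field_simps\<close>)
  qed
  show "0 \<le> b * c * sin \<alpha> * (g * h)" using pos gh by simp
  have inj: "?f x = ?f y \<Longrightarrow> x = y" for x y
  proof -
    assume "?f x = ?f y"
    then have e: "p * (fst x - fst y) + q * (snd x - snd y) = 0" "r * (fst x - fst y) + s * (snd x - snd y) = 0"
      unfolding f_affine by (simp_all add: algebra_simps)
    have lin: "(p * s - q * r) * X = s * (p * X + q * Y) - q * (r * X + s * Y)"
      "(p * s - q * r) * Y = p * (r * X + s * Y) - r * (p * X + q * Y)" for X Y
      by (simp_all add: algebra_simps)
    have "(p * s - q * r) * (fst x - fst y) = 0" "(p * s - q * r) * (snd x - snd y) = 0"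
      unfolding lin(1)[of "fst x - fst y" "snd x - snd y"] lin(2)[of "snd x - snd y" "fst x - fst y"] e by simp_all
    then show "x = y" using det0 by (simp add: prod_eq_iff)
  qed
  have "(\<integral>\<^sup>+z. indicator (?f ` ?R) z \<partial>lborel) =
     ennreal \<bar>p * s - q * r\<bar> * (\<integral>\<^sup>+z. indicator (?f ` ?R) (?f z) \<partial>lborel)"
    unfolding f_affine using det0
    by (intro nn_integral_plane_affine borel_measurable_indicator borel_closed compact_imp_closed
        compact[unfolded f_affine]) simp
  also have "(\<integral>\<^sup>+z. indicator (?f ` ?R) (?f z) \<partial>lborel) = (\<integral>\<^sup>+z. indicator ?R z \<partial>lborel)"
    by (rule nn_integral_cong) (auto simp: indicator_def dest: inj)
  also have "\<dots> = emeasure lborel ?R" using rect(1) by (simp add: borel_closed compact_imp_closed)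
  also have "\<dots> = ennreal (g * h)" using gh by (simp add: emeasure_plane_Times ennreal_mult)
  finally show "emeasure lborel (?f ` ?R) = ennreal (b * c * sin \<alpha> * (g * h))"
    using compact det0 pos gh by (simp add: det borel_closed compact_imp_closed ennreal_mult)
qed

text \<open>In skew coordinates the parallelogram becomes the unit square up to its boundary, and for a periodic
set the square may be translated by $d$.\<close>

lemma emeasure_parallelogram_periodic:
  assumes pos: "0 < b" "0 < c" "0 < sin \<alpha>" and E: "E \<in> sets borel"
    and per: "\<And>x y. (x + 1, y) \<in> E \<longleftrightarrow> (x, y) \<in> E" "\<And>x y. (x, y + 1) \<in> E \<longleftrightarrow> (x, y) \<in> E"
  shows "emeasure lborel (lattice_parallelogram b c \<alpha> \<inter> {P. skew_coords b c \<alpha> P + d \<in> E}) =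
    ennreal (b * c * sin \<alpha>) * emeasure lborel (({0..<1} \<times> {0..<1}) \<inter> E)"
proof -
  let ?I = "indicator :: point set \<Rightarrow> point \<Rightarrow> ennreal"
  let ?A = "lattice_parallelogram b c \<alpha> \<inter> {P. skew_coords b c \<alpha> P + d \<in> E}"
  obtain d1 d2 where d: "d = (d1, d2)" by (cases d)
  have par: "P \<in> lattice_parallelogram b c \<alpha> \<longleftrightarrow> skew_coords b c \<alpha> P \<in> {0..1} \<times> {0..1}" for P
  proof -
    obtain x y where P: "P = (x, y)" by (cases P)
    have cs: "0 < c * sin \<alpha>" "0 < b * sin \<alpha>" using pos by simp_all
    have "(0 \<le> (x * sin \<alpha> - y * cos \<alpha>) / (c * sin \<alpha>)) = (y * cot \<alpha> \<le> x)"
      "((x * sin \<alpha> - y * cos \<alpha>) / (c * sin \<alpha>) \<le> 1) = (x \<le> c + y * cot \<alpha>)"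
      "(0 \<le> y / (b * sin \<alpha>)) = (0 \<le> y)" "(y / (b * sin \<alpha>) \<le> 1) = (y \<le> b * sin \<alpha>)"
      using pos pos_le_divide_eq[OF cs(1), of 0] pos_le_divide_eq[OF cs(2), of 0] pos_divide_le_eq[OF cs(1)] pos_divide_le_eq[OF cs(2)]
      by (simp_all add: cot_def) (simp_all add: field_simps)
    then show ?thesis unfolding P lattice_parallelogram_def skew_coords_def by auto
  qed
  have A: "?A = skew_coords b c \<alpha> -` (({0..1} \<times> {0..1}) \<inter> (\<lambda>z. z + d) -` E)"
    using par by auto
  have cont: "continuous_on UNIV (skew_coords b c \<alpha>)"
    using linear_skew_coords by (intro linear_continuous_on) (simp add: linear_conv_bounded_linear)
  have shift_E: "(\<lambda>z. z + d) -` E \<in> sets borel"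
    using measurable_sets[OF borel_measurable_continuous_onI E, of "\<lambda>z. z + d"]
    by (simp add: continuous_intros)
  have sq: "{0..1} \<times> {0..1} \<in> sets (borel :: point measure)" by (rule borel_Times) auto
  have "({0..1} \<times> {0..1}) \<inter> (\<lambda>z. z + d) -` E \<in> sets borel" using sq shift_E by (rule sets.Int)
  from measurable_sets[OF borel_measurable_continuous_onI[OF cont] this]
  have meas_A: "?A \<in> sets borel" unfolding A by simp
  have "emeasure lborel ?A = (\<integral>\<^sup>+P. ?I ?A P \<partial>lborel)" using meas_A by simp
  also have "\<dots> = ennreal \<bar>c * (b * sin \<alpha>) - b * cos \<alpha> * 0\<bar> *
      (\<integral>\<^sup>+z. ?I ?A (c * fst z + b * cos \<alpha> * snd z + 0, 0 * fst z + b * sin \<alpha> * snd z + 0) \<partial>lborel)"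
    by (rule nn_integral_plane_affine) (use meas_A pos in simp_all)
  also have "ennreal \<bar>c * (b * sin \<alpha>) - b * cos \<alpha> * 0\<bar> = ennreal (b * c * sin \<alpha>)"
    using pos by (simp add: mult_ac)
  also have "(\<integral>\<^sup>+z. ?I ?A (c * fst z + b * cos \<alpha> * snd z + 0, 0 * fst z + b * sin \<alpha> * snd z + 0) \<partial>lborel) =
      (\<integral>\<^sup>+z. ?I E (1 * fst z + 0 * snd z + d1, 0 * fst z + 1 * snd z + d2) *
         ?I ({d1..<d1 + 1} \<times> {d2..<d2 + 1}) (1 * fst z + 0 * snd z + d1, 0 * fst z + 1 * snd z + d2) \<partial>lborel)"
  proof (rule nn_integral_cong_AE)
    show "AE z in lborel. ?I ?A (c * fst z + b * cos \<alpha> * snd z + 0, 0 * fst z + b * sin \<alpha> * snd z + 0) =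
       ?I E (1 * fst z + 0 * snd z + d1, 0 * fst z + 1 * snd z + d2) *
         ?I ({d1..<d1 + 1} \<times> {d2..<d2 + 1}) (1 * fst z + 0 * snd z + d1, 0 * fst z + 1 * snd z + d2)"
      using AE_plane_coords(1)[of 1] AE_plane_coords(2)[of 1]
    proof eventually_elim
      case (elim z)
      have "(c * fst z + b * cos \<alpha> * snd z + 0, 0 * fst z + b * sin \<alpha> * snd z + 0) = from_skew b c \<alpha> z"
        by (simp add: from_skew_def mult_ac)
      then have "(c * fst z + b * cos \<alpha> * snd z + 0, 0 * fst z + b * sin \<alpha> * snd z + 0) \<in> ?A \<longleftrightarrow>
         z \<in> {0..1} \<times> {0..1} \<and> z + d \<in> E"
        unfolding A using skew_coords_inverse(1)[OF pos] by simp
      also have "\<dots> \<longleftrightarrow> (fst z + d1, snd z + d2) \<in> E \<and> (fst z + d1, snd z + d2) \<in> {d1..<d1 + 1} \<times> {d2..<d2 + 1}"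
        using elim by (cases z) (auto simp: d)
      finally show ?case by (simp add: indicator_def)
    qed
  qed
  also have "\<dots> = (\<integral>\<^sup>+z. ?I E z * ?I ({d1..<d1 + 1} \<times> {d2..<d2 + 1}) z \<partial>lborel)"
  proof -
    have "{d1..<d1 + 1} \<times> {d2..<d2 + 1} \<in> sets (borel :: point measure)" by (rule borel_Times) auto
    then have "(\<lambda>z. ?I E z * ?I ({d1..<d1 + 1} \<times> {d2..<d2 + 1}) z) \<in> borel_measurable borel"
      using E by (intro borel_measurable_times_ennreal borel_measurable_indicator)
    from nn_integral_plane_affine[OF this, of 1 1 0 0 d1 d2] show ?thesis by simp
  qed
  also have "\<dots> = (\<integral>\<^sup>+z. ?I E z * ?I ({0..<1} \<times> {0..<1}) z \<partial>lborel)"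
    by (rule nn_integral_period_square) (use E per in \<open>simp_all add: indicator_def\<close>)
  also have "\<dots> = emeasure lborel (({0..<1} \<times> {0..<1}) \<inter> E)"
  proof -
    have "{0..<1} \<times> {0..<1} \<in> sets (borel :: point measure)" by (rule borel_Times) auto
    then have "({0..<1} \<times> {0..<1}) \<inter> E \<in> sets borel" using E by (rule sets.Int)
    moreover have "?I E z * ?I ({0..<1} \<times> {0..<1}) z = ?I (({0..<1} \<times> {0..<1}) \<inter> E) z" for z
      by (simp add: indicator_inter_arith mult.commute)
    ultimately show ?thesis by simp
  qed
  finally show ?thesis .
qed

lemma rot_rot: "rot x (rot y p) = rot (x + y) p"
  by (simp add: rot_def cos_add sin_add algebra_simps)

lemma rot_add: "rot x (p + q) = rot x p + rot x q"
  by (simp add: rot_def algebra_simps)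

lemma fst_rot: "fst (rot \<phi> p) = rect_form (\<phi> + pi / 2) p"
  by (simp add: rot_def rect_form_def sin_add cos_add)

lemma support_fun_rectangle:
  assumes "0 \<le> g" "0 \<le> h"
  shows "support_fun ((\<lambda>p. v + rot \<theta> p) ` ({0..g} \<times> {0..h})) \<phi> =
    rect_form (\<phi> + pi / 2) v + rect_low g h (\<phi> + \<theta> + pi / 2) + rect_width g h (\<phi> + \<theta> + pi / 2)"
proof -
  let ?\<eta> = "\<phi> + \<theta> + pi / 2"
  have f: "fst (rot \<phi> (v + rot \<theta> p)) = rect_form (\<phi> + pi / 2) v + rect_form ?\<eta> p" for p
    by (simp add: rot_add rot_rot fst_rot)
  have "(SUP p\<in>(\<lambda>p. v + rot \<theta> p) ` ({0..g} \<times> {0..h}). fst (rot \<phi> p)) =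
      (SUP p\<in>{0..g} \<times> {0..h}. rect_form (\<phi> + pi / 2) v + rect_form ?\<eta> p)"
    by (simp add: image_image f)
  also have "\<dots> = rect_form (\<phi> + pi / 2) v + rect_low g h ?\<eta> + rect_width g h ?\<eta>"
  proof (rule cSup_eq_maximum)
    obtain x where "x \<in> {0..g} \<times> {0..h}" "rect_form ?\<eta> x = rect_low g h ?\<eta> + rect_width g h ?\<eta>"
      using rect_form_range(3)[OF assms, of ?\<eta>] by blast
    then show "rect_form (\<phi> + pi / 2) v + rect_low g h ?\<eta> + rect_width g h ?\<eta> \<in>
       (\<lambda>p. rect_form (\<phi> + pi / 2) v + rect_form ?\<eta> p) ` ({0..g} \<times> {0..h})"
      by (intro image_eqI[of _ _ x]) auto
    show "t \<le> rect_form (\<phi> + pi / 2) v + rect_low g h ?\<eta> + rect_width g h ?\<eta>"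
      if "t \<in> (\<lambda>p. rect_form (\<phi> + pi / 2) v + rect_form ?\<eta> p) ` ({0..g} \<times> {0..h})" for t
      using that rect_form_range(1)[OF assms, of _ ?\<eta>] by (elim imageE) (simp add: add.assoc)
  qed
  finally show ?thesis by (simp add: support_fun_def)
qed

section \<open>The rectangle on the lattice of triangles\<close>

locale lattice_triangle =
  fixes a b c \<alpha> \<beta> \<gamma> Q :: real
  assumes sides: "0 < a" "0 < b" "0 < c"
    and angles: "0 < \<alpha>" "\<alpha> < pi" "0 < \<beta>" "\<beta> < pi" "0 < \<gamma>" "\<gamma> < pi" "\<alpha> + \<beta> + \<gamma> = pi"
    and cosines: "2 * b * c * cos \<alpha> = b\<^sup>2 + c\<^sup>2 - a\<^sup>2" "2 * c * a * cos \<beta> = c\<^sup>2 + a\<^sup>2 - b\<^sup>2"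
      "2 * a * b * cos \<gamma> = a\<^sup>2 + b\<^sup>2 - c\<^sup>2"
    and areas: "b * c * sin \<alpha> = Q" "c * a * sin \<beta> = Q" "a * b * sin \<gamma> = Q"
begin

lemma sin_pos: "0 < sin \<alpha>" "0 < sin \<beta>" "0 < sin \<gamma>"
  using angles by (auto intro: sin_gt_zero)

lemma Q_pos: "0 < Q"
  using sin_pos sides by (simp flip: areas(1))

lemma sin_sum: "sin (\<alpha> + \<beta>) = sin \<gamma>" "cos (\<alpha> + \<beta>) = - cos \<gamma>"
proof -
  have "\<alpha> + \<beta> = pi - \<gamma>" using angles by simp
  then show "sin (\<alpha> + \<beta>) = sin \<gamma>" "cos (\<alpha> + \<beta>) = - cos \<gamma>" by simp_all
qed

lemma law_of_sines: "b * sin (\<alpha> + \<beta>) = c * sin \<beta>" "a * sin \<beta> = b * sin \<alpha>"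
proof -
  have "a * (b * sin \<gamma>) = a * (c * sin \<beta>)" using areas by (simp add: mult_ac)
  then show "b * sin (\<alpha> + \<beta>) = c * sin \<beta>" using sides by (simp add: sin_sum)
  have "c * (a * sin \<beta>) = c * (b * sin \<alpha>)" using areas by (simp add: mult_ac)
  then show "a * sin \<beta> = b * sin \<alpha>" using sides by simp
qed

lemma projection: "a * cos \<beta> + b * cos \<alpha> = c"
proof -
  have "2 * c * (a * cos \<beta> + b * cos \<alpha>) = 2 * c * c"
    using cosines(1,2) by (simp add: algebra_simps power2_eq_square)
  then show ?thesis using sides by simp
qed

text \<open>The components of a vector along the three normals of the triangle are dependent, with the sides as
coefficients.\<close>

lemma rect_form_relation:
  "(a / Q) * rect_form (\<eta> + \<beta>) p = (c / Q) * rect_form \<eta> p - (b / Q) * rect_form (\<eta> - \<alpha>) p"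
proof -
  have s: "a * sin (\<eta> + \<beta>) + b * sin (\<eta> - \<alpha>) = c * sin \<eta>"
  proof -
    have "a * sin (\<eta> + \<beta>) + b * sin (\<eta> - \<alpha>) = sin \<eta> * (a * cos \<beta> + b * cos \<alpha>) + cos \<eta> * (a * sin \<beta> - b * sin \<alpha>)"
      by (simp add: sin_add sin_diff algebra_simps)
    then show ?thesis by (simp add: projection law_of_sines(2))
  qed
  have c: "a * cos (\<eta> + \<beta>) + b * cos (\<eta> - \<alpha>) = c * cos \<eta>"
  proof -
    have "a * cos (\<eta> + \<beta>) + b * cos (\<eta> - \<alpha>) = cos \<eta> * (a * cos \<beta> + b * cos \<alpha>) - sin \<eta> * (a * sin \<beta> - b * sin \<alpha>)"
      by (simp add: cos_add cos_diff algebra_simps)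
    then show ?thesis by (simp add: projection law_of_sines(2))
  qed
  have "a * rect_form (\<eta> + \<beta>) p + b * rect_form (\<eta> - \<alpha>) p =
      fst p * (a * sin (\<eta> + \<beta>) + b * sin (\<eta> - \<alpha>)) + snd p * (a * cos (\<eta> + \<beta>) + b * cos (\<eta> - \<alpha>))"
    by (simp add: rect_form_def algebra_simps)
  also have "\<dots> = c * rect_form \<eta> p" unfolding s c by (simp add: rect_form_def algebra_simps)
  finally have "a * rect_form (\<eta> + \<beta>) p = c * rect_form \<eta> p - b * rect_form (\<eta> - \<alpha>) p" by simp
  from arg_cong[OF this, of "\<lambda>x. x / Q"] show ?thesis by (simp add: diff_divide_distrib)
qed

text \<open>The normals of the three sides, weighted by the lengths of the sides, sum to 0. Therefore neither the
position of the reference point nor that of the centre contributes, and half of the weighted sum of the widths is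
left.\<close>

lemma c_star_rectangle:
  assumes gh: "0 \<le> g" "0 \<le> h" and C: "C = (\<lambda>p. v + rot \<theta> p) ` ({0..g} \<times> {0..h})"
    and \<psi>: "\<psi> = \<phi> + \<alpha> + pi / 2 + \<theta>"
  shows "c_star C \<alpha> \<beta> \<phi> = c * ((b / Q) * rect_width g h (\<psi> - \<alpha>) + (c / Q) * rect_width g h \<psi> + (a / Q) * rect_width g h (\<psi> + \<beta>)) / 2"
proof -
  \<comment> \<open>The weights in the definition of $c^*$ are the sides, up to the common factor $c / Q$.\<close>
  have inv: "1 / sin \<alpha> = c * (b / Q)" "1 / sin \<beta> = c * (a / Q)" "cot \<alpha> + cot \<beta> = c * (c / Q)"
  proof -
    show 1: "1 / sin \<alpha> = c * (b / Q)" "1 / sin \<beta> = c * (a / Q)"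
      using sin_pos Q_pos areas by (auto simp: field_simps)
    have "cot \<alpha> + cot \<beta> = sin (\<alpha> + \<beta>) * (1 / sin \<alpha>) * (1 / sin \<beta>)"
      using sin_pos by (simp add: cot_def sin_add field_simps)
    also have "\<dots> = c * (c / Q)"
      unfolding 1 sin_sum using areas(3) Q_pos by (simp add: field_simps power2_eq_square)
    finally show "cot \<alpha> + cot \<beta> = c * (c / Q)" .
  qed
  let ?o = "\<phi> + \<alpha> + pi / 2"
  have eqs: "\<phi> + pi / 2 = ?o - \<alpha>" "\<phi> + \<theta> + pi / 2 = \<psi> - \<alpha>" "\<phi> + \<alpha> + \<beta> + pi / 2 = ?o + \<beta>"
    "\<phi> + \<alpha> + \<beta> + \<theta> + pi / 2 = \<psi> + \<beta>" "\<phi> + \<alpha> + pi + pi / 2 = ?o + pi" "\<phi> + \<alpha> + pi + \<theta> + pi / 2 = \<psi> + pi"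
    unfolding \<psi> by simp_all
  have anti: "rect_form (x + pi) p = - rect_form x p" "rect_width g h (x + pi) = rect_width g h x" for x p
    by (simp_all add: rect_form_def rect_width_def)
  have "c_star C \<alpha> \<beta> \<phi> = c * ((b / Q) * support_fun C \<phi> + (a / Q) * support_fun C (\<phi> + \<alpha> + \<beta>) + (c / Q) * support_fun C (\<phi> + \<alpha> + pi))"
    unfolding c_star_def inv by (simp add: algebra_simps)
  also have "(b / Q) * support_fun C \<phi> + (a / Q) * support_fun C (\<phi> + \<alpha> + \<beta>) + (c / Q) * support_fun C (\<phi> + \<alpha> + pi) =
     (b / Q) * (rect_form (?o - \<alpha>) v + (rect_form (\<psi> - \<alpha>) (g, h) + rect_width g h (\<psi> - \<alpha>)) / 2) +
     (a / Q) * (rect_form (?o + \<beta>) v + (rect_form (\<psi> + \<beta>) (g, h) + rect_width g h (\<psi> + \<beta>)) / 2) +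
     (c / Q) * (- rect_form ?o v + (- rect_form \<psi> (g, h) + rect_width g h \<psi>) / 2)"
    unfolding C support_fun_rectangle[OF gh] eqs rect_low_def anti by (simp add: field_simps)
  also have "\<dots> = ((b / Q) * rect_form (?o - \<alpha>) v + (a / Q) * rect_form (?o + \<beta>) v - (c / Q) * rect_form ?o v) +
     ((b / Q) * rect_form (\<psi> - \<alpha>) (g, h) + (a / Q) * rect_form (\<psi> + \<beta>) (g, h) - (c / Q) * rect_form \<psi> (g, h)) / 2 +
     ((b / Q) * rect_width g h (\<psi> - \<alpha>) + (c / Q) * rect_width g h \<psi> + (a / Q) * rect_width g h (\<psi> + \<beta>)) / 2"
    by argo
  also have "\<dots> = ((b / Q) * rect_width g h (\<psi> - \<alpha>) + (c / Q) * rect_width g h \<psi> + (a / Q) * rect_width g h (\<psi> + \<beta>)) / 2"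
    unfolding rect_form_relation by simp
  finally show ?thesis by simp
qed

lemma skew_coords_rot: "skew_coords b c \<alpha> (rot \<psi> p) = (- (b / Q) * rect_form (\<psi> - \<alpha>) p, (c / Q) * rect_form \<psi> p)"
proof -
  have "fst (rot \<psi> p) * sin \<alpha> - snd (rot \<psi> p) * cos \<alpha> = - rect_form (\<psi> - \<alpha>) p"
    by (simp add: rot_def rect_form_def sin_diff cos_diff algebra_simps)
  moreover have "snd (rot \<psi> p) = rect_form \<psi> p" by (simp add: rot_def rect_form_def)
  moreover have "1 / (c * sin \<alpha>) = b / Q" "1 / (b * sin \<alpha>) = c / Q"
    using sides sin_pos by (simp_all flip: areas(1))
  ultimately show ?thesis
    unfolding skew_coords_def by (metis (no_types, opaque_lifting) mult.commute mult_minus_left mult_minus_right times_divide_eq_right mult.right_neutral)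
qed

lemma skew_coords_placed:
  assumes C: "C = (\<lambda>p. v + rot \<theta> p) ` ({0..g} \<times> {0..h})" and \<psi>: "\<psi> = \<phi> + \<alpha> + pi / 2 + \<theta>"
  shows "\<exists>d. \<forall>P. skew_coords b c \<alpha> ` placed \<alpha> C P \<phi> =
    (+) (skew_coords b c \<alpha> P + d) ` skew_rect g h (b / Q) (c / Q) \<alpha> \<psi> ` ({0..g} \<times> {0..h})"
proof (intro exI allI)
  fix P
  let ?s = "skew_coords b c \<alpha>"
  let ?e = "(- (b / Q) * (rect_low g h (\<psi> - \<alpha>) + rect_width g h (\<psi> - \<alpha>)), (c / Q) * rect_low g h \<psi>)"
  have "?s (P + rot (\<phi> + \<alpha> + pi / 2) (v + rot \<theta> p)) =
     ?s P + (?s (rot (\<phi> + \<alpha> + pi / 2) v) + ?e) + skew_rect g h (b / Q) (c / Q) \<alpha> \<psi> p" for p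
  proof -
    have "?s (P + rot (\<phi> + \<alpha> + pi / 2) (v + rot \<theta> p)) = ?s P + (?s (rot (\<phi> + \<alpha> + pi / 2) v) + ?s (rot \<psi> p))"
      by (simp add: linear_add[OF linear_skew_coords] rot_add rot_rot \<psi>)
    also have "?s (rot \<psi> p) = ?e + skew_rect g h (b / Q) (c / Q) \<alpha> \<psi> p"
      unfolding skew_coords_rot skew_rect_def by (simp add: algebra_simps)
    finally show ?thesis by (simp only: add.assoc)
  qed
  then show "?s ` placed \<alpha> C P \<phi> = (+) (?s P + (?s (rot (\<phi> + \<alpha> + pi / 2) v) + ?e)) ` skew_rect g h (b / Q) (c / Q) \<alpha> \<psi> ` ({0..g} \<times> {0..h})"
    unfolding placed_def C image_image by simp
qed

text \<open>For a fixed direction the count depends on the position of the body in skew coordinates only, and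
periodically so; the lemmas on the unit square apply after the translation that normalises the body.\<close>

lemma emeasure_hit_count:
  assumes gh: "0 < g" "0 < h" and C: "C = (\<lambda>p. v + rot \<theta> p) ` ({0..g} \<times> {0..h})"
    and \<psi>: "\<psi> = \<phi> + \<alpha> + pi / 2 + \<theta>" and fits: "c_star C \<alpha> \<beta> \<phi> \<le> c" and k: "1 \<le> k" "k \<le> 6"
  defines "q \<equiv> count_prob ((b / Q) * rect_width g h (\<psi> - \<alpha>)) ((c / Q) * rect_width g h \<psi>) ((a / Q) * rect_width g h (\<psi> + \<beta>)) (g * h / Q) k"
  shows "emeasure lborel (lattice_parallelogram b c \<alpha> \<inter> {P. hit_count b c \<alpha> \<beta> C P \<phi> = k}) = ennreal (Q * q) \<and> 0 \<le> q"
proof -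
  let ?K = "skew_rect g h (b / Q) (c / Q) \<alpha> \<psi> ` ({0..g} \<times> {0..h})"
  have g0: "0 \<le> g" "0 \<le> h" using gh by auto
  have det: "(b / Q) * (c / Q) * sin \<alpha> * (g * h) = g * h / Q"
    using Q_pos areas(1) by (simp add: field_simps power2_eq_square)
  have "c * (((b / Q) * rect_width g h (\<psi> - \<alpha>) + (c / Q) * rect_width g h \<psi> + (a / Q) * rect_width g h (\<psi> + \<beta>)) / 2) \<le> c * 1"
    using fits c_star_rectangle[OF g0 C \<psi>] by simp
  then have small: "(b / Q) * rect_width g h (\<psi> - \<alpha>) + (c / Q) * rect_width g h \<psi> + (a / Q) * rect_width g h (\<psi> + \<beta>) \<le> 2"
    using sides by (subst (asm) mult_le_cancel_left_pos) auto
  interpret normal_body ?K "(b / Q) * rect_width g h (\<psi> - \<alpha>)" "(c / Q) * rect_width g h \<psi>" "(a / Q) * rect_width g h (\<psi> + \<beta>)" "g * h / Q"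
    unfolding det[symmetric] using sides Q_pos sin_pos
    by (intro normal_body_rectangle gh rect_form_relation small) simp_all
  define E where "E = {z. cell_count ((+) z ` ?K) = k}"
  obtain d where d: "\<And>P. skew_coords b c \<alpha> ` placed \<alpha> C P \<phi> = (+) (skew_coords b c \<alpha> P + d) ` ?K"
    using skew_coords_placed[OF C \<psi>] by blast
  have "hit_count b c \<alpha> \<beta> C P \<phi> = k \<longleftrightarrow> skew_coords b c \<alpha> P + d \<in> E" for P
    using hit_count_skew[of b c \<alpha> \<beta> C P \<phi>] sides sin_pos law_of_sines by (simp add: d E_def)
  then have "emeasure lborel (lattice_parallelogram b c \<alpha> \<inter> {P. hit_count b c \<alpha> \<beta> C P \<phi> = k}) =
     emeasure lborel (lattice_parallelogram b c \<alpha> \<inter> {P. skew_coords b c \<alpha> P + d \<in> E})" by simp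
  also have "\<dots> = ennreal (b * c * sin \<alpha>) * emeasure lborel (({0..<1} \<times> {0..<1}) \<inter> E)"
  proof (rule emeasure_parallelogram_periodic)
    show "E \<in> sets borel" unfolding E_def by (rule measurable_count)
    have tr: "cell_count ((+) (of_int m + x, of_int n + y) ` ?K) = cell_count ((+) (x, y) ` ?K)" for x y m n
      using cell_count_translate[of m n "(+) (x, y) ` ?K"] by (simp add: image_image add.assoc[symmetric])
    show "(x + 1, y) \<in> E \<longleftrightarrow> (x, y) \<in> E" "(x, y + 1) \<in> E \<longleftrightarrow> (x, y) \<in> E" for x y
      using tr[of 1 x 0 y] tr[of 0 x 1 y] by (simp_all add: E_def add.commute)
  qed (use sides sin_pos in simp_all)
  also have "emeasure lborel (({0..<1} \<times> {0..<1}) \<inter> E) = ennreal q"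
    using emeasure_count[OF k] by (simp add: unit_square_def E_def q_def)
  finally show ?thesis
    using emeasure_count[OF k] Q_pos by (simp add: areas ennreal_mult q_def)
qed

text \<open>The angles between the directions of the widths are $\alpha$, $\beta$ and $\alpha + \beta = \pi - \gamma$.
As $\alpha \<ge> \pi / 2$, the first and the third are not acute while $\beta$ is, which decides between the two forms of
\<open>sin_cos_integral\<close>.\<close>

lemma has_integral_width_products:
  fixes t :: real
  assumes gh: "0 < g" "0 < h" and obtuse: "pi / 2 \<le> \<alpha>"
  defines "A \<equiv> \<lambda>x. (b / Q) * rect_width g h (x + t - \<alpha>)" and "B \<equiv> \<lambda>x. (c / Q) * rect_width g h (x + t)"
    and "W \<equiv> \<lambda>x. (a / Q) * rect_width g h (x + t + \<beta>)"
  shows "((\<lambda>x. A x + B x + W x) has_integral 4 * (a + b + c) * (g + h) / Q) {0..2 * pi}"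
    and "((\<lambda>x. (A x)\<^sup>2 + (B x)\<^sup>2 + (W x)\<^sup>2) has_integral (a\<^sup>2 + b\<^sup>2 + c\<^sup>2) * (pi * (g\<^sup>2 + h\<^sup>2) + 4 * (g * h)) / Q\<^sup>2) {0..2 * pi}"
    and "((\<lambda>x. A x * B x + A x * W x + B x * W x) has_integral
      ((g\<^sup>2 + h\<^sup>2) * (6 * Q - pi * (a\<^sup>2 + b\<^sup>2 + c\<^sup>2) / 2 + 2 * (\<alpha> * a\<^sup>2 + \<beta> * b\<^sup>2 + \<gamma> * c\<^sup>2))
       + 2 * (g * h) * (3 * a\<^sup>2 - b\<^sup>2 - c\<^sup>2 + 4 * Q * (pi - \<alpha>))) / Q\<^sup>2) {0..2 * pi}" (is "(?f has_integral ?I) _")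
proof -
  let ?rw = "rect_width g h"
  let ?J = "\<lambda>\<delta>. (g\<^sup>2 + h\<^sup>2) * (2 * sin \<delta> + (pi - 2 * \<delta>) * cos \<delta>) + 2 * g * h * sin_cos_integral \<delta>"
  note Q = Q_pos
  have single: "((\<lambda>x. ?rw (x + k)) has_integral 4 * (g + h)) {0..2 * pi}" for k
    by (rule has_integral_rect_width)
  have sum: "((\<lambda>x. (b / Q) * ?rw (x + (t - \<alpha>)) + (c / Q) * ?rw (x + t) + (a / Q) * ?rw (x + (t + \<beta>))) has_integral
      (b / Q) * (4 * (g + h)) + (c / Q) * (4 * (g + h)) + (a / Q) * (4 * (g + h))) {0..2 * pi}"
    by (intro has_integral_add has_integral_mult_right single)
  show "((\<lambda>x. A x + B x + W x) has_integral 4 * (a + b + c) * (g + h) / Q) {0..2 * pi}"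
  proof -
    have f: "(\<lambda>x. A x + B x + W x) = (\<lambda>x. (b / Q) * ?rw (x + (t - \<alpha>)) + (c / Q) * ?rw (x + t) + (a / Q) * ?rw (x + (t + \<beta>)))"
      by (simp add: A_def B_def W_def fun_eq_iff add.assoc add_diff_eq)
    have v: "4 * (a + b + c) * (g + h) / Q = (b / Q) * (4 * (g + h)) + (c / Q) * (4 * (g + h)) + (a / Q) * (4 * (g + h))"
      by (simp add: add_divide_distrib distrib_left distrib_right mult.assoc) (simp only: ac_simps)
    show ?thesis unfolding f v by (rule sum)
  qed
  have J0: "?J 0 = pi * (g\<^sup>2 + h\<^sup>2) + 4 * (g * h)" by (simp add: sin_cos_integral_def)
  have sq: "((\<lambda>x. (?rw (x + k))\<^sup>2) has_integral pi * (g\<^sup>2 + h\<^sup>2) + 4 * (g * h)) {0..2 * pi}" for k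
    using has_integral_rect_width_mult[of 0 g h k] unfolding J0 by (simp add: power2_eq_square)
  have sum: "((\<lambda>x. (b / Q)\<^sup>2 * (?rw (x + (t - \<alpha>)))\<^sup>2 + (c / Q)\<^sup>2 * (?rw (x + t))\<^sup>2 + (a / Q)\<^sup>2 * (?rw (x + (t + \<beta>)))\<^sup>2) has_integral
      (b / Q)\<^sup>2 * (pi * (g\<^sup>2 + h\<^sup>2) + 4 * (g * h)) + (c / Q)\<^sup>2 * (pi * (g\<^sup>2 + h\<^sup>2) + 4 * (g * h)) + (a / Q)\<^sup>2 * (pi * (g\<^sup>2 + h\<^sup>2) + 4 * (g * h))) {0..2 * pi}"
    by (intro has_integral_add has_integral_mult_right sq)
  show "((\<lambda>x. (A x)\<^sup>2 + (B x)\<^sup>2 + (W x)\<^sup>2) has_integral (a\<^sup>2 + b\<^sup>2 + c\<^sup>2) * (pi * (g\<^sup>2 + h\<^sup>2) + 4 * (g * h)) / Q\<^sup>2) {0..2 * pi}"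
  proof -
    have f: "(\<lambda>x. (A x)\<^sup>2 + (B x)\<^sup>2 + (W x)\<^sup>2) =
      (\<lambda>x. (b / Q)\<^sup>2 * (?rw (x + (t - \<alpha>)))\<^sup>2 + (c / Q)\<^sup>2 * (?rw (x + t))\<^sup>2 + (a / Q)\<^sup>2 * (?rw (x + (t + \<beta>)))\<^sup>2)"
      by (simp only: A_def B_def W_def power_mult_distrib add.assoc add_diff_eq)
    have v: "(a\<^sup>2 + b\<^sup>2 + c\<^sup>2) * X / Q\<^sup>2 = (b / Q)\<^sup>2 * X + (c / Q)\<^sup>2 * X + (a / Q)\<^sup>2 * X" for X
      by (simp add: power_divide add_divide_distrib distrib_right)
    show ?thesis unfolding f v by (rule sum)
  qed
  have prod: "((\<lambda>x. ?rw (x + k) * ?rw (x + k + \<delta>)) has_integral ?J \<delta>) {0..2 * pi}" if "0 \<le> \<delta>" "\<delta> \<le> pi" for k \<delta>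
    by (rule has_integral_rect_width_mult[OF that])
  have ab: "0 \<le> \<alpha>" "\<alpha> \<le> pi" "0 \<le> \<beta>" "\<beta> \<le> pi" "0 \<le> \<alpha> + \<beta>" "\<alpha> + \<beta> \<le> pi" using angles by auto
  have sum: "((\<lambda>x. (b / Q * (c / Q)) * (?rw (x + (t - \<alpha>)) * ?rw (x + (t - \<alpha>) + \<alpha>)) +
       (b / Q * (a / Q)) * (?rw (x + (t - \<alpha>)) * ?rw (x + (t - \<alpha>) + (\<alpha> + \<beta>))) +
       (c / Q * (a / Q)) * (?rw (x + t) * ?rw (x + t + \<beta>))) has_integral
      (b / Q * (c / Q)) * ?J \<alpha> + (b / Q * (a / Q)) * ?J (\<alpha> + \<beta>) + (c / Q * (a / Q)) * ?J \<beta>) {0..2 * pi}"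
    by (intro has_integral_add has_integral_mult_right prod ab)
  have J\<alpha>: "b * c * ?J \<alpha> = (g\<^sup>2 + h\<^sup>2) * (2 * Q + (pi - 2 * \<alpha>) * (b\<^sup>2 + c\<^sup>2 - a\<^sup>2) / 2)
     + 2 * (g * h) * (- (b\<^sup>2 + c\<^sup>2 - a\<^sup>2) + (2 * pi - 2 * \<alpha>) * Q)"
  proof -
    have m: "sin_cos_integral \<alpha> = - 2 * cos \<alpha> + (2 * pi - 2 * \<alpha>) * sin \<alpha>"
    proof (cases "\<alpha> = pi / 2")
      case True
      show ?thesis unfolding True sin_cos_integral_def by simp
    qed (use obtuse in \<open>simp add: sin_cos_integral_def\<close>)
    have "b * c * ?J \<alpha> = (g\<^sup>2 + h\<^sup>2) * (2 * (b * c * sin \<alpha>) + (pi - 2 * \<alpha>) * (2 * b * c * cos \<alpha>) / 2)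
     + 2 * (g * h) * (- (2 * b * c * cos \<alpha>) + (2 * pi - 2 * \<alpha>) * (b * c * sin \<alpha>))"
      unfolding m by (simp add: field_simps)
    then show ?thesis unfolding areas cosines .
  qed
  have J\<beta>: "c * a * ?J \<beta> = (g\<^sup>2 + h\<^sup>2) * (2 * Q + (pi - 2 * \<beta>) * (c\<^sup>2 + a\<^sup>2 - b\<^sup>2) / 2)
     + 2 * (g * h) * (c\<^sup>2 + a\<^sup>2 - b\<^sup>2 + 2 * \<beta> * Q)"
  proof -
    have m: "sin_cos_integral \<beta> = 2 * cos \<beta> + 2 * \<beta> * sin \<beta>"
      using obtuse angles by (simp add: sin_cos_integral_def)
    have "c * a * ?J \<beta> = (g\<^sup>2 + h\<^sup>2) * (2 * (c * a * sin \<beta>) + (pi - 2 * \<beta>) * (2 * c * a * cos \<beta>) / 2)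
     + 2 * (g * h) * (2 * c * a * cos \<beta> + 2 * \<beta> * (c * a * sin \<beta>))"
      unfolding m by (simp add: field_simps)
    then show ?thesis unfolding areas cosines .
  qed
  have J\<gamma>: "a * b * ?J (\<alpha> + \<beta>) = (g\<^sup>2 + h\<^sup>2) * (2 * Q + (pi - 2 * \<gamma>) * (a\<^sup>2 + b\<^sup>2 - c\<^sup>2) / 2)
     + 2 * (g * h) * (a\<^sup>2 + b\<^sup>2 - c\<^sup>2 + 2 * \<gamma> * Q)"
  proof -
    have g: "\<alpha> + \<beta> = pi - \<gamma>" using angles by simp
    have m: "sin_cos_integral (\<alpha> + \<beta>) = 2 * cos \<gamma> + 2 * \<gamma> * sin \<gamma>"
    proof -
      have "\<not> \<alpha> + \<beta> \<le> pi / 2" using obtuse angles by linarith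
      then show ?thesis unfolding sin_cos_integral_def sin_sum by (simp add: g)
    qed
    have "a * b * ?J (\<alpha> + \<beta>) = (g\<^sup>2 + h\<^sup>2) * (2 * (a * b * sin \<gamma>) + (pi - 2 * \<gamma>) * (2 * a * b * cos \<gamma>) / 2)
     + 2 * (g * h) * (2 * a * b * cos \<gamma> + 2 * \<gamma> * (a * b * sin \<gamma>))"
      unfolding m sin_sum by (simp add: g field_simps)
    then show ?thesis unfolding areas cosines .
  qed
  have total: "(b / Q * (c / Q)) * ?J \<alpha> + (b / Q * (a / Q)) * ?J (\<alpha> + \<beta>) + (c / Q * (a / Q)) * ?J \<beta> =
      ?I"
  proof -
    have "(b / Q * (c / Q)) * ?J \<alpha> + (b / Q * (a / Q)) * ?J (\<alpha> + \<beta>) + (c / Q * (a / Q)) * ?J \<beta> =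
      (b * c * ?J \<alpha> + a * b * ?J (\<alpha> + \<beta>) + c * a * ?J \<beta>) / Q\<^sup>2"
      by (simp add: power2_eq_square add_divide_distrib mult.commute)
    also have "b * c * ?J \<alpha> + a * b * ?J (\<alpha> + \<beta>) + c * a * ?J \<beta> =
      (g\<^sup>2 + h\<^sup>2) * (6 * Q - pi * (a\<^sup>2 + b\<^sup>2 + c\<^sup>2) / 2 + 2 * (\<alpha> * a\<^sup>2 + \<beta> * b\<^sup>2 + \<gamma> * c\<^sup>2))
       + 2 * (g * h) * (3 * a\<^sup>2 - b\<^sup>2 - c\<^sup>2 + 4 * Q * (pi - \<alpha>))"
    proof -
      have pi_eq: "pi = \<alpha> + \<beta> + \<gamma>" using angles by simp
      show ?thesis unfolding J\<alpha> J\<beta> J\<gamma> unfolding pi_eq by (simp add: field_simps)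
    qed
    finally show ?thesis .
  qed
  have "\<And>x. ?rw (x + (t - \<alpha>) + \<alpha>) = ?rw (x + t)" "\<And>x. ?rw (x + (t - \<alpha>) + (\<alpha> + \<beta>)) = ?rw (x + t + \<beta>)"
     "\<And>x. ?rw (x + (t - \<alpha>)) = ?rw (x + t - \<alpha>)"
    by (simp_all add: algebra_simps)
  then show "(?f has_integral ?I) {0..2 * pi}"
    by (intro has_integral_eq_rhs[OF has_integral_eq[OF _ sum] total[symmetric]]) (simp add: A_def B_def W_def mult_ac)
qed

lemma measurable_hit_count:
  assumes C: "compact C"
  shows "{x. hit_count b c \<alpha> \<beta> C (fst x) (snd x) = k} \<in> sets borel"
proof -
  let ?h = "\<lambda>q :: point \<times> point \<times> real. skew_coords b c \<alpha> (fst (snd q) + rot (snd (snd q) + \<alpha> + pi / 2) (fst q))"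
  have lin: "continuous_on UNIV (skew_coords b c \<alpha>)"
    using linear_skew_coords by (intro linear_continuous_on) (simp add: linear_conv_bounded_linear)
  have "continuous_on UNIV ?h"
    unfolding rot_def by (rule continuous_on_compose2[OF lin]) (auto intro!: continuous_intros)
  from measurable_cell_count[OF C this]
  have "(\<lambda>x. hit_count b c \<alpha> \<beta> C (fst x) (snd x)) \<in> borel \<rightarrow>\<^sub>M count_space UNIV"
    using hit_count_skew[of b c \<alpha> \<beta> C] sides sin_pos law_of_sines
    by (simp add: placed_def image_image)
  from measurable_sets[OF this, of "{k}"] show ?thesis by (simp add: vimage_def)
qed

lemma parallelogram_borel: "lattice_parallelogram b c \<alpha> \<in> sets borel"
  and emeasure_parallelogram: "emeasure lborel (lattice_parallelogram b c \<alpha>) = ennreal Q"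
proof -
  have "closed (lattice_parallelogram b c \<alpha>)"
    unfolding lattice_parallelogram_def case_prod_beta
    by (intro closed_Collect_conj closed_Collect_le continuous_intros)
  then show "lattice_parallelogram b c \<alpha> \<in> sets borel" by (rule borel_closed)
  show "emeasure lborel (lattice_parallelogram b c \<alpha>) = ennreal Q"
    using emeasure_parallelogram_periodic[of b c \<alpha> UNIV 0] sides sin_pos
    by (simp add: areas emeasure_plane_Times)
qed

text \<open>By Fubini's theorem the probability is the mean over all directions of the probability for a fixed
direction. Being a probability, the polynomial in the widths is nonnegative, so that its Henstock-Kurzweil
integral yields the Lebesgue integral.\<close>

lemma hit_prob_rectangle:
  assumes gh: "0 < g" "0 < h" and C: "C = (\<lambda>p. v + rot \<theta> p) ` ({0..g} \<times> {0..h})"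
    and fits: "\<And>\<phi>. \<phi> \<in> {0..2 * pi} \<Longrightarrow> c_star C \<alpha> \<beta> \<phi> \<le> c" and k: "1 \<le> k" "k \<le> 6"
    and I: "((\<lambda>\<phi>. count_prob ((b / Q) * rect_width g h (\<phi> + (\<alpha> + pi / 2 + \<theta>) - \<alpha>)) ((c / Q) * rect_width g h (\<phi> + (\<alpha> + pi / 2 + \<theta>)))
       ((a / Q) * rect_width g h (\<phi> + (\<alpha> + pi / 2 + \<theta>) + \<beta>)) (g * h / Q) k) has_integral 2 * pi * r) {0..2 * pi}"
  shows "hit_prob b c \<alpha> \<beta> C k = r"
proof -
  let ?q = "\<lambda>\<phi>. count_prob ((b / Q) * rect_width g h (\<phi> + (\<alpha> + pi / 2 + \<theta>) - \<alpha>)) ((c / Q) * rect_width g h (\<phi> + (\<alpha> + pi / 2 + \<theta>)))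
       ((a / Q) * rect_width g h (\<phi> + (\<alpha> + pi / 2 + \<theta>) + \<beta>)) (g * h / Q) k"
  let ?P = "uniform_measure lborel (lattice_parallelogram b c \<alpha>)" and ?A = "uniform_measure lborel {0..2 * pi}"
  let ?E = "{x. hit_count b c \<alpha> \<beta> C (fst x) (snd x) = k}"
  interpret P: prob_space ?P
    by (rule prob_space_uniform_measure) (use emeasure_parallelogram Q_pos in auto)
  interpret A: prob_space ?A
    by (rule prob_space_uniform_measure) auto
  interpret PA: pair_sigma_finite ?P ?A ..
  have "compact C"
  proof -
    have "continuous_on ({0..g} \<times> {0..h}) (\<lambda>p. v + rot \<theta> p)"
      unfolding rot_def by (intro continuous_intros)
    then show ?thesis unfolding C by (intro compact_continuous_image compact_Times) auto
  qed
  then have E_borel: "?E \<in> sets borel" by (rule measurable_hit_count)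
  have "sets (?P \<Otimes>\<^sub>M ?A) = sets (borel \<Otimes>\<^sub>M borel)"
    by (intro sets_pair_measure_cong) simp_all
  then have "sets (?P \<Otimes>\<^sub>M ?A) = sets borel" by (simp only: borel_prod)
  then have E: "?E \<in> sets (?P \<Otimes>\<^sub>M ?A)" using E_borel by blast
  have slice: "emeasure ?P ((\<lambda>x. (x, \<phi>)) -` ?E) = ennreal (?q \<phi>) \<and> 0 \<le> ?q \<phi>" if \<phi>: "\<phi> \<in> {0..2 * pi}" for \<phi>
  proof -
    have \<psi>: "\<phi> + (\<alpha> + pi / 2 + \<theta>) = \<phi> + \<alpha> + pi / 2 + \<theta>" by simp
    have m: "(\<lambda>x. (x, \<phi>)) -` ?E \<in> sets borel"
      using measurable_sets[OF borel_measurable_continuous_onI E_borel, of "\<lambda>x. (x, \<phi>)"]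
      by (simp add: continuous_intros)
    note hc = emeasure_hit_count[OF gh C \<psi> fits[OF \<phi>] k]
    have "emeasure ?P ((\<lambda>x. (x, \<phi>)) -` ?E) = ennreal (Q * ?q \<phi>) / ennreal Q"
      using m parallelogram_borel hc by (simp add: emeasure_parallelogram vimage_def)
    also have "\<dots> = ennreal (?q \<phi>)" using hc Q_pos by (simp add: divide_ennreal)
    finally show ?thesis using hc by simp
  qed
  have "0 \<le> 2 * pi * r" using I slice by (intro has_integral_nonneg[OF I]) auto
  then have r: "0 \<le> r" using pi_gt_zero by (auto simp: zero_le_mult_iff)
  have "emeasure (random_throw b c \<alpha>) ?E = (\<integral>\<^sup>+\<phi>. emeasure ?P ((\<lambda>x. (x, \<phi>)) -` ?E) \<partial>?A)"
    unfolding random_throw_def by (rule PA.emeasure_pair_measure_alt2[OF E])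
  also have "\<dots> = (\<integral>\<^sup>+\<phi>. emeasure ?P ((\<lambda>x. (x, \<phi>)) -` ?E) * indicator {0..2 * pi} \<phi> \<partial>lborel) / emeasure lborel {0..2 * pi}"
  proof (rule nn_integral_uniform_measure)
    have "(\<lambda>\<phi>. emeasure ?P ((\<lambda>x. (x, \<phi>)) -` ?E)) \<in> borel_measurable ?A"
      using PA.measurable_emeasure_Pair2[OF E] .
    then show "(\<lambda>\<phi>. emeasure ?P ((\<lambda>x. (x, \<phi>)) -` ?E)) \<in> borel_measurable lborel" by simp
  qed simp
  also have "(\<integral>\<^sup>+\<phi>. emeasure ?P ((\<lambda>x. (x, \<phi>)) -` ?E) * indicator {0..2 * pi} \<phi> \<partial>lborel) =
      (\<integral>\<^sup>+\<phi>. ennreal (indicator {0..2 * pi} \<phi> * ?q \<phi>) \<partial>lborel)"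
    by (rule nn_integral_cong) (use slice in \<open>auto split: split_indicator\<close>)
  also have "\<dots> = ennreal (2 * pi * r)"
    by (rule nn_integral_has_integral_lebesgue[OF _ I]) (use slice in auto)
  also have "ennreal (2 * pi * r) / emeasure lborel {0..2 * pi} = ennreal r"
    using r by (simp add: divide_ennreal)
  finally have "emeasure (random_throw b c \<alpha>) ?E = ennreal r" .
  moreover have "{(P, \<phi>). hit_count b c \<alpha> \<beta> C P \<phi> = k} = ?E" by auto
  ultimately show ?thesis
    unfolding hit_prob_def using r by (simp add: measure_def)
qed

end

section \<open>The hitting probabilities\<close>

text \<open>Here $m_1$, $m_2$ and $m_{11}$ are the means over all directions of the sum of the three widths, of the sum
of their squares and of the sum of their products in pairs; the probabilities for a fixed direction are
combinations of these.\<close>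

lemma (in lattice_triangle) hit_prob_values:
  assumes gh: "0 < g" "0 < h" and C: "C = (\<lambda>p. v + rot \<theta> p) ` ({0..g} \<times> {0..h})"
    and fits: "\<forall>\<phi>\<in>{0..2 * pi}. c_star C \<alpha> \<beta> \<phi> \<le> c" and obtuse: "pi / 2 \<le> \<alpha>"
  defines "m1 \<equiv> 4 * (a + b + c) * (g + h) / Q / (2 * pi)"
    and "m2 \<equiv> (a\<^sup>2 + b\<^sup>2 + c\<^sup>2) * (pi * (g\<^sup>2 + h\<^sup>2) + 4 * (g * h)) / Q\<^sup>2 / (2 * pi)"
    and "m11 \<equiv> ((g\<^sup>2 + h\<^sup>2) * (6 * Q - pi * (a\<^sup>2 + b\<^sup>2 + c\<^sup>2) / 2 + 2 * (\<alpha> * a\<^sup>2 + \<beta> * b\<^sup>2 + \<gamma> * c\<^sup>2))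
       + 2 * (g * h) * (3 * a\<^sup>2 - b\<^sup>2 - c\<^sup>2 + 4 * Q * (pi - \<alpha>))) / Q\<^sup>2 / (2 * pi)"
  shows "hit_prob b c \<alpha> \<beta> C 1 = 1 - m1 + m2 / 4 + m11 / 2"
    and "hit_prob b c \<alpha> \<beta> C 2 = m1 - 3 * m2 / 4 - m11 / 2"
    and "hit_prob b c \<alpha> \<beta> C 3 = 3 * m2 / 4 - m11 / 2"
    and "hit_prob b c \<alpha> \<beta> C 4 = - (g * h / Q) - m2 / 4 + m11 / 2"
    and "hit_prob b c \<alpha> \<beta> C 5 = 0"
    and "hit_prob b c \<alpha> \<beta> C 6 = g * h / Q"
proof -
  let ?t = "\<alpha> + pi / 2 + \<theta>"
  define A B W where "A = (\<lambda>x. (b / Q) * rect_width g h (x + ?t - \<alpha>))" and "B = (\<lambda>x. (c / Q) * rect_width g h (x + ?t))"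
    and "W = (\<lambda>x. (a / Q) * rect_width g h (x + ?t + \<beta>))"
  note I = has_integral_width_products[OF gh obtuse, of ?t, folded A_def B_def W_def]
  have m: "4 * (a + b + c) * (g + h) / Q = 2 * pi * m1"
    "(a\<^sup>2 + b\<^sup>2 + c\<^sup>2) * (pi * (g\<^sup>2 + h\<^sup>2) + 4 * (g * h)) / Q\<^sup>2 = 2 * pi * m2"
    "((g\<^sup>2 + h\<^sup>2) * (6 * Q - pi * (a\<^sup>2 + b\<^sup>2 + c\<^sup>2) / 2 + 2 * (\<alpha> * a\<^sup>2 + \<beta> * b\<^sup>2 + \<gamma> * c\<^sup>2))
       + 2 * (g * h) * (3 * a\<^sup>2 - b\<^sup>2 - c\<^sup>2 + 4 * Q * (pi - \<alpha>))) / Q\<^sup>2 = 2 * pi * m11"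
    by (simp_all add: m1_def m2_def m11_def)
  have comb: "hit_prob b c \<alpha> \<beta> C k = c0 + c1 * m1 + c2 * m2 + c11 * m11"
    if k: "1 \<le> k" "k \<le> 6" and q: "\<And>A B W. count_prob A B W (g * h / Q) k =
      c0 + c1 * (A + B + W) + c2 * (A\<^sup>2 + B\<^sup>2 + W\<^sup>2) + c11 * (A * B + A * W + B * W)" for k c0 c1 c2 c11
  proof (rule hit_prob_rectangle[OF gh C bspec[OF fits] k])
    have c: "((\<lambda>x. c0) has_integral (2 * pi - 0) *\<^sub>R c0) {0..2 * pi}"
      using has_integral_const_real[of c0 0 "2 * pi"] by simp
    note has_integral_add[OF has_integral_add[OF has_integral_add[OF c has_integral_mult_right[OF I(1), of c1]]
        has_integral_mult_right[OF I(2), of c2]] has_integral_mult_right[OF I(3), of c11]]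
    then show "((\<lambda>\<phi>. count_prob (b / Q * rect_width g h (\<phi> + ?t - \<alpha>)) (c / Q * rect_width g h (\<phi> + ?t)) (a / Q * rect_width g h (\<phi> + ?t + \<beta>)) (g * h / Q) k)
        has_integral 2 * pi * (c0 + c1 * m1 + c2 * m2 + c11 * m11)) {0..2 * pi}"
      unfolding q A_def B_def W_def m by (rule has_integral_eq_rhs) (simp add: algebra_simps)
  qed
  show "hit_prob b c \<alpha> \<beta> C 1 = 1 - m1 + m2 / 4 + m11 / 2"
    using comb[of 1 1 "- 1" "1 / 4" "1 / 2"] by (simp add: count_prob_def power2_eq_square field_simps)
  show "hit_prob b c \<alpha> \<beta> C 2 = m1 - 3 * m2 / 4 - m11 / 2"
    using comb[of 2 0 1 "- 3 / 4" "- 1 / 2"] by (simp add: count_prob_def)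
  show "hit_prob b c \<alpha> \<beta> C 3 = 3 * m2 / 4 - m11 / 2"
    using comb[of 3 0 0 "3 / 4" "- 1 / 2"] by (simp add: count_prob_def)
  show "hit_prob b c \<alpha> \<beta> C 4 = - (g * h / Q) - m2 / 4 + m11 / 2"
    using comb[of 4 "- (g * h / Q)" 0 "- 1 / 4" "1 / 2"] by (simp add: count_prob_def)
  show "hit_prob b c \<alpha> \<beta> C 5 = 0"
    using comb[of 5 0 0 0 0] by (simp add: count_prob_def)
  show "hit_prob b c \<alpha> \<beta> C 6 = g * h / Q"
    using comb[of 6 "g * h / Q" 0 0 0] by (simp add: count_prob_def)
qed

theorem corollary3:
  fixes a b c \<alpha> \<beta> \<gamma> g h u F Q :: real
    and C :: "point set"
    and p :: "nat \<Rightarrow> real"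
  assumes triangle: "triangle_sides_angles a b c \<alpha> \<beta> \<gamma>"
    and obtuse_or_right: "pi / 2 \<le> \<alpha>" "\<alpha> < pi"
    and sides: "g > 0" "h > 0"
    and rectangle: "is_rectangle g h C"
    and reference_point: "(0, 0) \<in> C"
    and fits: "\<forall>\<phi>\<in>{0..<2 * pi}. c_star C \<alpha> \<beta> \<phi> \<le> c"
    and u: "u = 2 * (g + h)"
    and F: "F = g * h"
    and Q: "Q = a * b * sin \<gamma>"
    and p: "p = hit_prob b c \<alpha> \<beta> C"
  shows "p 1 = 1 - (a + b + c) * u / (pi * Q)
      + (\<alpha> * a^2 + \<beta> * b^2 + \<gamma> * c^2) * (g^2 + h^2) / (2 * pi * Q^2)
      + 3 * (g^2 + h^2) / (2 * pi * Q)
      + 2 * a^2 * F / (pi * Q^2) + 2 * F / Q - 2 * \<alpha> * F / (pi * Q)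
    \<and> p 2 = (a + b + c) * u / (pi * Q)
      - (a^2 + b^2 + c^2) * (g^2 + h^2) / (4 * Q^2)
      - (\<alpha> * a^2 + \<beta> * b^2 + \<gamma> * c^2) * (g^2 + h^2) / (2 * pi * Q^2)
      - 3 * (g^2 + h^2) / (2 * pi * Q)
      - (3 * a^2 + b^2 + c^2) * F / (pi * Q^2) - 2 * F / Q + 2 * \<alpha> * F / (pi * Q)
    \<and> p 3 = (a^2 + b^2 + c^2) * (g^2 + h^2) / (2 * Q^2)
      - (\<alpha> * a^2 + \<beta> * b^2 + \<gamma> * c^2) * (g^2 + h^2) / (2 * pi * Q^2)
      - 3 * (g^2 + h^2) / (2 * pi * Q)
      + 2 * (b^2 + c^2) * F / (pi * Q^2) - 2 * F / Q + 2 * \<alpha> * F / (pi * Q)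
    \<and> p 4 = 3 * (g^2 + h^2) / (2 * pi * Q)
      - (a^2 + b^2 + c^2) * (g^2 + h^2) / (4 * Q^2)
      + (\<alpha> * a^2 + \<beta> * b^2 + \<gamma> * c^2) * (g^2 + h^2) / (2 * pi * Q^2)
      - (b^2 + c^2 - a^2) * F / (pi * Q^2) + F / Q - 2 * \<alpha> * F / (pi * Q)
    \<and> p 5 = 0
    \<and> p 6 = F / Q"
proof -
  note laws = triangle_laws[OF triangle] and gh = sides
  interpret lattice_triangle a b c \<alpha> \<beta> \<gamma> Q
    by unfold_locales (use laws in \<open>simp_all add: Q\<close>)
  obtain v \<theta> where C: "C = (\<lambda>p. v + rot \<theta> p) ` ({0..g} \<times> {0..h})"
    using rectangle unfolding is_rectangle_def by blast
  have rot_period: "rot (2 * pi + x) = rot (0 + x)" for x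
    using sin_periodic[of x] cos_periodic[of x] by (simp add: rot_def fun_eq_iff add.commute)
  have "rot (2 * pi) = rot 0" "rot (2 * pi + x + y) = rot (0 + x + y)" for x y
    using rot_period[of 0] rot_period[of "x + y"] by (simp_all add: add.assoc)
  then have "c_star C \<alpha> \<beta> (2 * pi) = c_star C \<alpha> \<beta> 0"
    unfolding c_star_def support_fun_def by (simp only:)
  \<comment> \<open>The angle of a throw is taken from the closed interval, whose end point repeats the start.\<close>
  then have fits': "\<forall>\<phi>\<in>{0..2 * pi}. c_star C \<alpha> \<beta> \<phi> \<le> c"
    using fits by (metis atLeastAtMost_iff atLeastLessThan_iff order_le_less pi_gt_zero zero_less_mult_iff zero_less_numeral)
  have Q0: "Q \<noteq> 0" using Q_pos by simp
  define L G S T where "L = a + b + c" and "G = g\<^sup>2 + h\<^sup>2" and "S = a\<^sup>2 + b\<^sup>2 + c\<^sup>2" and "T = \<alpha> * a\<^sup>2 + \<beta> * b\<^sup>2 + \<gamma> * c\<^sup>2"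
  have m1: "4 * L * (g + h) / Q / (2 * pi) = L * u / (pi * Q)"
    unfolding u using Q0 by (simp add: field_simps)
  have m2: "S * (pi * G + 4 * F) / Q\<^sup>2 / (2 * pi) = S * G / (2 * Q\<^sup>2) + 2 * S * F / (pi * Q\<^sup>2)"
    using Q0 by (simp add: field_simps)
  have m11: "(G * (6 * Q - pi * S / 2 + 2 * T) + 2 * F * (3 * a\<^sup>2 - b\<^sup>2 - c\<^sup>2 + 4 * Q * (pi - \<alpha>))) / Q\<^sup>2 / (2 * pi) =
     3 * G / (pi * Q) - S * G / (4 * Q\<^sup>2) + T * G / (pi * Q\<^sup>2) + (4 * a\<^sup>2 - S) * F / (pi * Q\<^sup>2) + 4 * F / Q - 4 * \<alpha> * F / (pi * Q)"
    using Q0 unfolding S_def by (simp add: field_simps power2_eq_square)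
  note vals = hit_prob_values[OF gh C fits' obtuse_or_right(1), folded p F L_def G_def S_def T_def, unfolded m1 m2 m11]
  have bc: "(3 * a\<^sup>2 + b\<^sup>2 + c\<^sup>2) = 2 * a\<^sup>2 + S" "b\<^sup>2 + c\<^sup>2 = S - a\<^sup>2" "b\<^sup>2 + c\<^sup>2 - a\<^sup>2 = S - 2 * a\<^sup>2"
    by (simp_all add: S_def)
  show ?thesis
    unfolding vals L_def[symmetric] G_def[symmetric] S_def[symmetric] T_def[symmetric] bc
    by (simp add: add_divide_distrib diff_divide_distrib ring_distribs mult_ac)
qed

end
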